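(* There exist universal constants $C_1,C_2,C_3>0$ such that the following holds. Let $1\le r\le n$ and $m\ge C_1 n r$ be integers, let $a_1,\dots,a_m\in\mathbb{C}^n$ be independent standard (complex) Gaussian random vectors, and let $\mathcal{A}:\mathcal{H}_n\to\mathbb{R}^m$ be the linear map $\mathcal{A}(Z)=\big(\mathrm{tr}(Z a_ja_j^* )\big)_{j=1}^m$. Then with probability at least $1-e^{-C_2 m}$ the following holds simultaneously for all positive semidefinite matrices $X\in\mathcal{H}_n$ of rank at most $r$, all $\eta\ge 0$ and all $\epsilon\in\mathbb{R}^m$ with $\|\epsilon\|_{\ell_2}\le\eta$: setting $b=\mathcal{A}(X)+\epsilon$, any solution $X^\#$ of the convex optimization problem $$\underset{Z\in\mathcal{H}_n}{\text{minimize}}\ \|Z\|_1\quad\text{subject to}\quad \|\mathcal{A}(Z)-b\|_{\ell_2}\le\eta$$ satisfies $$\|X-X^\#\|_2\le \frac{C_3\,\eta}{\sqrt m}.$$ (In particular, for $\eta=0$ one has exact reconstruction $X^\#=X$.)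
   Context: $\mathcal{H}_n$ is the real vector space of Hermitian $n\times n$ complex matrices. For $Z\in\mathcal{H}_n$, $\|Z\|_1$ is the nuclear norm (sum of singular values) and $\|Z\|_2$ is the Frobenius norm. $\|\cdot\|_{\ell_2}$ is the Euclidean norm. A standard Gaussian random vector in $\mathbb{C}^n$ has independent entries of the form $g+\mathrm{i}h$ with $g,h$ independent real $\mathcal{N}(0,1/2)$ random variables. "Universal" means that the constants do not depend on $n,r,m$ or any other parameter. *)

theory Defs
  imports
    "HOL-Probability.Probability"
    "Jordan_Normal_Form.Spectral_Radius"
    "Jordan_Normal_Form.Schur_Decomposition"
    "Jordan_Normal_Form.DL_Rank"
begin

text \<open>Since the dimensions are quantified after the universal constants, vectors and
  matrices are those of \<^theory>\<open>Jordan_Normal_Form.Matrix\<close>, which carry their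
  dimensions at the value level; indices start at 0.\<close>

no_notation vec_nth (infixl \<open>$\<close> 90)
hide_const (open) Finite_Cartesian_Product.vec Finite_Cartesian_Product.mat

definition hermitian_mats :: "nat \<Rightarrow> complex mat set" where
  "hermitian_mats n = {Z \<in> carrier_mat n n. mat_adjoint Z = Z}"

text \<open>In the order on \<^typ>\<open>complex\<close>, \<open>0 \<le> z\<close> means that \<open>z\<close> is real and nonnegative.\<close>

definition psd_mat :: "nat \<Rightarrow> complex mat \<Rightarrow> bool" where
  "psd_mat n X \<longleftrightarrow> X \<in> hermitian_mats n \<and> (\<forall>v \<in> carrier_vec n. 0 \<le> (X *\<^sub>v v) \<bullet>c v)"

definition mat_trace :: "complex mat \<Rightarrow> complex" where
  "mat_trace A = (\<Sum>i<dim_row A. A $$ (i, i))"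

definition singular_values :: "complex mat \<Rightarrow> real multiset" where
  "singular_values A = image_mset (\<lambda>z. sqrt (Re z)) (proots (char_poly (mat_adjoint A * A)))"

definition nuclear_norm :: "complex mat \<Rightarrow> real" where
  "nuclear_norm A = sum_mset (singular_values A)"

definition frobenius_norm :: "complex mat \<Rightarrow> real" where
  "frobenius_norm A = sqrt (\<Sum>i<dim_row A. \<Sum>j<dim_col A. (cmod (A $$ (i, j)))\<^sup>2)"

definition l2_norm :: "real vec \<Rightarrow> real" where
  "l2_norm v = L2_set (\<lambda>i. v $ i) {..<dim_vec v}"

definition outer_self :: "complex vec \<Rightarrow> complex mat" where
  "outer_self v = mat (dim_vec v) (dim_vec v) (\<lambda>(i, j). v $ i * cnj (v $ j))"

text \<open>The trace below is real whenever \<open>Z\<close> is Hermitian.\<close>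

definition measurement :: "nat \<Rightarrow> (nat \<Rightarrow> complex vec) \<Rightarrow> complex mat \<Rightarrow> real vec" where
  "measurement m a Z = vec m (\<lambda>j. Re (mat_trace (Z * outer_self (a j))))"

definition feasible_set ::
  "nat \<Rightarrow> nat \<Rightarrow> (nat \<Rightarrow> complex vec) \<Rightarrow> real vec \<Rightarrow> real \<Rightarrow> complex mat set" where
  "feasible_set n m a b \<eta> = {Z \<in> hermitian_mats n. l2_norm (measurement m a Z - b) \<le> \<eta>}"

definition is_solution ::
  "nat \<Rightarrow> nat \<Rightarrow> (nat \<Rightarrow> complex vec) \<Rightarrow> real vec \<Rightarrow> real \<Rightarrow> complex mat \<Rightarrow> bool" where
  "is_solution n m a b \<eta> Y \<longleftrightarrow>
     Y \<in> feasible_set n m a b \<eta> \<and> (\<forall>Z \<in> feasible_set n m a b \<eta>. nuclear_norm Y \<le> nuclear_norm Z)"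

text \<open>The second parameter of \<^const>\<open>normal_density\<close> is the standard deviation, so the real
  and imaginary parts have variance \<open>1/2\<close>.\<close>

definition complex_gaussian :: "complex measure" where
  "complex_gaussian =
     distr (density lborel (normal_density 0 (sqrt (1/2))) \<Otimes>\<^sub>M
            density lborel (normal_density 0 (sqrt (1/2))))
       borel (\<lambda>(x, y). Complex x y)"

text \<open>The joint law of \<open>m\<close> independent standard Gaussian vectors in \<open>\<complex>\<^sup>n\<close>; the entry \<open>k\<close>
  of the vector \<open>j\<close> of a sample \<open>\<omega>\<close> is \<open>\<omega> j k\<close>.\<close>

definition gaussian_vectors :: "nat \<Rightarrow> nat \<Rightarrow> (nat \<Rightarrow> nat \<Rightarrow> complex) measure" where
  "gaussian_vectors n m = (\<Pi>\<^sub>M j\<in>{..<m}. \<Pi>\<^sub>M k\<in>{..<n}. complex_gaussian)"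

text \<open>Working with this law instead of random vectors on an arbitrary probability space loses
  nothing: any such family has it as its joint distribution. It does make the constants of a
  theorem independent of the type of the sample space.\<close>

lemma sets_complex_gaussian [simp, measurable_cong]: "sets complex_gaussian = sets borel"
  by (simp add: complex_gaussian_def)

lemma (in prob_space) distr_complex_gaussian:
  fixes Z :: "'a \<Rightarrow> complex"
  assumes Z: "random_variable borel Z"
    and indep: "indep_var borel (\<lambda>\<omega>. Re (Z \<omega>)) borel (\<lambda>\<omega>. Im (Z \<omega>))"
    and re: "distributed M lborel (\<lambda>\<omega>. Re (Z \<omega>)) (normal_density 0 (sqrt (1/2)))"
    and im: "distributed M lborel (\<lambda>\<omega>. Im (Z \<omega>)) (normal_density 0 (sqrt (1/2)))"
  shows "distr M borel Z = complex_gaussian"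
proof -
  let ?N = "density lborel (normal_density 0 (sqrt (1/2)))"
  have [measurable]: "Z \<in> borel_measurable M" by (rule Z)
  have C[measurable]: "(\<lambda>(x, y). Complex x y) \<in> borel_measurable (borel \<Otimes>\<^sub>M borel)"
    by (simp add: Complex_eq split_beta')
  have d: "distr M borel (\<lambda>\<omega>. Re (Z \<omega>)) = ?N" "distr M borel (\<lambda>\<omega>. Im (Z \<omega>)) = ?N"
    using distributed_distr_eq_density[OF re] distributed_distr_eq_density[OF im]
    by (metis distr_cong sets_lborel)+
  have "?N \<Otimes>\<^sub>M ?N = distr M (borel \<Otimes>\<^sub>M borel) (\<lambda>\<omega>. (Re (Z \<omega>), Im (Z \<omega>)))"
    using indep unfolding indep_var_distribution_eq d by simp
  then show ?thesis
    unfolding complex_gaussian_def by (simp add: distr_distr comp_def)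
qed

lemma (in prob_space) distr_gaussian_vectors:
  fixes a :: "nat \<Rightarrow> nat \<Rightarrow> 'a \<Rightarrow> complex"
  assumes "0 < n" "0 < m"
    and vectors: "indep_vars (\<lambda>_. \<Pi>\<^sub>M k\<in>{..<n}. borel) (\<lambda>j \<omega>. \<lambda>k\<in>{..<n}. a j k \<omega>) {..<m}"
    and entries: "\<And>j. j < m \<Longrightarrow> indep_vars (\<lambda>_. borel) (a j) {..<n}"
    and parts: "\<And>j k. j < m \<Longrightarrow> k < n \<Longrightarrow>
      indep_var borel (\<lambda>\<omega>. Re (a j k \<omega>)) borel (\<lambda>\<omega>. Im (a j k \<omega>))"
    and re: "\<And>j k. j < m \<Longrightarrow> k < n \<Longrightarrow>
      distributed M lborel (\<lambda>\<omega>. Re (a j k \<omega>)) (normal_density 0 (sqrt (1/2)))"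
    and im: "\<And>j k. j < m \<Longrightarrow> k < n \<Longrightarrow>
      distributed M lborel (\<lambda>\<omega>. Im (a j k \<omega>)) (normal_density 0 (sqrt (1/2)))"
  shows "distr M (\<Pi>\<^sub>M j\<in>{..<m}. \<Pi>\<^sub>M k\<in>{..<n}. borel) (\<lambda>\<omega>. \<lambda>j\<in>{..<m}. \<lambda>k\<in>{..<n}. a j k \<omega>)
    = gaussian_vectors n m"
proof -
  have rv: "random_variable borel (a j k)" if "j < m" "k < n" for j k
    using entries[OF that(1)] that(2) unfolding indep_vars_def by auto
  have row: "distr M (\<Pi>\<^sub>M k\<in>{..<n}. borel) (\<lambda>\<omega>. \<lambda>k\<in>{..<n}. a j k \<omega>)
      = (\<Pi>\<^sub>M k\<in>{..<n}. complex_gaussian)" if j: "j < m" for j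
  proof -
    have "distr M (\<Pi>\<^sub>M k\<in>{..<n}. borel) (\<lambda>\<omega>. \<lambda>k\<in>{..<n}. a j k \<omega>)
        = (\<Pi>\<^sub>M k\<in>{..<n}. distr M borel (a j k))"
      using indep_vars_iff_distr_eq_PiM'[where I = "{..<n}" and M' = "\<lambda>_. borel" and X = "a j"] entries[OF j] rv j \<open>0 < n\<close>
      by auto
    also have "\<dots> = (\<Pi>\<^sub>M k\<in>{..<n}. complex_gaussian)"
      by (intro PiM_cong refl distr_complex_gaussian rv parts re im j) auto
    finally show ?thesis .
  qed
  have "distr M (\<Pi>\<^sub>M j\<in>{..<m}. \<Pi>\<^sub>M k\<in>{..<n}. borel) (\<lambda>\<omega>. \<lambda>j\<in>{..<m}. \<lambda>k\<in>{..<n}. a j k \<omega>)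
      = (\<Pi>\<^sub>M j\<in>{..<m}. distr M (\<Pi>\<^sub>M k\<in>{..<n}. borel) (\<lambda>\<omega>. \<lambda>k\<in>{..<n}. a j k \<omega>))"
    using indep_vars_iff_distr_eq_PiM'[where I = "{..<m}"
        and M' = "\<lambda>_. \<Pi>\<^sub>M k\<in>{..<n}. borel" and X = "\<lambda>j \<omega>. \<lambda>k\<in>{..<n}. a j k \<omega>"] vectors \<open>0 < m\<close>
    unfolding indep_vars_def by auto
  also have "\<dots> = gaussian_vectors n m"
    unfolding gaussian_vectors_def by (intro PiM_cong refl row) auto
  finally show ?thesis .
qed

end

theory Submission
  imports Defs
begin

text \<open>Put \<open>H = X\<^sup># - X\<close>. As \<open>X\<close> is feasible, the nuclear norm of \<open>X + H\<close> is at most that of \<open>X\<close>, which forces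
  \<open>H\<close> to have effective rank of order \<open>r\<close>: its trace against any \<open>M\<close> is at most \<open>3 \<surd>r\<close> times the operator norm of \<open>M\<close>
  times the Frobenius norm of \<open>H\<close>. As the residual \<open>A(H)\<close> has Euclidean norm at most \<open>2 \<eta>\<close>, it suffices to bound
  \<open>\<Sum>\<^sub>j min (\<bar>a\<^sub>j\<^sup>* H a\<^sub>j\<bar>) 1\<close> from below by a multiple of \<open>m\<close>, uniformly over such \<open>H\<close> of Frobenius norm 1.

  This is Mendelson's small-ball method. Each summand has expectation at least \<open>1/8\<close>. The exponential moment of
  the largest deviation over a finite set of matrices is estimated one measurement at a time: Hoeffding's
  lemma reduces it to an expectation, which symmetrization and contraction replace by that of the maximum of
  the linear process \<open>2 \<Sum>\<^sub>j \<epsilon>\<^sub>j a\<^sub>j\<^sup>* H a\<^sub>j\<close>. The latter is at most \<open>6 \<surd>r\<close> times the operator norm of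
  \<open>\<Sum>\<^sub>j \<epsilon>\<^sub>j a\<^sub>j a\<^sub>j\<^sup>*\<close>, controlled by a net of the unit ball. A countable dense set of matrices
  and continuity in \<open>H\<close> give the uniform bound on a measurable event.\<close>

subsection \<open>Rademacher processes and bounded deviations\<close>

text \<open>The forms \<open>a\<^sub>j\<^sup>* H a\<^sub>j\<close> are unbounded, with only
  exponential tails. A lower bound survives truncation, and \<open>trunc\<close> has the three
  properties required: it is at most \<bar>x\<bar>, its values lie in an interval of length 1 as
  Hoeffding's lemma demands, and it is 1-Lipschitz, so that contraction can remove it again after
  symmetrization.

  Treating the measurements one at a time gives concentration and the expectation bound by the same
  recursion: what has been sampled is absorbed in an offset \<open>g\<close>, and a random sign is
  just an average of two terms, so no independent family of signs has to be constructed.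

  Vectors and matrices are plain functions on \<open>nat\<close>, since samples of a product measure
  have this form and the product topology supplies separability and continuity. The type
  \<open>mat\<close> enters through facts of linear algebra (triangularization, inverses, rank) and
  through the statement itself.\<close>

definition trunc :: "real \<Rightarrow> real" where
  "trunc x = min \<bar>x\<bar> 1"

lemma trunc_bounds: "0 \<le> trunc x" "trunc x \<le> 1" "trunc x \<le> \<bar>x\<bar>"
  by (auto simp: trunc_def)

lemma trunc_lipschitz: "\<bar>trunc x - trunc y\<bar> \<le> \<bar>x - y\<bar>"
  by (auto simp: trunc_def min_def)

lemma trunc_measurable [measurable]: "trunc \<in> borel_measurable borel"
  unfolding trunc_def by measurable

lemma Max_le_Max_add:
  fixes f g :: "'t \<Rightarrow> real"
  assumes "finite T" "T \<noteq> {}" "\<And>t. t \<in> T \<Longrightarrow> f t \<le> g t + c"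
  shows "Max (f ` T) \<le> Max (g ` T) + c"
proof -
  have "f t \<le> Max (g ` T) + c" if "t \<in> T" for t
    using assms(3)[OF that] Max_ge[OF finite_imageI[OF assms(1)] imageI[OF that], of g] by linarith
  then show ?thesis using assms by auto
qed

lemma Max_image_add_le:
  fixes f g :: "'t \<Rightarrow> real"
  assumes "finite T" "T \<noteq> {}"
  shows "Max ((\<lambda>t. f t + g t) ` T) \<le> Max (f ` T) + Max (g ` T)"
proof -
  have "f t + g t \<le> Max (f ` T) + Max (g ` T)" if "t \<in> T" for t
    using assms that by (intro add_mono) auto
  then show ?thesis using assms by auto
qed

lemma Max_image_obtain:
  fixes f :: "'t \<Rightarrow> 'a :: linorder"
  assumes "finite T" "T \<noteq> {}"
  obtains t where "t \<in> T" "Max (f ` T) = f t"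
  using Max_in[of "f ` T"] assms by fastforce

text \<open>The comparison inequality of Ledoux and Talagrand for one Rademacher sign.\<close>

lemma Max_contraction:
  fixes g p q :: "'t \<Rightarrow> real"
  assumes T: "finite T" "T \<noteq> {}"
    and pq: "\<And>s t. s \<in> T \<Longrightarrow> t \<in> T \<Longrightarrow> \<bar>q s - q t\<bar> \<le> \<bar>p s - p t\<bar>"
  shows "Max ((\<lambda>t. g t + q t) ` T) + Max ((\<lambda>t. g t - q t) ` T)
    \<le> Max ((\<lambda>t. g t + p t) ` T) + Max ((\<lambda>t. g t - p t) ` T)"
proof -
  obtain s where s: "s \<in> T" "Max ((\<lambda>t. g t + q t) ` T) = g s + q s"
    by (rule Max_image_obtain[OF T])
  obtain t where t: "t \<in> T" "Max ((\<lambda>t. g t - q t) ` T) = g t - q t"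
    by (rule Max_image_obtain[OF T])
  have m: "f u \<le> Max (f ` T)" if "u \<in> T" for u and f :: "'t \<Rightarrow> real"
    using T that by simp
  \<comment> \<open>Testing the two maxima at \<open>s\<close> and \<open>t\<close>, or at
    \<open>t\<close> and \<open>s\<close>, bounds the right side below by \<open>g s + g t\<close>
    plus or minus \<open>p s - p t\<close>, hence plus \<bar>p s - p t\<bar>, which dominates
    \<open>q s - q t\<close>.\<close>
  have "g s + p s \<le> Max ((\<lambda>t. g t + p t) ` T)" "g t + p t \<le> Max ((\<lambda>t. g t + p t) ` T)"
    "g s - p s \<le> Max ((\<lambda>t. g t - p t) ` T)" "g t - p t \<le> Max ((\<lambda>t. g t - p t) ` T)"
    using m[OF s(1), of "\<lambda>t. g t + p t"] m[OF t(1), of "\<lambda>t. g t + p t"]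
      m[OF s(1), of "\<lambda>t. g t - p t"] m[OF t(1), of "\<lambda>t. g t - p t"] by simp_all
  then show ?thesis unfolding s(2) t(2) using pq[OF s(1) t(1)] by linarith
qed

section \<open>Expected maxima of symmetrized finite processes\<close>

locale finite_process = prob_space N for N :: "'x measure" +
  fixes T :: "'t set" and p :: "'x \<Rightarrow> 't \<Rightarrow> real"
  assumes T: "finite T" "T \<noteq> {}"
    and p_int: "\<And>t. t \<in> T \<Longrightarrow> integrable N (\<lambda>x. p x t)"
begin

lemma p_measurable [measurable]: "t \<in> T \<Longrightarrow> (\<lambda>x. p x t) \<in> borel_measurable N"
  by (rule borel_measurable_integrable[OF p_int])

text \<open>\<open>rad k g\<close> is the expectation of the maximum of \<open>g t + 2 (\<epsilon>\<^sub>1 p x\<^sub>1 t + \<dots> + \<epsilon>\<^sub>k p x\<^sub>k t)\<close>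
  for independent samples \<open>x\<^sub>j\<close> and independent signs \<open>\<epsilon>\<^sub>j\<close>.\<close>

primrec rad :: "nat \<Rightarrow> ('t \<Rightarrow> real) \<Rightarrow> real" where
  "rad 0 g = Max (g ` T)"
| "rad (Suc k) g = (\<integral>x. (rad k (\<lambda>t. g t + 2 * p x t) + rad k (\<lambda>t. g t - 2 * p x t)) / 2 \<partial>N)"

lemma rad_cong: "(\<And>t. t \<in> T \<Longrightarrow> g t = h t) \<Longrightarrow> rad k g = rad k h"
proof (induction k arbitrary: g h)
  case 0
  then have "g ` T = h ` T" by (intro image_cong) auto
  then show ?case by simp
next
  case (Suc k)
  have "rad k (\<lambda>t. g t + 2 * p x t) = rad k (\<lambda>t. h t + 2 * p x t)"
    "rad k (\<lambda>t. g t - 2 * p x t) = rad k (\<lambda>t. h t - 2 * p x t)" for x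
    by (rule Suc.IH, simp add: Suc.prems)+
  then show ?case by simp
qed

text \<open>The recursion integrates \<open>rad k\<close> along offsets that depend on the sample,
  so measurability in the offset is needed. Restricting offsets to \<open>T\<close>, which
  \<open>rad_cong\<close> permits, makes them points of a finite product space.\<close>

lemma rad_measurable_PiM: "rad k \<in> borel_measurable (\<Pi>\<^sub>M t\<in>T. borel)"
proof (induction k)
  case 0
  have "(\<lambda>g. Max (g ` T)) \<in> borel_measurable (\<Pi>\<^sub>M t\<in>T. borel :: real measure)"
    using T by measurable
  then show ?case by (simp cong: measurable_cong)
next
  case (Suc k)
  note [measurable] = Suc
  have 1: "rad k (\<lambda>t. g t + 2 * p x t) = rad k (\<lambda>t\<in>T. g t + 2 * p x t)"
    "rad k (\<lambda>t. g t - 2 * p x t) = rad k (\<lambda>t\<in>T. g t - 2 * p x t)" for g x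
    by (rule rad_cong, simp)+
  have "(\<lambda>g. \<integral>x. (rad k (\<lambda>t\<in>T. g t + 2 * p x t) + rad k (\<lambda>t\<in>T. g t - 2 * p x t)) / 2 \<partial>N)
      \<in> borel_measurable (\<Pi>\<^sub>M t\<in>T. borel)"
    by measurable
  then show ?case by (simp add: 1)
qed

lemma rad_measurable:
  assumes [measurable]: "\<And>t. t \<in> T \<Longrightarrow> (\<lambda>y. g y t) \<in> borel_measurable M"
  shows "(\<lambda>y. rad k (g y)) \<in> borel_measurable M"
proof -
  note [measurable] = rad_measurable_PiM
  have "rad k (g y) = rad k (\<lambda>t\<in>T. g y t)" for y
    by (rule rad_cong) simp
  moreover have "(\<lambda>y. rad k (\<lambda>t\<in>T. g y t)) \<in> borel_measurable M"
    by measurable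
  ultimately show ?thesis by simp
qed

text \<open>Integrability at level \<open>k\<close> follows from the Lipschitz bound at level
  \<open>k\<close>, which in turn needs integrability one level below. With the bound as a
  hypothesis, the induction in \<open>rad_lipschitz\<close> can use this lemma.\<close>

lemma rad_integrable_aux:
  assumes lip: "\<And>g h c. (\<And>t. t \<in> T \<Longrightarrow> g t \<le> h t + c) \<Longrightarrow> rad k g \<le> rad k h + c"
    and M: "prob_space M" and g: "\<And>t. t \<in> T \<Longrightarrow> integrable M (\<lambda>y. g y t)"
  shows "integrable M (\<lambda>y. rad k (g y))"
proof (rule Bochner_Integration.integrable_bound)
  note [measurable] = borel_measurable_integrable[OF g]
  interpret M: prob_space M by fact
  show "integrable M (\<lambda>y. \<bar>rad k (\<lambda>t. 0)\<bar> + (\<Sum>t\<in>T. \<bar>g y t\<bar>))"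
    by (intro Bochner_Integration.integrable_add Bochner_Integration.integrable_sum integrable_abs g) auto
  show "(\<lambda>y. rad k (g y)) \<in> borel_measurable M"
    by (rule rad_measurable) measurable
  have "\<bar>rad k (g y)\<bar> \<le> \<bar>rad k (\<lambda>t. 0)\<bar> + (\<Sum>t\<in>T. \<bar>g y t\<bar>)" for y
  proof -
    have "\<bar>g y t\<bar> \<le> (\<Sum>t\<in>T. \<bar>g y t\<bar>)" if "t \<in> T" for t
      using T that by (intro member_le_sum) auto
    then have b: "t \<in> T \<Longrightarrow> g y t \<le> 0 + (\<Sum>t\<in>T. \<bar>g y t\<bar>)" "t \<in> T \<Longrightarrow> 0 \<le> g y t + (\<Sum>t\<in>T. \<bar>g y t\<bar>)" for t
      by (smt (verit))+
    show ?thesis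
      using lip[of "g y" "\<lambda>t. 0", OF b(1)] lip[of "\<lambda>t. 0" "g y", OF b(2)]
      by (simp add: abs_le_iff) linarith
  qed
  then show "AE y in M. norm (rad k (g y)) \<le> norm (\<bar>rad k (\<lambda>t. 0)\<bar> + (\<Sum>t\<in>T. \<bar>g y t\<bar>))"
    by (intro AE_I2) (simp add: order_trans[OF _ abs_ge_self])
qed

lemma rad_lipschitz: "(\<And>t. t \<in> T \<Longrightarrow> g t \<le> h t + c) \<Longrightarrow> rad k g \<le> rad k h + c"
proof (induction k arbitrary: g h c)
  case 0
  then show ?case using Max_le_Max_add[OF T] by simp
next
  case (Suc k)
  have int: "integrable N (\<lambda>x. rad k (\<lambda>t. g t + 2 * p x t))"
    "integrable N (\<lambda>x. rad k (\<lambda>t. g t - 2 * p x t))" for g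
    by (rule rad_integrable_aux[OF _ prob_space_axioms], erule Suc.IH, simp add: p_int)+
  have mid: "(a + a') / 2 \<le> (b + b') / 2 + c" if "a \<le> b + c" "a' \<le> b' + c" for a a' b b' :: real
    using that by (simp add: field_simps)
  have "rad (Suc k) g \<le>
      (\<integral>x. (rad k (\<lambda>t. h t + 2 * p x t) + rad k (\<lambda>t. h t - 2 * p x t)) / 2 + c \<partial>N)"
    unfolding rad.simps
  proof (rule integral_mono)
    fix x
    have "rad k (\<lambda>t. g t + 2 * p x t) \<le> rad k (\<lambda>t. h t + 2 * p x t) + c"
      "rad k (\<lambda>t. g t - 2 * p x t) \<le> rad k (\<lambda>t. h t - 2 * p x t) + c"
      by (rule Suc.IH, use Suc.prems in force)+
    then show "(rad k (\<lambda>t. g t + 2 * p x t) + rad k (\<lambda>t. g t - 2 * p x t)) / 2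
        \<le> (rad k (\<lambda>t. h t + 2 * p x t) + rad k (\<lambda>t. h t - 2 * p x t)) / 2 + c"
      by (rule mid)
  qed (use int in auto)
  also have "\<dots> = rad (Suc k) h + c"
    using int by (simp add: prob_space)
  finally show ?case .
qed

lemma rad_integrable:
  assumes "prob_space M" "\<And>t. t \<in> T \<Longrightarrow> integrable M (\<lambda>y. g y t)"
  shows "integrable M (\<lambda>y. rad k (g y))"
  using assms by (intro rad_integrable_aux) (erule rad_lipschitz)

lemma rad_integrable_p:
  "integrable N (\<lambda>x. rad k (\<lambda>t. g t + 2 * p x t))"
  "integrable N (\<lambda>x. rad k (\<lambda>t. g t - 2 * p x t))"
  by (rule rad_integrable[OF prob_space_axioms], simp add: p_int)+

abbreviation mu :: "'t \<Rightarrow> real" where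
  "mu t \<equiv> (\<integral>x. trunc (p x t) \<partial>N)"

lemma trunc_p_integrable [simp]: "t \<in> T \<Longrightarrow> integrable N (\<lambda>x. trunc (p x t))"
  by (rule integrable_const_bound[of _ 1]) (auto simp: trunc_bounds)

text \<open>Jensen's inequality replaces \<open>mu t\<close> by an independent ghost sample
  \<open>y\<close>. Then \<open>g t + trunc (p y t) - trunc (p x t)\<close> is the mean of
  \<open>g t + 2 * trunc (p y t)\<close> and \<open>g t - 2 * trunc (p x t)\<close>, so the maximum
  splits in two. This splitting takes the place of the random sign and is the source of the factor 2
  in \<open>rad\<close>.\<close>

lemma rad_symmetrization_0:
  "(\<integral>x. rad 0 (\<lambda>t. g t + mu t - trunc (p x t)) \<partial>N) \<le> rad (Suc 0) g"
proof -
  note I = rad_integrable[OF prob_space_axioms, of _ 0, unfolded rad.simps]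
  have half: "(\<integral>x. (\<integral>y. a y / 2 \<partial>N) + b x / 2 \<partial>N) = (\<integral>x. (a x + b x) / 2 \<partial>N)"
    if "integrable N a" "integrable N b" for a b :: "'x \<Rightarrow> real"
    using that by (simp add: prob_space add_divide_distrib)
  have i1: "integrable N (\<lambda>x. Max ((\<lambda>t. g t + 2 * trunc (p x t)) ` T))"
    and i2: "integrable N (\<lambda>x. Max ((\<lambda>t. g t - 2 * trunc (p x t)) ` T))"
    by (rule I, intro Bochner_Integration.integrable_add Bochner_Integration.integrable_diff
        integrable_mult_right integrable_const trunc_p_integrable, assumption)+
  have 1: "(\<integral>x. rad 0 (\<lambda>t. g t + mu t - trunc (p x t)) \<partial>N)
    \<le> (\<integral>x. (\<integral>y. Max ((\<lambda>t. g t + 2 * trunc (p y t)) ` T) / 2 \<partial>N)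
          + Max ((\<lambda>t. g t - 2 * trunc (p x t)) ` T) / 2 \<partial>N)"
  proof (rule integral_mono)
    fix x
    have m: "Max ((\<lambda>t. g t + mu t - trunc (p x t)) ` T)
      \<le> (\<integral>y. Max ((\<lambda>t. g t + trunc (p y t) - trunc (p x t)) ` T) \<partial>N)"
    proof (subst Max_le_iff)
      show "\<forall>a\<in>(\<lambda>t. g t + mu t - trunc (p x t)) ` T.
          a \<le> (\<integral>y. Max ((\<lambda>t. g t + trunc (p y t) - trunc (p x t)) ` T) \<partial>N)"
      proof (clarify)
        fix t assume t: "t \<in> T"
        have "g t + mu t - trunc (p x t) = (\<integral>y. g t + trunc (p y t) - trunc (p x t) \<partial>N)"
          using t by (simp add: prob_space)
        also have "\<dots> \<le> (\<integral>y. Max ((\<lambda>t. g t + trunc (p y t) - trunc (p x t)) ` T) \<partial>N)"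
          using t T by (intro integral_mono I) auto
        finally show "g t + mu t - trunc (p x t)
          \<le> (\<integral>y. Max ((\<lambda>t. g t + trunc (p y t) - trunc (p x t)) ` T) \<partial>N)" .
      qed
    qed (use T in auto)
    also have "\<dots> \<le> (\<integral>y. Max ((\<lambda>t. g t + 2 * trunc (p y t)) ` T) / 2
          + Max ((\<lambda>t. g t - 2 * trunc (p x t)) ` T) / 2 \<partial>N)"
    proof (rule integral_mono)
      fix y
      have "Max ((\<lambda>t. g t + trunc (p y t) - trunc (p x t)) ` T)
        = Max ((\<lambda>t. (g t + 2 * trunc (p y t)) / 2 + (g t - 2 * trunc (p x t)) / 2) ` T)"
        by (intro arg_cong[where f = Max] image_cong) (auto simp: field_simps)
      also have "\<dots> \<le> Max ((\<lambda>t. (g t + 2 * trunc (p y t)) / 2) ` T)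
          + Max ((\<lambda>t. (g t - 2 * trunc (p x t)) / 2) ` T)"
        by (rule Max_image_add_le[OF T])
      also have "Max ((\<lambda>t. (g t + 2 * trunc (p y t)) / 2) ` T)
          = Max ((\<lambda>t. g t + 2 * trunc (p y t)) ` T) / 2"
        using mono_Max_commute[of "\<lambda>x::real. x / 2" "(\<lambda>t. g t + 2 * trunc (p y t)) ` T"] T
        by (simp add: image_image mono_def)
      also have "Max ((\<lambda>t. (g t - 2 * trunc (p x t)) / 2) ` T)
          = Max ((\<lambda>t. g t - 2 * trunc (p x t)) ` T) / 2"
        using mono_Max_commute[of "\<lambda>x::real. x / 2" "(\<lambda>t. g t - 2 * trunc (p x t)) ` T"] T
        by (simp add: image_image mono_def)
      finally show "Max ((\<lambda>t. g t + trunc (p y t) - trunc (p x t)) ` T)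
        \<le> Max ((\<lambda>t. g t + 2 * trunc (p y t)) ` T) / 2
          + Max ((\<lambda>t. g t - 2 * trunc (p x t)) ` T) / 2" .
    qed (auto intro!: I Bochner_Integration.integrable_add integrable_divide_zero)
    also have "\<dots> = (\<integral>y. Max ((\<lambda>t. g t + 2 * trunc (p y t)) ` T) / 2 \<partial>N)
          + Max ((\<lambda>t. g t - 2 * trunc (p x t)) ` T) / 2"
      by (subst Bochner_Integration.integral_add) (auto intro!: I simp: prob_space)
    finally show "rad 0 (\<lambda>t. g t + mu t - trunc (p x t)) \<le> \<dots>"
      by simp
  qed (auto intro!: I Bochner_Integration.integrable_add)
  have 2: "(\<integral>x. (\<integral>y. Max ((\<lambda>t. g t + 2 * trunc (p y t)) ` T) / 2 \<partial>N)
          + Max ((\<lambda>t. g t - 2 * trunc (p x t)) ` T) / 2 \<partial>N) = (\<integral>x. (Max ((\<lambda>t. g t + 2 * trunc (p x t)) ` T)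
      + Max ((\<lambda>t. g t - 2 * trunc (p x t)) ` T)) / 2 \<partial>N)"
    by (rule half[OF i1 i2])
  \<comment> \<open>Contraction applies because increments of \<open>2 * trunc\<close> are dominated
    by those of \<open>2 * p\<close>.\<close>
  have 3: "(\<integral>x. (Max ((\<lambda>t. g t + 2 * trunc (p x t)) ` T)
      + Max ((\<lambda>t. g t - 2 * trunc (p x t)) ` T)) / 2 \<partial>N)
    \<le> (\<integral>x. (Max ((\<lambda>t. g t + 2 * p x t) ` T) + Max ((\<lambda>t. g t - 2 * p x t) ` T)) / 2 \<partial>N)"
  proof (rule integral_mono)
    fix x
    show "(Max ((\<lambda>t. g t + 2 * trunc (p x t)) ` T) + Max ((\<lambda>t. g t - 2 * trunc (p x t)) ` T)) / 2
      \<le> (Max ((\<lambda>t. g t + 2 * p x t) ` T) + Max ((\<lambda>t. g t - 2 * p x t) ` T)) / 2"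
    proof (intro divide_right_mono Max_contraction[OF T])
      fix s t
      show "\<bar>2 * trunc (p x s) - 2 * trunc (p x t)\<bar> \<le> \<bar>2 * p x s - 2 * p x t\<bar>"
        using trunc_lipschitz[of "p x s" "p x t"] by linarith
    qed simp
  qed (intro integrable_divide_zero Bochner_Integration.integrable_add i1 i2
      rad_integrable_p[of 0, unfolded rad.simps])+
  show ?thesis using order.trans[OF 1[unfolded 2] 3] by simp
qed

text \<open>Fubini moves the new sample inside the outermost step of \<open>rad\<close>, whose
  increment joins the offset; the induction hypothesis pushes it further in, until it meets the
  maximum.\<close>

lemma rad_symmetrization:
  "(\<integral>x. rad k (\<lambda>t. g t + mu t - trunc (p x t)) \<partial>N) \<le> rad (Suc k) g"
proof (induction k arbitrary: g)
  case 0
  show ?case by (rule rad_symmetrization_0)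
next
  case (Suc k)
  interpret P: pair_prob_space N N ..
  let ?h = "\<lambda>x y. (rad k (\<lambda>t. g t + 2 * p y t + mu t - trunc (p x t))
      + rad k (\<lambda>t. g t - 2 * p y t + mu t - trunc (p x t))) / 2"
  have int1: "integrable (N \<Otimes>\<^sub>M N) (\<lambda>z. p (snd z) t)" if "t \<in> T" for t
    using that p_int[OF that]
    by (intro P.Fubini_integrable) auto
  have int2: "integrable (N \<Otimes>\<^sub>M N) (\<lambda>z. trunc (p (fst z) t))" if "t \<in> T" for t
    using that by (intro P.integrable_const_bound[of _ 1]) (auto simp: trunc_bounds)
  have int3: "integrable (N \<Otimes>\<^sub>M N) (\<lambda>z. g t + 2 * p (snd z) t + mu t - trunc (p (fst z) t))"
    "integrable (N \<Otimes>\<^sub>M N) (\<lambda>z. g t - 2 * p (snd z) t + mu t - trunc (p (fst z) t))"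
    if "t \<in> T" for t
    by (intro Bochner_Integration.integrable_add Bochner_Integration.integrable_diff
        integrable_mult_right int1 int2 P.integrable_const that)+
  have int: "integrable (N \<Otimes>\<^sub>M N) (\<lambda>(x, y). ?h x y)"
    unfolding split_beta'
    by (intro integrable_divide_zero Bochner_Integration.integrable_add
        rad_integrable[OF P.prob_space_axioms] int3)
  have "(\<integral>x. rad (Suc k) (\<lambda>t. g t + mu t - trunc (p x t)) \<partial>N) = (\<integral>x. (\<integral>y. ?h x y \<partial>N) \<partial>N)"
    by (simp add: algebra_simps)
  also have "\<dots> = (\<integral>y. (\<integral>x. ?h x y \<partial>N) \<partial>N)"
    by (rule P.Fubini_integral[OF int, symmetric])
  also have "\<dots> \<le> (\<integral>y. (rad (Suc k) (\<lambda>t. g t + 2 * p y t) + rad (Suc k) (\<lambda>t. g t - 2 * p y t)) / 2 \<partial>N)"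
  proof (rule integral_mono)
    fix y
    have "(\<integral>x. ?h x y \<partial>N) = ((\<integral>x. rad k (\<lambda>t. g t + 2 * p y t + mu t - trunc (p x t)) \<partial>N)
     + (\<integral>x. rad k (\<lambda>t. g t - 2 * p y t + mu t - trunc (p x t)) \<partial>N)) / 2"
      by (subst integral_divide_zero, subst Bochner_Integration.integral_add)
        (auto intro!: rad_integrable prob_space_axioms)
    also have "\<dots> \<le> (rad (Suc k) (\<lambda>t. g t + 2 * p y t) + rad (Suc k) (\<lambda>t. g t - 2 * p y t)) / 2"
      by (intro divide_right_mono add_mono Suc.IH) auto
    finally show "(\<integral>x. ?h x y \<partial>N) \<le> \<dots>" .
    show "integrable N (\<lambda>y. (\<integral>x. ?h x y \<partial>N))"
      by (rule P.integrable_snd[OF int])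
  qed (intro integrable_divide_zero Bochner_Integration.integrable_add rad_integrable_p)
  finally show ?case by simp
qed

text \<open>The method of bounded differences. For a fixed last sample \<open>x\<close> the
  induction hypothesis bounds the inner integral in terms of \<open>Y x\<close>; Hoeffding's lemma
  controls the fluctuation of \<open>Y\<close>, and \<open>rad_symmetrization\<close> turns its mean
  into the next level of \<open>rad\<close>.\<close>

lemma rad_exp_moment:
  assumes "0 < l"
  shows "(\<integral>\<^sup>+ w. exp (l * Max ((\<lambda>t. g t + (\<Sum>j<m. mu t - trunc (p (w j) t))) ` T)) \<partial>(\<Pi>\<^sub>M j\<in>{..<m}. N))
    \<le> exp (l * rad m g + real m * l\<^sup>2 / 8)"
proof (induction m arbitrary: g)
  case 0
  show ?case by (simp add: PiM_empty)
next
  case (Suc m)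
  interpret S: product_sigma_finite "\<lambda>_. N" ..
  let ?e = "\<lambda>g m w. ennreal (exp (l * Max ((\<lambda>t. g t + (\<Sum>j<m. mu t - trunc (p (w j) t))) ` T)))"
  have [measurable]: "(\<lambda>w. ?e g m w) \<in> borel_measurable (\<Pi>\<^sub>M j\<in>{..<m}. N)" for g m
    using T by measurable
  define Y where "Y x = rad m (\<lambda>t. g t + mu t - trunc (p x t))" for x
  \<comment> \<open>Replacing \<open>trunc\<close> by its upper bound 1 lowers \<open>rad\<close> by
    at most 1, so all values of \<open>Y\<close> lie in an interval of length 1.\<close>
  define a where "a = rad m (\<lambda>t. g t + mu t - 1)"
  have Yi: "integrable N Y" unfolding Y_def
    by (auto intro!: rad_integrable prob_space_axioms)
  have "a \<le> Y x" "Y x \<le> a + 1" for x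
    using rad_lipschitz[of "\<lambda>t. g t + mu t - 1" "\<lambda>t. g t + mu t - trunc (p x t)" 0 m]
      rad_lipschitz[of "\<lambda>t. g t + mu t - trunc (p x t)" "\<lambda>t. g t + mu t - 1" 1 m] trunc_bounds
    by (auto simp: Y_def a_def)
  then interpret I: interval_bounded_random_variable N Y a "a + 1"
    by unfold_locales (use Yi in auto)
  have "(\<integral>\<^sup>+ w. ?e g (Suc m) w \<partial>(\<Pi>\<^sub>M j\<in>insert m {..<m}. N))
    = (\<integral>\<^sup>+ x. (\<integral>\<^sup>+ w. ?e g (Suc m) (w(m := x)) \<partial>(\<Pi>\<^sub>M j\<in>{..<m}. N)) \<partial>N)"
  proof (rule S.product_nn_integral_insert_rev)
    show "?e g (Suc m) \<in> borel_measurable (\<Pi>\<^sub>M j\<in>insert m {..<m}. N)"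
      unfolding lessThan_Suc[symmetric] by measurable
  qed auto
  also have "\<dots> = (\<integral>\<^sup>+ x. (\<integral>\<^sup>+ w. ?e (\<lambda>t. g t + mu t - trunc (p x t)) m w \<partial>(\<Pi>\<^sub>M j\<in>{..<m}. N)) \<partial>N)"
    by (simp add: algebra_simps)
  also have "\<dots> \<le> (\<integral>\<^sup>+ x. exp (l * Y x + real m * l\<^sup>2 / 8) \<partial>N)"
    unfolding Y_def by (intro nn_integral_mono Suc.IH)
  also have "\<dots> = (\<integral>\<^sup>+ x. ennreal (exp (l * (Y x - expectation Y)))
      * ennreal (exp (l * expectation Y + real m * l\<^sup>2 / 8)) \<partial>N)"
    by (simp add: algebra_simps flip: ennreal_mult exp_add)
  also have "\<dots> = (\<integral>\<^sup>+ x. ennreal (exp (l * (Y x - expectation Y))) \<partial>N)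
      * ennreal (exp (l * expectation Y + real m * l\<^sup>2 / 8))"
    by (rule nn_integral_multc) auto
  also have "\<dots> \<le> ennreal (exp (l\<^sup>2 * (a + 1 - a)\<^sup>2 / 8)) * ennreal (exp (l * expectation Y + real m * l\<^sup>2 / 8))"
    by (intro mult_right_mono I.Hoeffdings_lemma_nn_integral assms) auto
  also have "\<dots> = ennreal (exp (l * expectation Y + real (Suc m) * l\<^sup>2 / 8))"
    by (simp flip: ennreal_mult exp_add) (simp add: field_simps)
  also have "\<dots> \<le> ennreal (exp (l * rad (Suc m) g + real (Suc m) * l\<^sup>2 / 8))"
    using rad_symmetrization[where k = m and g = g] assms unfolding Y_def[symmetric]
    by (intro ennreal_leI) (simp del: rad.simps)
  finally show ?case by (simp only: lessThan_Suc)
qed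

text \<open>The maximum is replaced by the smooth potential
  \<open>ln (\<Sum>u\<in>U. 2 * cosh (s * w u))\<close>, which behaves well under sign averages. The
  values \<open>w\<close> on the finite set \<open>U\<close> evolve along with the offset
  \<open>g\<close>, and \<open>G\<close> is the invariant linking them. In the application both are
  read off from one random matrix, \<open>g\<close> by traces and \<open>w\<close> by quadratic
  forms at net points.\<close>

lemma rad_le_ln_sum_cosh:
  fixes q :: "'x \<Rightarrow> 'u \<Rightarrow> real" and G :: "('t \<Rightarrow> real) \<Rightarrow> ('u \<Rightarrow> real) \<Rightarrow> bool"
  assumes U: "finite U" "U \<noteq> {}" and s: "0 < s" and B: "0 \<le> B" and kappa: "0 < \<kappa>"
    and base: "\<And>g w t. G g w \<Longrightarrow> t \<in> T \<Longrightarrow> g t \<le> B * Max ((\<lambda>u. \<bar>w u\<bar>) ` U)"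
    and plus: "\<And>g w x. G g w \<Longrightarrow> x \<in> space N \<Longrightarrow> G (\<lambda>t. g t + 2 * p x t) (\<lambda>u. w u + 2 * q x u)"
    and minus: "\<And>g w x. G g w \<Longrightarrow> x \<in> space N \<Longrightarrow> G (\<lambda>t. g t - 2 * p x t) (\<lambda>u. w u - 2 * q x u)"
    and int: "\<And>u. u \<in> U \<Longrightarrow> integrable N (\<lambda>x. cosh (2 * s * q x u))"
    and le: "\<And>u. u \<in> U \<Longrightarrow> (\<integral>x. cosh (2 * s * q x u) \<partial>N) \<le> \<kappa>"
    and G: "G g w"
  shows "rad k g \<le> B / s * ln (\<kappa> ^ k * (\<Sum>u\<in>U. 2 * cosh (s * w u)))"
  using G
proof (induction k arbitrary: g w)
  case 0
  have "Max ((\<lambda>u. \<bar>w u\<bar>) ` U) \<le> 1 / s * ln (\<Sum>u\<in>U. 2 * cosh (s * w u))"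
  proof (rule Max.boundedI)
    fix y assume "y \<in> (\<lambda>u. \<bar>w u\<bar>) ` U"
    then obtain u where u: "u \<in> U" "y = \<bar>w u\<bar>" by auto
    have "exp (s * y) \<le> 2 * cosh (s * w u)"
      using u(2) s by (cases "w u \<ge> 0") (auto simp: cosh_def)
    also have "\<dots> \<le> (\<Sum>u\<in>U. 2 * cosh (s * w u))"
      using u(1) U(1) by (intro member_le_sum) auto
    finally have le: "exp (s * y) \<le> (\<Sum>u\<in>U. 2 * cosh (s * w u))" .
    then have "s * y \<le> ln (\<Sum>u\<in>U. 2 * cosh (s * w u))"
      by (subst ln_ge_iff) (auto intro: less_le_trans[OF exp_gt_zero])
    then show "y \<le> 1 / s * ln (\<Sum>u\<in>U. 2 * cosh (s * w u))"
      using s by (simp add: field_simps)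
  qed (use U in auto)
  then have "B * Max ((\<lambda>u. \<bar>w u\<bar>) ` U) \<le> B * (1 / s * ln (\<Sum>u\<in>U. 2 * cosh (s * w u)))"
    using B by (rule mult_left_mono)
  then have "g t \<le> B / s * ln (\<Sum>u\<in>U. 2 * cosh (s * w u))" if "t \<in> T" for t
    using base[OF 0 that] by simp
  then show ?case using T by simp
next
  case (Suc k)
  \<comment> \<open>Jensen's inequality for \<open>ln\<close> is applied through the tangent at
    \<open>c\<close>. As \<open>c\<close> is the bound for the mean, the linear correction
    \<open>c / c - 1\<close> vanishes at the end.\<close>
  define c where "c = \<kappa> ^ Suc k * (\<Sum>u\<in>U. 2 * cosh (s * w u))"
  define S where "S w = \<kappa> ^ k * (\<Sum>u\<in>U. 2 * cosh (s * w u))" for w :: "'u \<Rightarrow> real"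
  have pos: "0 < (\<Sum>u\<in>U. 2 * cosh (s * w u))" for w :: "'u \<Rightarrow> real"
    using U by (intro sum_pos) (auto simp: cosh_real_pos)
  have c: "0 < c" and S: "0 < S w" for w
    unfolding c_def S_def using kappa pos by simp_all
  have mid: "(K * (l + y / d - 1) + K * (l + z / d - 1)) / 2 = K * (l + (y + z) / 2 / d - 1)"
    for K l y z d :: real
  proof -
    have 1: "(y + z) / 2 / d = (y / d + z / d) / 2" by (simp add: add_divide_distrib)
    have "(K * (l + a - 1) + K * (l + b - 1)) / 2 = K * (l + (a + b) / 2 - 1)" for a b
      by (simp add: field_simps)
    then show ?thesis unfolding 1 .
  qed
  define h where "h x = B / s * (ln c + \<kappa> ^ k * (\<Sum>u\<in>U. 2 * cosh (s * w u) * cosh (2 * s * q x u)) / c - 1)" for x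
  have "rad (Suc k) g \<le> (\<integral>x. h x \<partial>N)"
    unfolding rad.simps
  proof (rule integral_mono)
    fix x assume x: "x \<in> space N"
    let ?w1 = "\<lambda>u. w u + 2 * q x u" and ?w2 = "\<lambda>u. w u - 2 * q x u"
    have ln_le: "ln (S w) \<le> ln c + S w / c - 1" for w
      using ln_le_minus_one[of "S w / c"] S[of w] c by (simp add: ln_div)
    have r1: "rad k (\<lambda>t. g t + 2 * p x t) \<le> B / s * (ln c + S ?w1 / c - 1)"
      by (rule order.trans[OF Suc.IH[OF plus[OF Suc.prems x]]], fold S_def)
        (intro mult_left_mono ln_le divide_nonneg_pos B s)
    have r2: "rad k (\<lambda>t. g t - 2 * p x t) \<le> B / s * (ln c + S ?w2 / c - 1)"
      by (rule order.trans[OF Suc.IH[OF minus[OF Suc.prems x]]], fold S_def)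
        (intro mult_left_mono ln_le divide_nonneg_pos B s)
    \<comment> \<open>The sign average turns \<open>cosh (x + y)\<close> and
      \<open>cosh (x - y)\<close> into the product \<open>cosh x * cosh y\<close>, which separates
      the old state from the new sample; the factor of the latter has mean at most \<kappa>.\<close>
    have S2: "S ?w1 + S ?w2 = 2 * (\<kappa> ^ k * (\<Sum>u\<in>U. 2 * cosh (s * w u) * cosh (2 * s * q x u)))"
    proof -
      have "2 * cosh (s * ?w1 u) + 2 * cosh (s * ?w2 u) = 2 * (2 * cosh (s * w u) * cosh (2 * s * q x u))" for u
        by (simp add: distrib_left right_diff_distrib cosh_add cosh_diff mult_ac)
      then have "(\<Sum>u\<in>U. 2 * cosh (s * ?w1 u)) + (\<Sum>u\<in>U. 2 * cosh (s * ?w2 u))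
          = 2 * (\<Sum>u\<in>U. 2 * cosh (s * w u) * cosh (2 * s * q x u))"
        unfolding sum.distrib[symmetric] sum_distrib_left by simp
      then show ?thesis unfolding S_def distrib_left[symmetric] by simp
    qed
    have "(rad k (\<lambda>t. g t + 2 * p x t) + rad k (\<lambda>t. g t - 2 * p x t)) / 2
        \<le> (B / s * (ln c + S ?w1 / c - 1) + B / s * (ln c + S ?w2 / c - 1)) / 2"
      by (intro divide_right_mono add_mono r1 r2) simp
    also have "\<dots> = B / s * (ln c + (S ?w1 + S ?w2) / 2 / c - 1)"
      by (rule mid)
    also have "\<dots> = h x"
      unfolding S2 h_def by simp
    finally show "(rad k (\<lambda>t. g t + 2 * p x t) + rad k (\<lambda>t. g t - 2 * p x t)) / 2 \<le> h x" .
  next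
    show "integrable N h"
      unfolding h_def using int
      by (intro integrable_mult_right Bochner_Integration.integrable_add Bochner_Integration.integrable_diff
          integrable_divide_zero Bochner_Integration.integrable_sum integrable_const)
  qed (intro integrable_divide_zero Bochner_Integration.integrable_add rad_integrable_p)
  also have "(\<integral>x. h x \<partial>N) = B / s * (ln c + \<kappa> ^ k * (\<Sum>u\<in>U. 2 * cosh (s * w u) * (\<integral>x. cosh (2 * s * q x u) \<partial>N)) / c - 1)"
    unfolding h_def using int by (simp add: prob_space)
  also have "\<dots> \<le> B / s * (ln c + \<kappa> ^ k * (\<Sum>u\<in>U. 2 * cosh (s * w u) * \<kappa>) / c - 1)"
    using B s kappa c le by (intro mult_left_mono diff_right_mono add_left_mono divide_right_mono sum_mono) auto
  also have "\<kappa> ^ k * (\<Sum>u\<in>U. 2 * cosh (s * w u) * \<kappa>) = c"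
    by (simp add: c_def mult_ac flip: sum_distrib_left)
  also have "B / s * (ln c + c / c - 1) = B / s * ln c"
    using c by simp
  finally show ?case unfolding c_def .
qed

end

subsection \<open>Complex Gaussian vectors\<close>

abbreviation real_gaussian :: "real measure" where
  "real_gaussian \<equiv> density lborel (normal_density 0 (sqrt (1/2)))"

lemma normal_density_half: "normal_density 0 (sqrt (1/2)) x = exp (- x\<^sup>2) / sqrt pi"
  by (simp add: normal_density_def)

lemma prob_space_real_gaussian: "prob_space real_gaussian"
  by (rule prob_space_normal_density) simp

lemma prob_space_complex_gaussian: "prob_space complex_gaussian"
proof -
  interpret R: prob_space real_gaussian by (rule prob_space_real_gaussian)
  interpret P: pair_prob_space real_gaussian real_gaussian ..
  show ?thesis unfolding complex_gaussian_def
    by (rule P.prob_space_distr) (simp add: Complex_eq split_beta')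
qed

interpretation real_gaussian: prob_space real_gaussian by (rule prob_space_real_gaussian)
interpretation complex_gaussian: prob_space complex_gaussian by (rule prob_space_complex_gaussian)
interpretation gaussian_PiM: product_prob_space "\<lambda>_. complex_gaussian" I for I :: "nat set" ..

lemma space_complex_gaussian [simp]: "space complex_gaussian = UNIV"
  by (simp add: complex_gaussian_def)

lemma measurable_Complex [measurable]: "(\<lambda>(x, y). Complex x y) \<in> borel_measurable (borel \<Otimes>\<^sub>M borel)"
  by (simp add: Complex_eq split_beta')

lemma nn_integral_real_gaussian:
  assumes [measurable]: "f \<in> borel_measurable borel"
  shows "(\<integral>\<^sup>+ x. f x \<partial>real_gaussian) = (\<integral>\<^sup>+ x. ennreal (exp (- x\<^sup>2) / sqrt pi) * f x \<partial>lborel)"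
  by (subst nn_integral_density) (auto simp: normal_density_half)

lemma nn_integral_complex_gaussian:
  assumes [measurable]: "f \<in> borel_measurable borel"
  shows "(\<integral>\<^sup>+ z. f z \<partial>complex_gaussian) = (\<integral>\<^sup>+ x. (\<integral>\<^sup>+ y. f (Complex x y) \<partial>real_gaussian) \<partial>real_gaussian)"
proof -
  have "(\<integral>\<^sup>+ z. f z \<partial>complex_gaussian)
      = (\<integral>\<^sup>+ z. f (case z of (x, y) \<Rightarrow> Complex x y) \<partial>(real_gaussian \<Otimes>\<^sub>M real_gaussian))"
    unfolding complex_gaussian_def by (subst nn_integral_distr) auto
  also have "\<dots> = (\<integral>\<^sup>+ x. (\<integral>\<^sup>+ y. f (Complex x y) \<partial>real_gaussian) \<partial>real_gaussian)"
    by (subst real_gaussian.nn_integral_fst[symmetric]) (auto simp: split_beta')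
  finally show ?thesis .
qed

lemma nn_integral_normal_density [simp]:
  "0 < \<sigma> \<Longrightarrow> (\<integral>\<^sup>+ x. ennreal (normal_density \<mu> \<sigma> x) \<partial>lborel) = 1"
  by (subst nn_integral_eq_integral) auto

lemma normal_density_rescale:
  assumes "0 < u"
  shows "normal_density 0 (sqrt (1 / (2 * u))) x = sqrt u / sqrt pi * exp (- u * x\<^sup>2)"
proof -
  have "(sqrt (1 / (2 * u)))\<^sup>2 = 1 / (2 * u)" using assms by simp
  then show ?thesis
    using assms unfolding normal_density_def by (simp add: real_sqrt_divide mult.commute)
qed

text \<open>Up to a constant, the factor turns the density into the normal one of variance
  \<open>1 / (2 * (1 + t))\<close>. Negative \<open>t\<close> is included for the exponential
  moments of squares.\<close>

lemma real_gaussian_exp_square: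
  assumes "-1 < t"
  shows "(\<integral>\<^sup>+ x. exp (- t * x\<^sup>2) \<partial>real_gaussian) = ennreal (1 / sqrt (1 + t))"
proof -
  have "exp (- x\<^sup>2) / sqrt pi * exp (- t * x\<^sup>2)
      = 1 / sqrt (1 + t) * normal_density 0 (sqrt (1 / (2 * (1 + t)))) x" for x
  proof -
    have "1 / sqrt (1 + t) * normal_density 0 (sqrt (1 / (2 * (1 + t)))) x = exp (- (1 + t) * x\<^sup>2) / sqrt pi"
      using normal_density_rescale[of "1 + t" x] assms by simp
    then show ?thesis by (simp add: algebra_simps flip: exp_add)
  qed
  then have "(\<integral>\<^sup>+ x. exp (- t * x\<^sup>2) \<partial>real_gaussian)
      = (\<integral>\<^sup>+ x. ennreal (1 / sqrt (1 + t)) * ennreal (normal_density 0 (sqrt (1 / (2 * (1 + t)))) x) \<partial>lborel)"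
    using assms by (subst nn_integral_real_gaussian) (auto simp flip: ennreal_mult)
  also have "\<dots> = ennreal (1 / sqrt (1 + t))"
    using assms by (subst nn_integral_cmult) auto
  finally show ?thesis .
qed

lemma real_gaussian_exp_linear:
  "(\<integral>\<^sup>+ x. exp (b * x) \<partial>real_gaussian) = ennreal (exp (b\<^sup>2 / 4))"
proof -
  have "exp (- x\<^sup>2) / sqrt pi * exp (b * x) = exp (b\<^sup>2 / 4) * normal_density (b / 2) (sqrt (1 / 2)) x" for x
    by (simp add: normal_density_def power2_eq_square algebra_simps flip: exp_add)
  then have "(\<integral>\<^sup>+ x. exp (b * x) \<partial>real_gaussian)
      = (\<integral>\<^sup>+ x. ennreal (exp (b\<^sup>2 / 4)) * ennreal (normal_density (b / 2) (sqrt (1 / 2)) x) \<partial>lborel)"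
    by (subst nn_integral_real_gaussian) (auto simp flip: ennreal_mult)
  also have "\<dots> = ennreal (exp (b\<^sup>2 / 4))"
    by (subst nn_integral_cmult) auto
  finally show ?thesis .
qed

lemma cis_measurable [measurable]: "cis \<in> borel_measurable borel"
  by (intro borel_measurable_continuous_onI continuous_intros)

lemma real_gaussian_char: "(\<integral>x. cis (b * x) \<partial>real_gaussian) = exp (- b\<^sup>2 / 4)"
proof -
  interpret S: prob_space std_normal_distribution by (rule prob_space_normal_density) simp
  have "distributed std_normal_distribution lborel (\<lambda>x. x) std_normal_density"
    by (simp add: distributed_def distr_id2)
  then have "distributed std_normal_distribution lborel (\<lambda>x. 0 + sqrt (1/2) * x)
      (normal_density (0 + sqrt (1/2) * 0) (\<bar>sqrt (1/2)\<bar> * 1))"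
    by (intro S.normal_density_affine) auto
  then have "real_gaussian = distr std_normal_distribution borel (\<lambda>x. sqrt (1/2) * x)"
    using distributed_distr_eq_density by (fastforce cong: distr_cong)
  then have "(\<integral>x. cis (b * x) \<partial>real_gaussian) = (\<integral>x. cis (b * (sqrt (1/2) * x)) \<partial>std_normal_distribution)"
    by (simp add: integral_distr[where f = "\<lambda>x. cis (b * x)"])
  also have "\<dots> = char std_normal_distribution (b * sqrt (1/2))"
    by (simp add: char_def cis_conv_exp mult_ac)
  also have "\<dots> = exp (- b\<^sup>2 / 4)"
    by (simp add: char_std_normal_distribution power_mult_distrib)
  finally show ?thesis .
qed

lemma complex_gaussian_exp_square:
  assumes "-1 < t"
  shows "(\<integral>\<^sup>+ z. exp (- t * (cmod z)\<^sup>2) \<partial>complex_gaussian) = ennreal (1 / (1 + t))"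
proof -
  have "(\<integral>\<^sup>+ z. exp (- t * (cmod z)\<^sup>2) \<partial>complex_gaussian)
    = (\<integral>\<^sup>+ x. (\<integral>\<^sup>+ y. ennreal (exp (- t * x\<^sup>2)) * ennreal (exp (- t * y\<^sup>2)) \<partial>real_gaussian) \<partial>real_gaussian)"
    by (subst nn_integral_complex_gaussian)
      (auto simp: cmod_power2 algebra_simps simp flip: ennreal_mult exp_add)
  also have "\<dots> = (\<integral>\<^sup>+ x. ennreal (exp (- t * x\<^sup>2)) * ennreal (1 / sqrt (1 + t)) \<partial>real_gaussian)"
    by (subst nn_integral_cmult) (auto simp: real_gaussian_exp_square[OF assms, simplified])
  also have "\<dots> = ennreal (1 / sqrt (1 + t)) * ennreal (1 / sqrt (1 + t))"
    by (subst nn_integral_multc) (auto simp: real_gaussian_exp_square[OF assms, simplified])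
  also have "\<dots> = ennreal (1 / (1 + t))"
    using assms by (simp flip: ennreal_mult)
  finally show ?thesis .
qed

text \<open>Real and imaginary part have variance 1/2; the factor 2 in the exponent is chosen so
  that the result is exactly the exponential of \<open>(cmod b)\<^sup>2\<close>.\<close>

lemma complex_gaussian_exp_linear:
  "(\<integral>\<^sup>+ z. exp (2 * Re (cnj b * z)) \<partial>complex_gaussian) = ennreal (exp ((cmod b)\<^sup>2))"
proof -
  have "(\<integral>\<^sup>+ z. exp (2 * Re (cnj b * z)) \<partial>complex_gaussian)
    = (\<integral>\<^sup>+ x. (\<integral>\<^sup>+ y. ennreal (exp (2 * Re b * x)) * ennreal (exp (2 * Im b * y)) \<partial>real_gaussian) \<partial>real_gaussian)"
    by (subst nn_integral_complex_gaussian)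
      (auto simp: algebra_simps simp flip: ennreal_mult exp_add)
  also have "\<dots> = (\<integral>\<^sup>+ x. ennreal (exp (2 * Re b * x)) * ennreal (exp ((2 * Im b)\<^sup>2 / 4)) \<partial>real_gaussian)"
    by (subst nn_integral_cmult) (auto simp: real_gaussian_exp_linear)
  also have "\<dots> = ennreal (exp ((2 * Re b)\<^sup>2 / 4)) * ennreal (exp ((2 * Im b)\<^sup>2 / 4))"
    by (subst nn_integral_multc) (auto simp: real_gaussian_exp_linear)
  also have "\<dots> = ennreal (exp ((cmod b)\<^sup>2))"
    by (simp add: cmod_power2 power_mult_distrib flip: ennreal_mult exp_add)
  finally show ?thesis .
qed

lemma complex_gaussian_char:
  "(\<integral>z. cis (2 * Re (cnj b * z)) \<partial>complex_gaussian) = exp (- (cmod b)\<^sup>2)"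
proof -
  interpret P: pair_prob_space real_gaussian real_gaussian ..
  have "(\<integral>z. cis (2 * Re (cnj b * z)) \<partial>complex_gaussian)
    = (\<integral>w. cis (2 * Re b * fst w) * cis (2 * Im b * snd w) \<partial>(real_gaussian \<Otimes>\<^sub>M real_gaussian))"
    unfolding complex_gaussian_def
    by (subst integral_distr) (auto simp: split_beta' cis_mult algebra_simps intro!: borel_measurable_continuous_onI continuous_intros)
  also have "\<dots> = (\<integral>x. (\<integral>y. cis (2 * Re b * x) * cis (2 * Im b * y) \<partial>real_gaussian) \<partial>real_gaussian)"
    by (subst P.integral_fst'[symmetric])
      (auto intro!: P.integrable_const_bound[of _ 1] simp: norm_mult)
  also have "\<dots> = exp (- (2 * Re b)\<^sup>2 / 4) * exp (- (2 * Im b)\<^sup>2 / 4)"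
    by (simp add: real_gaussian_char)
  also have "\<dots> = exp (- (cmod b)\<^sup>2)"
    by (simp add: cmod_power2 power_mult_distrib flip: exp_add)
  finally show ?thesis by simp
qed

section \<open>Linear forms of a Gaussian vector\<close>

abbreviation gaussian_vector :: "nat \<Rightarrow> (nat \<Rightarrow> complex) measure" where
  "gaussian_vector n \<equiv> \<Pi>\<^sub>M k\<in>{..<n}. complex_gaussian"

text \<open>Bilinear, without a conjugate, so that \<open>lin n (H a) x\<close> is entry
  \<open>a\<close> of the product of the matrix \<open>H\<close> with \<open>x\<close>.\<close>

definition lin :: "nat \<Rightarrow> (nat \<Rightarrow> complex) \<Rightarrow> (nat \<Rightarrow> complex) \<Rightarrow> complex" where
  "lin n c v = (\<Sum>k<n. c k * v k)"

definition sqnorm :: "nat \<Rightarrow> (nat \<Rightarrow> complex) \<Rightarrow> real" where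
  "sqnorm n c = (\<Sum>k<n. (cmod (c k))\<^sup>2)"

lemma sqnorm_nonneg [simp]: "0 \<le> sqnorm n c"
  by (simp add: sqnorm_def sum_nonneg)

lemma lin_measurable [measurable]: "lin n c \<in> borel_measurable (gaussian_vector n)"
  unfolding lin_def by measurable

lemma Re_cnj_lin: "2 * Re (cnj b * lin n c v) = (\<Sum>k<n. 2 * Re (cnj (b * cnj (c k)) * v k))"
proof -
  have "cnj b * lin n c v = (\<Sum>k<n. cnj (b * cnj (c k)) * v k)"
    unfolding lin_def sum_distrib_left by (intro sum.cong) auto
  then show ?thesis by (simp only: Re_sum sum_distrib_left)
qed

lemma sum_cmod_mult_cnj: "(\<Sum>k<n. (cmod (b * cnj (c k)))\<^sup>2) = (cmod b)\<^sup>2 * sqnorm n c"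
  by (simp add: sqnorm_def norm_mult power_mult_distrib sum_distrib_left)

lemma cis_sum: "finite A \<Longrightarrow> cis (\<Sum>k\<in>A. f k) = (\<Prod>k\<in>A. cis (f k))"
  by (induction A rule: finite_induct) (simp_all flip: cis_mult)

lemma gaussian_vector_exp_linear:
  "(\<integral>\<^sup>+ v. exp (2 * Re (cnj b * lin n c v)) \<partial>gaussian_vector n) = ennreal (exp ((cmod b)\<^sup>2 * sqnorm n c))"
proof -
  have "(\<integral>\<^sup>+ v. exp (2 * Re (cnj b * lin n c v)) \<partial>gaussian_vector n)
    = (\<integral>\<^sup>+ v. (\<Prod>k<n. ennreal (exp (2 * Re (cnj (b * cnj (c k)) * v k)))) \<partial>gaussian_vector n)"
    unfolding Re_cnj_lin by (subst prod_ennreal) (auto simp: exp_sum)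
  also have "\<dots> = (\<Prod>k<n. \<integral>\<^sup>+ z. ennreal (exp (2 * Re (cnj (b * cnj (c k)) * z))) \<partial>complex_gaussian)"
    by (rule gaussian_PiM.product_nn_integral_prod) auto
  also have "\<dots> = ennreal (exp ((cmod b)\<^sup>2 * sqnorm n c))"
    unfolding complex_gaussian_exp_linear sum_cmod_mult_cnj[symmetric]
    by (subst prod_ennreal) (auto simp: exp_sum)
  finally show ?thesis .
qed

lemma gaussian_vector_char:
  "(\<integral>v. cis (2 * Re (cnj b * lin n c v)) \<partial>gaussian_vector n) = exp (- (cmod b)\<^sup>2 * sqnorm n c)"
proof -
  have "(\<integral>v. cis (2 * Re (cnj b * lin n c v)) \<partial>gaussian_vector n)
    = (\<integral>v. (\<Prod>k<n. cis (2 * Re (cnj (b * cnj (c k)) * v k))) \<partial>gaussian_vector n)"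
    unfolding Re_cnj_lin by (simp add: cis_sum)
  also have "\<dots> = (\<Prod>k<n. \<integral>z. cis (2 * Re (cnj (b * cnj (c k)) * z)) \<partial>complex_gaussian)"
    by (rule gaussian_PiM.product_integral_prod)
      (auto intro!: complex_gaussian.integrable_const_bound[of _ 1])
  also have "\<dots> = exp (- (cmod b)\<^sup>2 * sqnorm n c)"
    unfolding complex_gaussian_char mult_minus_left sum_cmod_mult_cnj[symmetric] sum_negf[symmetric]
    by (simp add: exp_sum)
  finally show ?thesis .
qed

text \<open>Writing \<open>exp (s \<bar>w\<bar>\<^sup>2)\<close> as the Laplace transform, and \<open>exp (- s \<bar>w\<bar>\<^sup>2)\<close> as the Fourier transform,
  of an independent complex Gaussian linearizes the exponents of the next two lemmas; this replaces
  the rotation invariance of the Gaussian vector.\<close>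

lemma gaussian_vector_exp_square:
  assumes "0 \<le> s" "s * sqnorm n c < 1"
  shows "(\<integral>\<^sup>+ v. exp (s * (cmod (lin n c v))\<^sup>2) \<partial>gaussian_vector n) = ennreal (1 / (1 - s * sqnorm n c))"
proof -
  interpret P: pair_prob_space "gaussian_vector n" complex_gaussian ..
  let ?r = "complex_of_real (sqrt s)"
  have "(\<integral>\<^sup>+ v. exp (s * (cmod (lin n c v))\<^sup>2) \<partial>gaussian_vector n)
    = (\<integral>\<^sup>+ v. (\<integral>\<^sup>+ b. exp (2 * Re (cnj (?r * b) * lin n c v)) \<partial>complex_gaussian) \<partial>gaussian_vector n)"
  proof (rule nn_integral_cong)
    fix v
    have "(\<integral>\<^sup>+ b. exp (2 * Re (cnj (?r * b) * lin n c v)) \<partial>complex_gaussian)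
      = (\<integral>\<^sup>+ b. exp (2 * Re (cnj (?r * lin n c v) * b)) \<partial>complex_gaussian)"
      by (simp add: algebra_simps)
    also have "\<dots> = ennreal (exp ((cmod (?r * lin n c v))\<^sup>2))"
      by (rule complex_gaussian_exp_linear)
    also have "\<dots> = ennreal (exp (s * (cmod (lin n c v))\<^sup>2))"
      using assms by (simp add: norm_mult power_mult_distrib)
    finally show "ennreal (exp (s * (cmod (lin n c v))\<^sup>2))
      = (\<integral>\<^sup>+ b. exp (2 * Re (cnj (?r * b) * lin n c v)) \<partial>complex_gaussian)" by simp
  qed
  also have "\<dots> = (\<integral>\<^sup>+ b. (\<integral>\<^sup>+ v. exp (2 * Re (cnj (?r * b) * lin n c v)) \<partial>gaussian_vector n) \<partial>complex_gaussian)"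
    by (rule P.Fubini'[symmetric]) simp
  also have "\<dots> = (\<integral>\<^sup>+ b. ennreal (exp (- (- s * sqnorm n c) * (cmod b)\<^sup>2)) \<partial>complex_gaussian)"
    unfolding gaussian_vector_exp_linear
    using assms by (simp add: norm_mult power_mult_distrib mult_ac)
  also have "\<dots> = ennreal (1 / (1 + - s * sqnorm n c))"
    using assms by (intro complex_gaussian_exp_square) auto
  finally show ?thesis by simp
qed

lemma gaussian_vector_exp_neg_square:
  assumes "0 \<le> s"
  shows "(\<integral>v. exp (- s * (cmod (lin n c v))\<^sup>2) \<partial>gaussian_vector n) = 1 / (1 + s * sqnorm n c)"
proof -
  interpret P: pair_prob_space "gaussian_vector n" complex_gaussian ..
  have pos: "-1 < s * sqnorm n c"
    using mult_nonneg_nonneg[OF assms sqnorm_nonneg[of n c]] by linarith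
  let ?r = "complex_of_real (sqrt s)"
  have "complex_of_real (\<integral>v. exp (- s * (cmod (lin n c v))\<^sup>2) \<partial>gaussian_vector n)
    = (\<integral>v. complex_of_real (exp (- s * (cmod (lin n c v))\<^sup>2)) \<partial>gaussian_vector n)"
    by simp
  also have "\<dots> = (\<integral>v. (\<integral>b. cis (2 * Re (cnj (?r * b) * lin n c v)) \<partial>complex_gaussian) \<partial>gaussian_vector n)"
  proof (rule Bochner_Integration.integral_cong)
    fix v
    have "(\<integral>b. cis (2 * Re (cnj (?r * b) * lin n c v)) \<partial>complex_gaussian)
      = (\<integral>b. cis (2 * Re (cnj (?r * lin n c v) * b)) \<partial>complex_gaussian)"
      by (simp add: algebra_simps)
    also have "\<dots> = exp (- (cmod (?r * lin n c v))\<^sup>2)"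
      by (rule complex_gaussian_char)
    also have "\<dots> = exp (- s * (cmod (lin n c v))\<^sup>2)"
      using assms by (simp add: norm_mult power_mult_distrib)
    finally show "complex_of_real (exp (- s * (cmod (lin n c v))\<^sup>2))
      = (\<integral>b. cis (2 * Re (cnj (?r * b) * lin n c v)) \<partial>complex_gaussian)" by simp
  qed simp
  also have "\<dots> = (\<integral>b. (\<integral>v. cis (2 * Re (cnj (?r * b) * lin n c v)) \<partial>gaussian_vector n) \<partial>complex_gaussian)"
    by (rule P.Fubini_integral[symmetric], rule P.integrable_const_bound[of _ 1])
      (auto simp: split_beta')
  also have "\<dots> = (\<integral>b. complex_of_real (exp (- (s * sqnorm n c) * (cmod b)\<^sup>2)) \<partial>complex_gaussian)"
    unfolding gaussian_vector_char using assms by (simp add: norm_mult power_mult_distrib mult_ac)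
  also have "\<dots> = complex_of_real (1 / (1 + s * sqnorm n c))"
    unfolding integral_complex_of_real of_real_eq_iff
    using complex_gaussian_exp_square[OF pos] pos
    by (subst integral_eq_nn_integral) simp_all
  finally show ?thesis by (simp only: of_real_eq_iff)
qed

text \<open>Substitute \<open>u = \<alpha> * x + \<beta> * y\<close> in the inner integral and
  exchange the order. For fixed \<open>u\<close> the joint density is that of \<open>u\<close> times
  a normal density in \<open>x\<close> with mean \<open>\<alpha> * u\<close> and standard deviation
  \<open>\<bar>\<beta>\<bar> * sqrt (1/2)\<close>, which integrates to 1.\<close>

lemma real_gaussian_rotation:
  assumes ab: "\<alpha>\<^sup>2 + \<beta>\<^sup>2 = 1" "\<beta> \<noteq> 0" and [measurable]: "f \<in> borel_measurable borel"
  shows "(\<integral>\<^sup>+ x. (\<integral>\<^sup>+ y. f (\<alpha> * x + \<beta> * y) \<partial>real_gaussian) \<partial>real_gaussian) = (\<integral>\<^sup>+ x. f x \<partial>real_gaussian)"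
proof -
  let ?d = "\<lambda>x::real. exp (- x\<^sup>2) / sqrt pi"
  have "(\<integral>\<^sup>+ y. f (\<alpha> * x + \<beta> * y) \<partial>real_gaussian)
    = (\<integral>\<^sup>+ u. ennreal (?d ((u - \<alpha> * x) / \<beta>) / \<bar>\<beta>\<bar>) * f u \<partial>lborel)" for x
  proof -
    have "(\<integral>\<^sup>+ y. f (\<alpha> * x + \<beta> * y) \<partial>real_gaussian)
      = (\<integral>\<^sup>+ y. ennreal (?d ((\<alpha> * x + \<beta> * y - \<alpha> * x) / \<beta>)) * f (\<alpha> * x + \<beta> * y) \<partial>lborel)"
      using ab(2) by (simp add: nn_integral_real_gaussian)
    moreover have "(\<integral>\<^sup>+ u. ennreal (?d ((u - \<alpha> * x) / \<beta>) / \<bar>\<beta>\<bar>) * f u \<partial>lborel)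
      = \<bar>\<beta>\<bar> * (\<integral>\<^sup>+ y. ennreal (?d ((\<alpha> * x + \<beta> * y - \<alpha> * x) / \<beta>) / \<bar>\<beta>\<bar>) * f (\<alpha> * x + \<beta> * y) \<partial>lborel)"
      using ab(2) by (intro nn_integral_real_affine) auto
    moreover have "\<dots> = (\<integral>\<^sup>+ y. ennreal (?d ((\<alpha> * x + \<beta> * y - \<alpha> * x) / \<beta>)) * f (\<alpha> * x + \<beta> * y) \<partial>lborel)"
      using ab(2) by (subst nn_integral_cmult[symmetric])
        (auto simp: mult.assoc[symmetric] simp flip: ennreal_mult)
    ultimately show ?thesis by simp
  qed
  then have "(\<integral>\<^sup>+ x. (\<integral>\<^sup>+ y. f (\<alpha> * x + \<beta> * y) \<partial>real_gaussian) \<partial>real_gaussian)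
    = (\<integral>\<^sup>+ x. (\<integral>\<^sup>+ u. ennreal (?d x) * (ennreal (?d ((u - \<alpha> * x) / \<beta>) / \<bar>\<beta>\<bar>) * f u) \<partial>lborel) \<partial>lborel)"
    by (simp add: nn_integral_real_gaussian nn_integral_cmult)
  also have "\<dots> = (\<integral>\<^sup>+ u. (\<integral>\<^sup>+ x. ennreal (?d x) * (ennreal (?d ((u - \<alpha> * x) / \<beta>) / \<bar>\<beta>\<bar>) * f u) \<partial>lborel) \<partial>lborel)"
    by (rule lborel_pair.Fubini') simp
  also have "\<dots> = (\<integral>\<^sup>+ u. ennreal (?d u) * f u \<partial>lborel)"
  proof (rule nn_integral_cong)
    fix u
    have "?d x * (?d ((u - \<alpha> * x) / \<beta>) / \<bar>\<beta>\<bar>) = ?d u * normal_density (\<alpha> * u) (\<bar>\<beta>\<bar> * sqrt (1/2)) x" for x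
    proof -
      have a: "\<alpha>\<^sup>2 = 1 - \<beta>\<^sup>2" using ab(1) by simp
      have "x\<^sup>2 + ((u - \<alpha> * x) / \<beta>)\<^sup>2 = u\<^sup>2 + (x - \<alpha> * u)\<^sup>2 / \<beta>\<^sup>2"
        using ab(2) by (simp add: power_divide power2_diff power_mult_distrib a divide_simps) (simp add: algebra_simps)
      then have e: "exp (- x\<^sup>2) * exp (- ((u - \<alpha> * x) / \<beta>)\<^sup>2) = exp (- u\<^sup>2) * exp (- (x - \<alpha> * u)\<^sup>2 / \<beta>\<^sup>2)"
        by (simp flip: exp_add)
      have "normal_density (\<alpha> * u) (\<bar>\<beta>\<bar> * sqrt (1/2)) x = exp (- (x - \<alpha> * u)\<^sup>2 / \<beta>\<^sup>2) / (sqrt pi * \<bar>\<beta>\<bar>)"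
        by (simp add: normal_density_def power_mult_distrib real_sqrt_mult)
      then show ?thesis using e by (simp add: field_simps)
    qed
    then have "(\<integral>\<^sup>+ x. ennreal (?d x) * (ennreal (?d ((u - \<alpha> * x) / \<beta>) / \<bar>\<beta>\<bar>) * f u) \<partial>lborel)
      = (\<integral>\<^sup>+ x. ennreal (?d u) * ennreal (normal_density (\<alpha> * u) (\<bar>\<beta>\<bar> * sqrt (1/2)) x) * f u \<partial>lborel)"
      by (simp add: mult.assoc[symmetric] flip: ennreal_mult)
    also have "\<dots> = ennreal (?d u) * f u"
      using ab(2) by (subst nn_integral_multc, simp, subst nn_integral_cmult) auto
    finally show "(\<integral>\<^sup>+ x. ennreal (?d x) * (ennreal (?d ((u - \<alpha> * x) / \<beta>) / \<bar>\<beta>\<bar>) * f u) \<partial>lborel)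
      = ennreal (?d u) * f u" .
  qed
  also have "\<dots> = (\<integral>\<^sup>+ x. f x \<partial>real_gaussian)"
    by (simp add: nn_integral_real_gaussian)
  finally show ?thesis .
qed

lemma complex_gaussian_rotation:
  assumes ab: "\<alpha>\<^sup>2 + \<beta>\<^sup>2 = 1" "\<beta> \<noteq> 0" and [measurable]: "f \<in> borel_measurable borel"
  shows "(\<integral>\<^sup>+ z. (\<integral>\<^sup>+ w. f (of_real \<alpha> * z + of_real \<beta> * w) \<partial>complex_gaussian) \<partial>complex_gaussian)
    = (\<integral>\<^sup>+ z. f z \<partial>complex_gaussian)"
proof -
  interpret P: pair_prob_space real_gaussian real_gaussian ..
  have c: "of_real \<alpha> * Complex x y + of_real \<beta> * Complex x' y' = Complex (\<alpha> * x + \<beta> * x') (\<alpha> * y + \<beta> * y')" for x y x' y'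
    by (simp add: complex_eq_iff)
  have [measurable]: "(\<lambda>p. Complex (g p) (h p)) \<in> borel_measurable M"
    if [measurable]: "g \<in> borel_measurable M" "h \<in> borel_measurable M" for g h and M :: "'z measure"
    by (simp add: Complex_eq)
  have "(\<integral>\<^sup>+ z. (\<integral>\<^sup>+ w. f (of_real \<alpha> * z + of_real \<beta> * w) \<partial>complex_gaussian) \<partial>complex_gaussian)
    = (\<integral>\<^sup>+ x. (\<integral>\<^sup>+ y. (\<integral>\<^sup>+ x'. (\<integral>\<^sup>+ y'. f (Complex (\<alpha> * x + \<beta> * x') (\<alpha> * y + \<beta> * y'))
        \<partial>real_gaussian) \<partial>real_gaussian) \<partial>real_gaussian) \<partial>real_gaussian)"
    by (simp add: nn_integral_complex_gaussian c)
  also have "\<dots> = (\<integral>\<^sup>+ x. (\<integral>\<^sup>+ x'. (\<integral>\<^sup>+ y. (\<integral>\<^sup>+ y'. f (Complex (\<alpha> * x + \<beta> * x') (\<alpha> * y + \<beta> * y'))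
        \<partial>real_gaussian) \<partial>real_gaussian) \<partial>real_gaussian) \<partial>real_gaussian)"
    by (intro nn_integral_cong P.Fubini') simp
  also have "\<dots> = (\<integral>\<^sup>+ x. (\<integral>\<^sup>+ x'. (\<integral>\<^sup>+ y. f (Complex (\<alpha> * x + \<beta> * x') y) \<partial>real_gaussian) \<partial>real_gaussian) \<partial>real_gaussian)"
    by (intro nn_integral_cong real_gaussian_rotation ab) simp
  also have "\<dots> = (\<integral>\<^sup>+ x. (\<integral>\<^sup>+ y. f (Complex x y) \<partial>real_gaussian) \<partial>real_gaussian)"
    by (rule real_gaussian_rotation[OF ab, where f = "\<lambda>x. \<integral>\<^sup>+ y. f (Complex x y) \<partial>real_gaussian"]) simp
  also have "\<dots> = (\<integral>\<^sup>+ z. f z \<partial>complex_gaussian)"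
    by (simp add: nn_integral_complex_gaussian)
  finally show ?thesis .
qed

subsection \<open>The small-ball estimate\<close>

text \<open>Serves to replace one Gaussian vector by the normalized sum, or difference, of two
  independent ones. Both measures agree on boxes, where the integral factors into single
  entries.\<close>

lemma gaussian_vector_rotation:
  assumes ab: "\<alpha>\<^sup>2 + \<beta>\<^sup>2 = 1" "\<beta> \<noteq> 0"
  shows "distr (gaussian_vector n \<Otimes>\<^sub>M gaussian_vector n) (gaussian_vector n)
      (\<lambda>(u, v). \<lambda>k\<in>{..<n}. of_real \<alpha> * u k + of_real \<beta> * v k) = gaussian_vector n"
    (is "distr ?P _ ?f = _")
proof (rule gaussian_PiM.PiM_eqI)
  have [measurable]: "?f \<in> measurable ?P (gaussian_vector n)"
    unfolding split_beta' by measurable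
  fix A :: "nat \<Rightarrow> complex set" assume A: "\<And>k. k \<in> {..<n} \<Longrightarrow> A k \<in> sets complex_gaussian"
  \<comment> \<open>Inserting \<open>UNIV\<close> outside the index range makes every
    \<open>B k\<close> measurable without a side condition.\<close>
  define B where "B k = (if k < n then A k else UNIV)" for k
  have [measurable]: "B k \<in> sets borel" for k using A by (auto simp: B_def)
  interpret P: pair_prob_space "gaussian_vector n" "gaussian_vector n" ..
  have PiE: "Pi\<^sub>E {..<n} A = Pi\<^sub>E {..<n} B" by (intro PiE_cong) (auto simp: B_def)
  have "emeasure (distr ?P (gaussian_vector n) ?f) (Pi\<^sub>E {..<n} A)
    = (\<integral>\<^sup>+ w. indicator (Pi\<^sub>E {..<n} B) (?f w) \<partial>?P)"
  proof -
    have "Pi\<^sub>E {..<n} B \<in> sets (gaussian_vector n)"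
      by (intro sets_PiM_I_finite) auto
    then have "(\<integral>\<^sup>+ w. indicator (Pi\<^sub>E {..<n} B) (?f w) \<partial>?P)
        = (\<integral>\<^sup>+ v. indicator (Pi\<^sub>E {..<n} B) v \<partial>distr ?P (gaussian_vector n) ?f)"
      by (subst nn_integral_distr) simp_all
    also have "\<dots> = emeasure (distr ?P (gaussian_vector n) ?f) (Pi\<^sub>E {..<n} A)"
      using \<open>Pi\<^sub>E {..<n} B \<in> sets (gaussian_vector n)\<close> unfolding PiE by (subst nn_integral_indicator) simp_all
    finally show ?thesis ..
  qed
  also have "\<dots> = (\<integral>\<^sup>+ w. (\<Prod>k<n. indicator (B k) (of_real \<alpha> * fst w k + of_real \<beta> * snd w k)) \<partial>?P)"
    by (intro nn_integral_cong) (auto simp: indicator_def split_beta' PiE_iff)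
  also have "\<dots> = (\<integral>\<^sup>+ u. (\<integral>\<^sup>+ v. (\<Prod>k<n. indicator (B k) (of_real \<alpha> * u k + of_real \<beta> * v k)) \<partial>gaussian_vector n) \<partial>gaussian_vector n)"
    by (subst gaussian_PiM.nn_integral_fst[symmetric]) auto
  also have "\<dots> = (\<integral>\<^sup>+ u. (\<Prod>k<n. \<integral>\<^sup>+ w. indicator (B k) (of_real \<alpha> * u k + of_real \<beta> * w) \<partial>complex_gaussian) \<partial>gaussian_vector n)"
  proof (rule nn_integral_cong)
    fix u
    show "(\<integral>\<^sup>+ v. (\<Prod>k<n. indicator (B k) (of_real \<alpha> * u k + of_real \<beta> * v k)) \<partial>gaussian_vector n)
      = (\<Prod>k<n. \<integral>\<^sup>+ w. indicator (B k) (of_real \<alpha> * u k + of_real \<beta> * w) \<partial>complex_gaussian)"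
      by (rule gaussian_PiM.product_nn_integral_prod) simp_all
  qed
  also have "\<dots> = (\<Prod>k<n. \<integral>\<^sup>+ z. (\<integral>\<^sup>+ w. indicator (B k) (of_real \<alpha> * z + of_real \<beta> * w) \<partial>complex_gaussian) \<partial>complex_gaussian)"
    by (rule gaussian_PiM.product_nn_integral_prod) simp_all
  also have "\<dots> = (\<Prod>k<n. \<integral>\<^sup>+ z. indicator (B k) z \<partial>complex_gaussian)"
    by (intro prod.cong complex_gaussian_rotation ab refl) auto
  also have "\<dots> = (\<Prod>k<n. emeasure complex_gaussian (A k))"
    using A by (intro prod.cong) (auto simp: B_def)
  finally show "emeasure (distr ?P (gaussian_vector n) ?f) (Pi\<^sub>E {..<n} A) = (\<Prod>k<n. emeasure complex_gaussian (A k))" .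
qed simp_all

lemma cnj_measurable [measurable]: "cnj \<in> borel_measurable borel"
  by (intro borel_measurable_continuous_onI continuous_intros)

definition quad :: "nat \<Rightarrow> (nat \<Rightarrow> nat \<Rightarrow> complex) \<Rightarrow> (nat \<Rightarrow> complex) \<Rightarrow> real" where
  "quad n H v = Re (\<Sum>i<n. \<Sum>j<n. H i j * cnj (v i) * v j)"

definition herm :: "nat \<Rightarrow> (nat \<Rightarrow> nat \<Rightarrow> complex) \<Rightarrow> bool" where
  "herm n H \<longleftrightarrow> (\<forall>i<n. \<forall>j<n. cnj (H i j) = H j i)"

lemma hermD: "herm n H \<Longrightarrow> i < n \<Longrightarrow> j < n \<Longrightarrow> cnj (H i j) = H j i"
  by (simp add: herm_def)

lemma quad_measurable [measurable]: "quad n H \<in> borel_measurable (gaussian_vector n)"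
  unfolding quad_def by measurable

lemma quad_cong: "(\<And>k. k < n \<Longrightarrow> u k = v k) \<Longrightarrow> quad n H u = quad n H v"
  unfolding quad_def by simp

text \<open>Polarization: the pure terms cancel, and the two mixed terms are conjugate to each other
  because \<open>H\<close> is Hermitian.\<close>

lemma quad_add_minus_quad_diff:
  assumes "herm n H"
  shows "quad n H (\<lambda>k. a * u k + b * v k) - quad n H (\<lambda>k. a * u k - b * v k)
    = 4 * Re (a * cnj b * (\<Sum>i<n. cnj (v i) * lin n (H i) u))"
proof -
  let ?S = "\<lambda>u v. \<Sum>i<n. \<Sum>j<n. H i j * cnj (u i) * v j"
  have sw: "cnj (?S u v) = ?S v u" for u v
  proof -
    have "cnj (?S u v) = (\<Sum>i<n. \<Sum>j<n. cnj (H i j) * u i * cnj (v j))"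
      by simp
    also have "\<dots> = (\<Sum>i<n. \<Sum>j<n. H j i * u i * cnj (v j))"
      using assms by (intro sum.cong) (auto simp: hermD)
    also have "\<dots> = ?S v u"
      by (subst sum.swap) (simp add: mult_ac)
    finally show ?thesis .
  qed
  have "?S (\<lambda>k. a * u k + b * v k) (\<lambda>k. a * u k + b * v k) - ?S (\<lambda>k. a * u k - b * v k) (\<lambda>k. a * u k - b * v k)
    = 2 * (a * cnj b * ?S v u) + 2 * (cnj a * b * ?S u v)"
    unfolding sum_distrib_left sum.distrib[symmetric] sum_subtractf[symmetric]
    by (simp add: algebra_simps)
  also have "cnj a * b * ?S u v = cnj (a * cnj b * ?S v u)"
    unfolding complex_cnj_mult sw complex_cnj_cnj ..
  also have "?S v u = (\<Sum>i<n. cnj (v i) * lin n (H i) u)"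
    by (simp add: lin_def sum_distrib_left mult_ac)
  finally have eq: "?S (\<lambda>k. a * u k + b * v k) (\<lambda>k. a * u k + b * v k)
      - ?S (\<lambda>k. a * u k - b * v k) (\<lambda>k. a * u k - b * v k)
    = 2 * (a * cnj b * (\<Sum>i<n. cnj (v i) * lin n (H i) u))
      + 2 * cnj (a * cnj b * (\<Sum>i<n. cnj (v i) * lin n (H i) u))" .
  have "Re (2 * z + 2 * cnj z) = 4 * Re z" for z by simp
  then show ?thesis
    unfolding quad_def minus_complex.sel[symmetric] eq by blast
qed

lemma trunc_diff_le: "trunc (x - y) \<le> trunc x + trunc y"
  by (auto simp: trunc_def min_def)

text \<open>Converts an upper bound on a characteristic function into a lower bound on a truncated
  mean: the latter is at least half of 1 minus the mean of the cosine.\<close>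

lemma cos_ge_one_minus_trunc: "1 - 2 * trunc x \<le> cos x"
proof (cases "\<bar>x\<bar> \<le> 1")
  case True
  have "1 - cos x = 2 * (sin (x / 2))\<^sup>2"
    using cos_double_sin[of "x / 2"] by simp
  also have "(sin (x / 2))\<^sup>2 \<le> (x / 2)\<^sup>2"
    by (subst abs_le_square_iff[symmetric]) (rule abs_sin_x_le_abs_x)
  also have "2 * (x / 2)\<^sup>2 \<le> 2 * \<bar>x\<bar>"
    using True mult_right_mono[of "\<bar>x\<bar>" 1 "\<bar>x\<bar>"] by (simp add: power2_eq_square abs_mult_self_eq)
  finally show ?thesis using True by (simp add: trunc_def)
next
  case False
  then show ?thesis using cos_ge_minus_one[of x] by (simp add: trunc_def)
qed

text \<open>Jensen's inequality, the rows being weighted with their squared norms; for a zero row \<open>1 / 0 = 0\<close> is harmless.\<close>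

lemma expectation_exp_neg_rows:
  assumes H: "(\<Sum>i<n. sqnorm n (H i)) = 1"
  shows "(\<integral>v. exp (- (\<Sum>i<n. (cmod (lin n (H i) v))\<^sup>2)) \<partial>gaussian_vector n) \<le> 1 / 2"
proof -
  let ?r = "\<lambda>i. sqnorm n (H i)" and ?w = "\<lambda>i v. (cmod (lin n (H i) v))\<^sup>2"
  have int: "integrable (gaussian_vector n) (\<lambda>v. exp (- s * ?w i v))" if "0 \<le> s" for s i
    using that by (intro gaussian_PiM.integrable_const_bound[of _ 1]) auto
  have zero: "lin n (H i) v = 0" if "?r i = 0" for i v
    using that by (auto simp: sqnorm_def lin_def sum_nonneg_eq_0_iff)
  have "(\<integral>v. exp (- (\<Sum>i<n. ?w i v)) \<partial>gaussian_vector n)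
    \<le> (\<integral>v. (\<Sum>i<n. ?r i * exp (- (1 / ?r i) * ?w i v)) \<partial>gaussian_vector n)"
  proof (rule integral_mono)
    fix v
    have "n \<noteq> 0" using H by (cases n) auto
    then have "exp (\<Sum>i<n. ?r i *\<^sub>R (- (1 / ?r i) * ?w i v)) \<le> (\<Sum>i<n. ?r i * exp (- (1 / ?r i) * ?w i v))"
      using H by (intro convex_on_sum[OF _ _ exp_convex]) auto
    moreover have "?r i *\<^sub>R (- (1 / ?r i) * ?w i v) = - ?w i v" for i
      using zero[of i v] by auto
    ultimately show "exp (- (\<Sum>i<n. ?w i v)) \<le> (\<Sum>i<n. ?r i * exp (- (1 / ?r i) * ?w i v))"
      by (simp add: sum_negf)
  next
    show "integrable (gaussian_vector n) (\<lambda>v. exp (- (\<Sum>i<n. ?w i v)))"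
      by (intro gaussian_PiM.integrable_const_bound[of _ 1]) (auto intro!: sum_nonneg)
  qed (intro Bochner_Integration.integrable_sum integrable_mult_right int, simp)
  also have "\<dots> = (\<Sum>i<n. ?r i * (\<integral>v. exp (- (1 / ?r i) * ?w i v) \<partial>gaussian_vector n))"
    by (subst Bochner_Integration.integral_sum)
      (rule integrable_mult_right, rule int, simp, simp)
  \<comment> \<open>With \<open>s = 1 / ?r i\<close> the value \<open>1 / (1 + s * ?r i)\<close> is
    1/2 for every nonzero row, whatever its length.\<close>
  also have "\<dots> = (\<Sum>i<n. ?r i * (1 / 2))"
  proof (intro sum.cong refl)
    fix i
    show "?r i * (\<integral>v. exp (- (1 / ?r i) * ?w i v) \<partial>gaussian_vector n) = ?r i * (1 / 2)"
      using gaussian_vector_exp_neg_square[of "1 / ?r i" n "H i"] by (cases "?r i = 0") simp_all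
  qed
  also have "\<dots> = 1 / 2"
    using H by (simp flip: sum_divide_distrib)
  finally show ?thesis .
qed

text \<open>Since \<open>(u + v) / \<surd>2\<close> and \<open>(u - v) / \<surd>2\<close> have the law of \<open>u\<close>, it suffices to bound the
  expectation for the difference \<open>2 Re (v\<^sup>* H u)\<close> of their quadratic forms, which is Gaussian given \<open>u\<close>.\<close>

lemma small_ball:
  assumes herm: "herm n H" and H: "(\<Sum>i<n. sqnorm n (H i)) = 1"
  shows "1 / 8 \<le> (\<integral>v. trunc (quad n H v) \<partial>gaussian_vector n)"
proof -
  let ?N = "gaussian_vector n"
  interpret P: pair_prob_space ?N ?N ..
  define s where "s = sqrt (1 / 2)"
  have s: "s\<^sup>2 + s\<^sup>2 = 1" "s\<^sup>2 + (- s)\<^sup>2 = 1" "s \<noteq> 0" "- s \<noteq> 0" "s * s = 1 / 2"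
    by (simp_all add: s_def)
  let ?D = "\<lambda>u v. 2 * Re (\<Sum>i<n. cnj (v i) * lin n (H i) u)"
  have eq: "(\<integral>v. trunc (quad n H v) \<partial>?N)
    = (\<integral>(u, v). trunc (quad n H (\<lambda>k. of_real s * u k + of_real t * v k)) \<partial>(?N \<Otimes>\<^sub>M ?N))"
    if "t = s \<or> t = - s" for t
  proof -
    have t: "s\<^sup>2 + t\<^sup>2 = 1" "t \<noteq> 0" using that s by auto
    have "(\<integral>v. trunc (quad n H v) \<partial>?N)
      = (\<integral>v. trunc (quad n H v) \<partial>distr (?N \<Otimes>\<^sub>M ?N) ?N (\<lambda>(u, v). \<lambda>k\<in>{..<n}. of_real s * u k + of_real t * v k))"
      unfolding gaussian_vector_rotation[OF t] ..
    also have "\<dots> = (\<integral>(u, v). trunc (quad n H (\<lambda>k\<in>{..<n}. of_real s * u k + of_real t * v k)) \<partial>(?N \<Otimes>\<^sub>M ?N))"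
      by (subst integral_distr) (simp_all add: split_beta')
    also have "\<dots> = (\<integral>(u, v). trunc (quad n H (\<lambda>k. of_real s * u k + of_real t * v k)) \<partial>(?N \<Otimes>\<^sub>M ?N))"
      unfolding split_beta' by (intro Bochner_Integration.integral_cong refl arg_cong[where f = trunc] quad_cong) simp
    finally show ?thesis .
  qed
  let ?Q = "\<lambda>t z. trunc (quad n H (\<lambda>k. of_real s * fst z k + of_real t * snd z k))"
  have [measurable]: "(\<lambda>z. quad n H (\<lambda>k. of_real s * fst z k + of_real t * snd z k)) \<in> borel_measurable (?N \<Otimes>\<^sub>M ?N)" for t
    unfolding quad_def by measurable
  have Qi: "integrable (?N \<Otimes>\<^sub>M ?N) (?Q t)" for t
    by (intro P.integrable_const_bound[of _ 1]) (auto simp: trunc_bounds)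
  have Dm [measurable]: "(\<lambda>z. ?D (fst z) (snd z)) \<in> borel_measurable (?N \<Otimes>\<^sub>M ?N)"
    unfolding lin_def by measurable
  have Di: "integrable (?N \<Otimes>\<^sub>M ?N) (\<lambda>z. trunc (?D (fst z) (snd z)))"
    by (intro P.integrable_const_bound[of _ 1]) (auto simp: trunc_bounds)
  have ci: "integrable (?N \<Otimes>\<^sub>M ?N) (\<lambda>z. cis (?D (fst z) (snd z)))"
    by (intro P.integrable_const_bound[of _ 1]) auto
  then have cosi: "integrable (?N \<Otimes>\<^sub>M ?N) (\<lambda>z. cos (?D (fst z) (snd z)))"
    using integrable_Re by fastforce
  have "complex_of_real (\<integral>z. cos (?D (fst z) (snd z)) \<partial>(?N \<Otimes>\<^sub>M ?N)) = of_real (Re (\<integral>z. cis (?D (fst z) (snd z)) \<partial>(?N \<Otimes>\<^sub>M ?N)))"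
    using integral_Re[OF ci] by simp
  also have "(\<integral>z. cis (?D (fst z) (snd z)) \<partial>(?N \<Otimes>\<^sub>M ?N)) = (\<integral>u. (\<integral>v. cis (?D u v) \<partial>?N) \<partial>?N)"
    using P.integral_fst'[OF ci] by simp
  also have "\<dots> = (\<integral>u. complex_of_real (exp (- (\<Sum>i<n. (cmod (lin n (H i) u))\<^sup>2))) \<partial>?N)"
  proof (rule Bochner_Integration.integral_cong)
    fix u
    \<comment> \<open>For fixed \<open>u\<close> this is a real linear form in \<open>v\<close>
      whose coefficients are the conjugated entries of \<open>H u\<close>, so its characteristic
      function at 1 is the exponential of minus the squared norm of \<open>H u\<close>.\<close>
    have "?D u v = 2 * Re (cnj 1 * lin n (\<lambda>i. cnj (lin n (H i) u)) v)" for v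
      by (simp add: lin_def[of n "\<lambda>i. cnj (lin n (H i) u)"] mult_ac)
    then have "(\<integral>v. cis (?D u v) \<partial>?N) = (\<integral>v. cis (2 * Re (cnj 1 * lin n (\<lambda>i. cnj (lin n (H i) u)) v)) \<partial>?N)"
      by (simp only:)
    also have "\<dots> = exp (- (cmod 1)\<^sup>2 * sqnorm n (\<lambda>i. cnj (lin n (H i) u)))"
      by (rule gaussian_vector_char)
    finally show "(\<integral>v. cis (?D u v) \<partial>?N) = complex_of_real (exp (- (\<Sum>i<n. (cmod (lin n (H i) u))\<^sup>2)))"
      by (simp add: sqnorm_def)
  qed simp
  \<comment> \<open>So \<open>trunc\<close> of the difference has mean at least 1/4. It is at most
    the sum of two truncated forms with equal means, which gives 1/8.\<close>
  finally have "(\<integral>z. cos (?D (fst z) (snd z)) \<partial>(?N \<Otimes>\<^sub>M ?N)) \<le> 1 / 2"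
    using expectation_exp_neg_rows[OF H] by simp
  moreover have "(\<integral>z. 1 - 2 * trunc (?D (fst z) (snd z)) \<partial>(?N \<Otimes>\<^sub>M ?N)) \<le> (\<integral>z. cos (?D (fst z) (snd z)) \<partial>(?N \<Otimes>\<^sub>M ?N))"
    by (intro integral_mono cosi cos_ge_one_minus_trunc Bochner_Integration.integrable_diff
        integrable_mult_right Di P.integrable_const)
  moreover have "(\<integral>z. 1 - 2 * trunc (?D (fst z) (snd z)) \<partial>(?N \<Otimes>\<^sub>M ?N)) = 1 - 2 * (\<integral>z. trunc (?D (fst z) (snd z)) \<partial>(?N \<Otimes>\<^sub>M ?N))"
    by (subst Bochner_Integration.integral_diff) (simp_all only: integrable_mult_right Di P.integrable_const
        integral_mult_right P.prob_space lebesgue_integral_const, simp_all)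
  moreover have "(\<integral>z. trunc (?D (fst z) (snd z)) \<partial>(?N \<Otimes>\<^sub>M ?N)) \<le> (\<integral>z. ?Q s z + ?Q (- s) z \<partial>(?N \<Otimes>\<^sub>M ?N))"
  proof (intro integral_mono Di Bochner_Integration.integrable_add Qi)
    fix z
    have "?D (fst z) (snd z) = quad n H (\<lambda>k. of_real s * fst z k + of_real s * snd z k)
        - quad n H (\<lambda>k. of_real s * fst z k - of_real s * snd z k)"
      by (subst quad_add_minus_quad_diff[OF herm]) (simp add: s(5) flip: of_real_mult)
    then show "trunc (?D (fst z) (snd z)) \<le> ?Q s z + ?Q (- s) z"
      using trunc_diff_le by simp
  qed
  moreover have "(\<integral>z. ?Q s z + ?Q (- s) z \<partial>(?N \<Otimes>\<^sub>M ?N)) = 2 * (\<integral>v. trunc (quad n H v) \<partial>?N)"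
    using eq[of s] eq[of "- s"] Qi[of s] Qi[of "- s"] by (simp add: split_beta')
  ultimately show ?thesis by linarith
qed

subsection \<open>Exponential moments of the Gaussian quadratic forms\<close>

text \<open>The hyperbolic cosine cancels the first-order term: \<open>1 / (1 - y)\<close> and
  \<open>1 / (1 + y)\<close> have the mean \<open>1 / (1 - y\<^sup>2)\<close>. One symmetrized
  measurement therefore costs only order \<open>s\<^sup>2\<close>.\<close>

lemma gaussian_vector_cosh:
  assumes "0 \<le> s" "s * sqnorm n c < 1"
  shows "integrable (gaussian_vector n) (\<lambda>v. exp (s * (cmod (lin n c v))\<^sup>2))"
    and "integrable (gaussian_vector n) (\<lambda>v. cosh (s * (cmod (lin n c v))\<^sup>2))"
    and "(\<integral>v. cosh (s * (cmod (lin n c v))\<^sup>2) \<partial>gaussian_vector n) = 1 / (1 - (s * sqnorm n c)\<^sup>2)"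
proof -
  let ?e = "\<lambda>v. exp (s * (cmod (lin n c v))\<^sup>2)" and ?f = "\<lambda>v. exp (- s * (cmod (lin n c v))\<^sup>2)"
  have "has_bochner_integral (gaussian_vector n) ?e (1 / (1 - s * sqnorm n c))"
    using assms gaussian_vector_exp_square[OF assms]
    by (intro has_bochner_integral_nn_integral) simp_all
  then have e: "integrable (gaussian_vector n) ?e"
    and e': "(\<integral>v. ?e v \<partial>gaussian_vector n) = 1 / (1 - s * sqnorm n c)"
    by (simp_all add: has_bochner_integral_iff)
  show "integrable (gaussian_vector n) ?e" by (rule e)
  have f: "integrable (gaussian_vector n) ?f"
    using assms by (intro gaussian_PiM.integrable_const_bound[of _ 1]) simp_all
  have c: "cosh (s * (cmod (lin n c v))\<^sup>2) = (?e v + ?f v) / 2" for v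
    by (simp add: cosh_field_def)
  show "integrable (gaussian_vector n) (\<lambda>v. cosh (s * (cmod (lin n c v))\<^sup>2))"
    unfolding c by (intro integrable_divide_zero Bochner_Integration.integrable_add e f)
  have "(\<integral>v. cosh (s * (cmod (lin n c v))\<^sup>2) \<partial>gaussian_vector n)
    = (1 / (1 - s * sqnorm n c) + 1 / (1 + s * sqnorm n c)) / 2"
    unfolding c integral_divide_zero Bochner_Integration.integral_add[OF e f] e'
      gaussian_vector_exp_neg_square[OF assms(1)] ..
  also have "\<dots> = 1 / (1 - (s * sqnorm n c)\<^sup>2)"
  proof -
    have "(1 / (1 - y) + 1 / (1 + y)) / 2 = 1 / (1 - y\<^sup>2)" if "0 \<le> y" "y < 1" for y :: real
    proof -
      have "1 - y\<^sup>2 = (1 - y) * (1 + y)" by (simp add: power2_eq_square algebra_simps)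
      moreover have "1 / (1 - y) + 1 / (1 + y) = 2 / ((1 - y) * (1 + y))"
        using that by (subst add_frac_eq) simp_all
      ultimately show ?thesis by simp
    qed
    then show ?thesis by this (use assms in simp_all)
  qed
  finally show "(\<integral>v. cosh (s * (cmod (lin n c v))\<^sup>2) \<partial>gaussian_vector n) = 1 / (1 - (s * sqnorm n c)\<^sup>2)" .
qed

lemma component_measurable: "k < n \<Longrightarrow> (\<lambda>v. v k) \<in> borel_measurable (gaussian_vector n)"
  using measurable_component_singleton[of k "{..<n}" "\<lambda>_. complex_gaussian"]
  unfolding measurable_cong_sets[OF refl sets_complex_gaussian] by simp

lemma integrable_cmod_square_component:
  assumes "k < n"
  shows "integrable (gaussian_vector n) (\<lambda>v. (cmod (v k))\<^sup>2)"
proof -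
  note [measurable] = component_measurable[OF assms]
  let ?c = "\<lambda>j. if j = k then 1 else 0"
  have l: "lin n ?c v = v k" and q: "sqnorm n ?c = 1" for v
    using assms by (simp_all add: lin_def sqnorm_def if_distrib[of "\<lambda>x. x * _"]
        if_distrib[of cmod] if_distrib[of "\<lambda>x. x\<^sup>2"] cong: if_cong)
  have i: "integrable (gaussian_vector n) (\<lambda>v. 2 * exp (1 / 2 * (cmod (v k))\<^sup>2))"
    using gaussian_vector_cosh(1)[of "1 / 2" n ?c] unfolding l q by simp
  show ?thesis
  proof (rule Bochner_Integration.integrable_bound[OF i])
    show "(\<lambda>v. (cmod (v k))\<^sup>2) \<in> borel_measurable (gaussian_vector n)"
      by measurable
    have "x \<le> 2 * exp (1 / 2 * x)" if "0 \<le> x" for x :: real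
      using exp_ge_add_one_self[of "1 / 2 * x"] that by linarith
    then show "AE v in gaussian_vector n. norm ((cmod (v k))\<^sup>2) \<le> norm (2 * exp (1 / 2 * (cmod (v k))\<^sup>2))"
      by simp
  qed
qed

lemma integrable_quad: "integrable (gaussian_vector n) (quad n H)"
proof -
  have prod: "integrable (gaussian_vector n) (\<lambda>v. cnj (v i) * v j)" if "i < n" "j < n" for i j
  proof (rule Bochner_Integration.integrable_bound)
    note [measurable] = component_measurable[OF that(1)] component_measurable[OF that(2)]
    show "integrable (gaussian_vector n) (\<lambda>v. (cmod (v i))\<^sup>2 + (cmod (v j))\<^sup>2)"
      using that by (intro Bochner_Integration.integrable_add integrable_cmod_square_component)
    show "(\<lambda>v. cnj (v i) * v j) \<in> borel_measurable (gaussian_vector n)"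
      by measurable
    have "cmod (cnj a * b) \<le> (cmod a)\<^sup>2 + (cmod b)\<^sup>2" for a b
    proof -
      have "2 * (cmod a * cmod b) \<le> (cmod a)\<^sup>2 + (cmod b)\<^sup>2"
        using sum_squares_bound[of "cmod a" "cmod b"] by (simp add: mult.assoc)
      moreover have "0 \<le> cmod a * cmod b" by simp
      ultimately show ?thesis unfolding norm_mult complex_mod_cnj by linarith
    qed
    then show "AE v in gaussian_vector n. norm (cnj (v i) * v j) \<le> norm ((cmod (v i))\<^sup>2 + (cmod (v j))\<^sup>2)"
      by simp
  qed
  show ?thesis
    unfolding quad_def mult.assoc
    by (intro integrable_Re Bochner_Integration.integrable_sum integrable_mult_right prod) simp_all
qed

section \<open>The random matrix process and effective rank\<close>

definition tr :: "nat \<Rightarrow> (nat \<Rightarrow> nat \<Rightarrow> complex) \<Rightarrow> (nat \<Rightarrow> nat \<Rightarrow> complex) \<Rightarrow> real" where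
  "tr n M H = Re (\<Sum>i<n. \<Sum>j<n. M i j * H j i)"

text \<open>A rank-one update is one step of the random matrix \<open>2 \<Sum>\<^sub>j
  \<epsilon>\<^sub>j a\<^sub>j a\<^sub>j\<^sup>*\<close>. This is its effect on the process indexed
  by \<open>H\<close>; \<open>quad_add_outer\<close> gives the effect on the process indexed by net
  points.\<close>

lemma tr_add_outer:
  "tr n (\<lambda>i j. M i j + of_real c * (x i * cnj (x j))) H = tr n M H + c * quad n H x"
proof -
  have "(\<Sum>i<n. \<Sum>j<n. (M i j + of_real c * (x i * cnj (x j))) * H j i)
    = (\<Sum>i<n. \<Sum>j<n. M i j * H j i) + of_real c * (\<Sum>i<n. \<Sum>j<n. H j i * cnj (x j) * x i)"
    unfolding distrib_right sum.distrib sum_distrib_left by (simp add: mult_ac)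
  also have "(\<Sum>i<n. \<Sum>j<n. H j i * cnj (x j) * x i) = (\<Sum>i<n. \<Sum>j<n. H i j * cnj (x i) * x j)"
    by (rule sum.swap)
  finally show ?thesis by (simp add: tr_def quad_def)
qed

lemma quad_add_outer:
  "quad n (\<lambda>i j. M i j + of_real c * (x i * cnj (x j))) u
    = quad n M u + c * (cmod (lin n (\<lambda>i. cnj (u i)) x))\<^sup>2"
proof -
  have "(\<Sum>i<n. \<Sum>j<n. (M i j + of_real c * (x i * cnj (x j))) * cnj (u i) * u j)
    = (\<Sum>i<n. \<Sum>j<n. M i j * cnj (u i) * u j)
      + of_real c * ((\<Sum>i<n. cnj (u i) * x i) * (\<Sum>j<n. u j * cnj (x j)))"
  proof -
    have "of_real c * ((\<Sum>i<n. cnj (u i) * x i) * (\<Sum>j<n. u j * cnj (x j)))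
      = (\<Sum>i<n. \<Sum>j<n. of_real c * (x i * cnj (x j)) * cnj (u i) * u j)"
      by (subst sum_product) (simp add: sum_distrib_left mult_ac)
    then show ?thesis by (simp add: distrib_right sum.distrib)
  qed
  also have "(\<Sum>j<n. u j * cnj (x j)) = cnj (\<Sum>i<n. cnj (u i) * x i)"
    by simp
  also have "(\<Sum>i<n. cnj (u i) * x i) * cnj (\<Sum>i<n. cnj (u i) * x i)
      = of_real ((cmod (lin n (\<lambda>i. cnj (u i)) x))\<^sup>2)"
    unfolding lin_def by (rule complex_norm_square[symmetric])
  finally show ?thesis
    by (simp only: quad_def plus_complex.sel Re_complex_of_real flip: of_real_mult)
qed

lemma herm_add_outer: "herm n M \<Longrightarrow> herm n (\<lambda>i j. M i j + of_real c * (x i * cnj (x j)))"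
  by (simp add: herm_def mult.commute)

text \<open>For Hermitian \<open>M\<close> this says that the operator norm is at most
  \<open>S\<close>.\<close>

definition form_bound :: "nat \<Rightarrow> (nat \<Rightarrow> nat \<Rightarrow> complex) \<Rightarrow> real \<Rightarrow> bool" where
  "form_bound n M S \<longleftrightarrow> 0 \<le> S \<and> (\<forall>x. \<bar>quad n M x\<bar> \<le> S * sqnorm n x)"

text \<open>The normalized Hermitian matrices of effective rank \<open>r\<close>: by duality the last condition says that
  their nuclear norm is at most \<open>3 \<surd>r\<close>.\<close>

definition eff_low_rank :: "nat \<Rightarrow> nat \<Rightarrow> (nat \<Rightarrow> nat \<Rightarrow> complex) set" where
  "eff_low_rank n r = {H. herm n H \<and> (\<Sum>i<n. sqnorm n (H i)) = 1 \<and>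
     (\<forall>M S. herm n M \<longrightarrow> form_bound n M S \<longrightarrow> tr n M H \<le> 3 * sqrt r * S)}"

text \<open>A finite part of the unit ball that determines operator norms of Hermitian matrices up
  to a factor 2. This factor and the \<open>3 * sqrt r\<close> of \<open>eff_low_rank\<close> make
  up the \<open>6 * sqrt r\<close> in \<open>rad_gaussian_le\<close>.\<close>

definition norming_net :: "nat \<Rightarrow> (nat \<Rightarrow> complex) set \<Rightarrow> bool" where
  "norming_net n U \<longleftrightarrow> finite U \<and> U \<noteq> {} \<and> (\<forall>u\<in>U. sqnorm n u \<le> 1) \<and>
     (\<forall>M. herm n M \<longrightarrow> form_bound n M (2 * Max ((\<lambda>u. \<bar>quad n M u\<bar>) ` U)))"

lemma sqnorm_cnj [simp]: "sqnorm n (\<lambda>i. cnj (u i)) = sqnorm n u"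
  by (simp add: sqnorm_def)

lemma finite_process_quad:
  assumes "finite D" "D \<noteq> {}"
  shows "finite_process (gaussian_vector n) D (\<lambda>x H. quad n H x)"
proof -
  interpret prob_space "gaussian_vector n"
    by (rule prob_space_PiM) (rule prob_space_complex_gaussian)
  show ?thesis
    using assms integrable_quad by unfold_locales auto
qed

text \<open>The invariant of \<open>rad_le_ln_sum_cosh\<close> is the existence of a Hermitian state
  \<open>M\<close> that yields the offset by traces and \<open>w\<close> by its quadratic form. The
  free scale \<open>s\<close> trades the term growing with \<open>m\<close> against the logarithm of
  the net size.\<close>

lemma rad_gaussian_le:
  assumes U: "norming_net n U" and D: "finite D" "D \<noteq> {}" "D \<subseteq> eff_low_rank n r"
    and s: "0 < s" "8 * s\<^sup>2 \<le> 1"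
  shows "finite_process.rad (gaussian_vector n) D (\<lambda>x H. quad n H x) m (\<lambda>_. 0)
    \<le> 6 * sqrt r / s * (8 * s\<^sup>2 * real m + ln (2 * real (card U)))"
proof -
  interpret finite_process "gaussian_vector n" D "\<lambda>x H. quad n H x"
    using D by (intro finite_process_quad)
  have U': "finite U" "U \<noteq> {}" "\<And>u. u \<in> U \<Longrightarrow> sqnorm n u \<le> 1"
    "\<And>M. herm n M \<Longrightarrow> form_bound n M (2 * Max ((\<lambda>u. \<bar>quad n M u\<bar>) ` U))"
    using U by (auto simp: norming_net_def)
  define \<kappa> where "\<kappa> = 1 / (1 - 4 * s\<^sup>2)"
  have \<kappa>: "0 < \<kappa>" using s by (simp add: \<kappa>_def)
  let ?q = "\<lambda>x u. (cmod (lin n (\<lambda>i. cnj (u i)) x))\<^sup>2"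
  let ?G = "\<lambda>g w. \<exists>M. herm n M \<and> (\<forall>H\<in>D. g H = tr n M H) \<and> (\<forall>u. w u = quad n M u)"
  have G: "?G (\<lambda>H. g H + c * quad n H x) (\<lambda>u. w u + c * ?q x u)" if G: "?G g w" for g w x c
  proof -
    from G obtain M where "herm n M" "\<forall>H\<in>D. g H = tr n M H" "\<forall>u. w u = quad n M u" by blast
    then show ?thesis
      by (intro exI[of _ "\<lambda>i j. M i j + of_real c * (x i * cnj (x j))"])
        (simp add: herm_add_outer tr_add_outer quad_add_outer)
  qed
  have s2: "2 * s * t < 1" if "t \<le> 1" for t
  proof -
    have "(2 * s)\<^sup>2 < 1\<^sup>2" using s by (simp add: power_mult_distrib)
    then have "2 * s < 1" using power_less_imp_less_base[of "2 * s" 2 1] by simp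
    moreover have "2 * s * t \<le> 2 * s" using that s by (simp add: mult_left_le)
    ultimately show ?thesis by linarith
  qed
  have "rad m (\<lambda>_. 0) \<le> 6 * sqrt r / s * ln (\<kappa> ^ m * (\<Sum>u\<in>U. 2 * cosh (s * 0)))"
  proof (rule rad_le_ln_sum_cosh[where G = ?G and q = ?q])
    fix g w H assume "?G g w" "H \<in> D"
    then obtain M where M: "herm n M" "g H = tr n M H" "\<forall>u. w u = quad n M u" by blast
    have "tr n M H \<le> 3 * sqrt r * (2 * Max ((\<lambda>u. \<bar>quad n M u\<bar>) ` U))"
      using \<open>H \<in> D\<close> D(3) M(1) U'(4)[OF M(1)] unfolding eff_low_rank_def by blast
    then show "g H \<le> 6 * sqrt r * Max ((\<lambda>u. \<bar>w u\<bar>) ` U)"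
      using M by simp
  next
    fix g w x assume g: "?G g w"
    show "?G (\<lambda>H. g H + 2 * quad n H x) (\<lambda>u. w u + 2 * ?q x u)"
      by (rule G[OF g])
    show "?G (\<lambda>H. g H - 2 * quad n H x) (\<lambda>u. w u - 2 * ?q x u)"
      using G[OF g, of "-2" x] by simp
  next
    fix u assume u: "u \<in> U"
    have c: "2 * s * sqnorm n (\<lambda>i. cnj (u i)) < 1"
      using s2 U'(3)[OF u] by simp
    show "integrable (gaussian_vector n) (\<lambda>x. cosh (2 * s * ?q x u))"
      using s by (intro gaussian_vector_cosh(2) c) simp
    have "(\<integral>x. cosh (2 * s * ?q x u) \<partial>gaussian_vector n) = 1 / (1 - (2 * s * sqnorm n u)\<^sup>2)"
      using s by (subst gaussian_vector_cosh(3)[OF _ c]) simp_all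
    also have "\<dots> \<le> 1 / (1 - (2 * s)\<^sup>2)"
    proof (intro divide_left_mono diff_left_mono power_mono)
      show "2 * s * sqnorm n u \<le> 2 * s" using U'(3)[OF u] s by (simp add: mult_left_le)
      have "(2 * s * sqnorm n u)\<^sup>2 < 1"
        using c s by (simp add: power_less_one_iff abs_square_less_1)
      then show "0 < (1 - (2 * s * sqnorm n u)\<^sup>2) * (1 - (2 * s)\<^sup>2)"
        using s by (intro mult_pos_pos) (simp_all add: power_mult_distrib)
    qed (use s in simp_all)
    finally show "(\<integral>x. cosh (2 * s * ?q x u) \<partial>gaussian_vector n) \<le> \<kappa>"
      by (simp add: \<kappa>_def power_mult_distrib)
  next
    show "?G (\<lambda>_. 0) (\<lambda>_. 0)"
      by (intro exI[of _ "\<lambda>_ _. 0"]) (simp add: herm_def tr_def quad_def)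
  qed (use U' s \<kappa> in simp_all)
  also have "ln (\<kappa> ^ m * (\<Sum>u\<in>U. 2 * cosh (s * 0))) = real m * ln \<kappa> + ln (2 * real (card U))"
    using \<kappa> U'(1,2) by (simp add: ln_mult ln_realpow card_gt_0_iff mult.commute)
  finally have rad: "rad m (\<lambda>_. 0) \<le> 6 * sqrt r / s * (real m * ln \<kappa> + ln (2 * real (card U)))" .
  \<comment> \<open>The assumption on \<open>s\<close> keeps \<open>1 - 4 * s\<^sup>2\<close> at
    least 1/2.\<close>
  have "ln \<kappa> \<le> 8 * s\<^sup>2"
  proof -
    have "ln \<kappa> \<le> \<kappa> - 1" using ln_le_minus_one \<kappa> by blast
    also have "\<dots> = 4 * s\<^sup>2 / (1 - 4 * s\<^sup>2)" using s by (simp add: \<kappa>_def field_simps)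
    also have "\<dots> \<le> 4 * s\<^sup>2 / (1 / 2)" using s by (intro divide_left_mono) simp_all
    finally show ?thesis by simp
  qed
  then have "real m * ln \<kappa> \<le> 8 * s\<^sup>2 * real m"
    by (subst mult.commute, intro mult_right_mono) simp_all
  then have "6 * sqrt r / s * (real m * ln \<kappa> + ln (2 * real (card U)))
    \<le> 6 * sqrt r / s * (8 * s\<^sup>2 * real m + ln (2 * real (card U)))"
    using s by (intro mult_left_mono add_right_mono) simp_all
  with rad show ?thesis by (rule order.trans)
qed

text \<open>Markov's inequality for the exponential moment of the maximal deviation.\<close>

lemma gaussian_deviation:
  assumes U: "norming_net n U" and D: "finite D" "D \<noteq> {}" "D \<subseteq> eff_low_rank n r" and r: "1 \<le> r"
    and m: "0 < m" "384 * 3072 * real r * ln (2 * real (card U)) \<le> real m"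
  shows "measure (gaussian_vectors n m)
      {\<omega> \<in> space (gaussian_vectors n m). \<exists>H\<in>D. (\<Sum>j<m. trunc (quad n H (\<omega> j))) < real m / 16}
    \<le> exp (- real m / 512)" (is "measure ?M ?B \<le> _")
proof -
  interpret finite_process "gaussian_vector n" D "\<lambda>x H. quad n H x"
    using D by (intro finite_process_quad)
  interpret M: prob_space ?M
    unfolding gaussian_vectors_def by (intro prob_space_PiM prob_space_complex_gaussian)
  have M: "?M = (\<Pi>\<^sub>M j\<in>{..<m}. gaussian_vector n)" by (simp add: gaussian_vectors_def)
  \<comment> \<open>With this value the first term of the bound on \<open>R\<close> is
    \<open>m / 64\<close>, as \<open>48 / 3072 = 1 / 64\<close>. The assumption on \<open>m\<close>
    bounds the second by \<open>m / 64\<close> too, as \<open>384 = 6 * 64\<close>.\<close>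
  define s where "s = 1 / (3072 * sqrt r)"
  have r': "0 < sqrt r" "1 \<le> sqrt r" using r by simp_all
  have s: "0 < s" "s * sqrt r = 1 / 3072" "s\<^sup>2 = 1 / (3072 * 3072 * r)"
    using r' by (simp_all add: s_def power_divide power_mult_distrib)
  have "8 * s\<^sup>2 \<le> 1" using r by (simp add: s(3))
  define R where "R = rad m (\<lambda>_. 0)"
  have "R \<le> 6 * sqrt r / s * (8 * s\<^sup>2 * real m + ln (2 * real (card U)))"
    unfolding R_def by (rule rad_gaussian_le[OF U D s(1) \<open>8 * s\<^sup>2 \<le> 1\<close>])
  also have "\<dots> = 48 * (s * sqrt r) * m + 6 * sqrt r / s * ln (2 * real (card U))"
    using s(1) by (simp add: distrib_left power2_eq_square)
  also have "6 * sqrt r / s = 6 * 3072 * real r"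
    using r' by (simp add: s_def)
  finally have R: "R \<le> real m / 32"
    using m(2) unfolding s(2) by simp
  let ?V = "\<lambda>w. Max ((\<lambda>H. 0 + (\<Sum>j<m. mu H - trunc (quad n H (w j)))) ` D)"
  have [measurable]: "?V \<in> borel_measurable ?M"
    unfolding M using D(1,2) by measurable
  have B [measurable]: "?B \<in> sets ?M"
    unfolding M using D(1) by measurable
  have "ennreal (measure ?M ?B * exp (real m / 128)) = (\<integral>\<^sup>+ w. ennreal (exp (real m / 128)) * indicator ?B w \<partial>?M)"
    using B by (simp add: nn_integral_cmult M.emeasure_eq_measure ennreal_mult mult.commute)
  \<comment> \<open>On the event the deviation is at least \<open>m / 8 - m / 16\<close>, so the
    factor 1/8 yields the exponent \<open>m / 128\<close>. The moment is at most the exponential of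
    \<open>m / 256 + m / 512\<close>; the difference of the exponents is
    \<open>- m / 512\<close>.\<close>
  also have "\<dots> \<le> (\<integral>\<^sup>+ w. exp (1 / 8 * ?V w) \<partial>?M)"
  proof (intro nn_integral_mono)
    fix w
    have "real m / 128 \<le> 1 / 8 * ?V w" if w: "w \<in> ?B"
    proof -
      obtain H where H: "H \<in> D" "(\<Sum>j<m. trunc (quad n H (w j))) < real m / 16"
        using w by blast
      have "herm n H" "(\<Sum>i<n. sqnorm n (H i)) = 1"
        using H(1) D(3) by (auto simp: eff_low_rank_def)
      from mult_left_mono[OF small_ball[OF this], of "real m"]
      have "real m / 8 \<le> real m * mu H" by simp
      then have "real m / 16 \<le> 0 + (\<Sum>j<m. mu H - trunc (quad n H (w j)))"
        using H(2) by (simp add: sum_subtractf)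
      also have "\<dots> \<le> ?V w"
        using H(1) D(1) by (intro Max_ge) auto
      finally show ?thesis by simp
    qed
    then show "ennreal (exp (real m / 128)) * indicator ?B w \<le> ennreal (exp (1 / 8 * ?V w))"
      by (auto split: split_indicator intro!: ennreal_leI)
  qed
  also have "\<dots> \<le> ennreal (exp (1 / 8 * R + real m * (1 / 8)\<^sup>2 / 8))"
    unfolding M R_def by (rule rad_exp_moment) simp
  also have "\<dots> \<le> ennreal (exp (- real m / 512 + real m / 128))"
    using R by (intro ennreal_leI) (simp add: power2_eq_square)
  finally have "measure ?M ?B * exp (real m / 128) \<le> exp (- real m / 512) * exp (real m / 128)"
    by (subst (asm) ennreal_le_iff) (simp_all flip: exp_add)
  then show ?thesis by simp
qed

subsection \<open>A norming net of the unit ball\<close>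

lemma quad_scale: "quad n M (\<lambda>k. of_real c * x k) = c\<^sup>2 * quad n M x"
proof -
  have "(\<Sum>i<n. \<Sum>j<n. M i j * cnj (of_real c * x i) * (of_real c * x j))
    = of_real (c\<^sup>2) * (\<Sum>i<n. \<Sum>j<n. M i j * cnj (x i) * x j)"
    by (simp add: sum_distrib_left power2_eq_square mult_ac)
  then show ?thesis by (simp add: quad_def)
qed

lemma sqnorm_scale: "sqnorm n (\<lambda>k. of_real c * x k) = c\<^sup>2 * sqnorm n x"
  by (simp add: sqnorm_def norm_mult power_mult_distrib sum_distrib_left)

lemma sqnorm_parallelogram:
  "sqnorm n (\<lambda>k. x k + y k) + sqnorm n (\<lambda>k. x k - y k) = 2 * sqnorm n x + 2 * sqnorm n y"
  unfolding sqnorm_def sum.distrib[symmetric] sum_distrib_left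
  by (intro sum.cong refl) (simp add: cmod_power2 power2_sum power2_diff)

lemma cmod_le_1_of_sqnorm: "sqnorm n x = 1 \<Longrightarrow> i < n \<Longrightarrow> cmod (x i) \<le> 1"
proof -
  assume x: "sqnorm n x = 1" and i: "i < n"
  have "(cmod (x i))\<^sup>2 \<le> sqnorm n x"
    unfolding sqnorm_def using i by (intro member_le_sum) auto
  then show ?thesis using x by (simp add: abs_square_le_1)
qed

lemma form_bound_of_sphere:
  assumes S: "0 \<le> S" and le: "\<And>x. sqnorm n x = 1 \<Longrightarrow> \<bar>quad n M x\<bar> \<le> S"
  shows "form_bound n M S"
  unfolding form_bound_def
proof (intro conjI allI S)
  fix x
  show "\<bar>quad n M x\<bar> \<le> S * sqnorm n x"
  proof (cases "sqnorm n x = 0")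
    case True
    then have "x i = 0" if "i < n" for i
      using that by (simp add: sqnorm_def sum_nonneg_eq_0_iff)
    then show ?thesis by (simp add: quad_def True)
  next
    case False
    then have p: "0 < sqnorm n x" by (simp add: order.not_eq_order_implies_strict)
    let ?c = "1 / sqrt (sqnorm n x)"
    have c: "?c\<^sup>2 = 1 / sqnorm n x" using p by (simp add: power_divide)
    have "sqnorm n (\<lambda>k. of_real ?c * x k) = 1"
      unfolding sqnorm_scale c using p by simp
    from le[OF this] show ?thesis
      unfolding quad_scale c using p by (simp add: abs_mult field_simps)
  qed
qed

text \<open>A crude bound by the moduli of all entries; it makes the supremum in
  \<open>norming_netI\<close> one of a bounded set.\<close>

lemma form_bound_exists: "\<exists>S. form_bound n M S"
proof (intro exI form_bound_of_sphere)
  fix x assume x: "sqnorm n x = 1"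
  have "\<bar>quad n M x\<bar> \<le> cmod (\<Sum>i<n. \<Sum>j<n. M i j * cnj (x i) * x j)"
    unfolding quad_def by (rule abs_Re_le_cmod)
  also have "\<dots> \<le> (\<Sum>i<n. \<Sum>j<n. cmod (M i j * cnj (x i) * x j))"
    by (intro order.trans[OF norm_sum] sum_mono) auto
  also have "\<dots> \<le> (\<Sum>i<n. \<Sum>j<n. cmod (M i j))"
  proof (intro sum_mono)
    fix i j assume "i \<in> {..<n}" "j \<in> {..<n}"
    then have "cmod (x i) * cmod (x j) \<le> 1"
      using cmod_le_1_of_sqnorm[OF x] by (intro mult_le_one) auto
    then show "cmod (M i j * cnj (x i) * x j) \<le> cmod (M i j)"
      by (simp add: norm_mult mult.assoc mult_left_le)
  qed
  finally show "\<bar>quad n M x\<bar> \<le> (\<Sum>i<n. \<Sum>j<n. cmod (M i j))" .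
qed (simp add: sum_nonneg)

text \<open>Polarization with the vectors \<open>t * u\<close> and \<open>v / t\<close>, whose mixed
  term does not depend on \<open>t\<close>. The free parameter balances two norms of different
  size.\<close>

lemma form_bound_polarized:
  assumes M: "herm n M" and S: "form_bound n M S" and t: "t \<noteq> 0"
  shows "4 * \<bar>Re (\<Sum>i<n. cnj (v i) * lin n (M i) u)\<bar> \<le> 2 * S * (t\<^sup>2 * sqnorm n u + sqnorm n v / t\<^sup>2)"
proof -
  let ?a = "\<lambda>k. of_real t * u k" and ?b = "\<lambda>k. of_real (1 / t) * v k"
  have q: "\<bar>quad n M x\<bar> \<le> S * sqnorm n x" for x using S by (simp add: form_bound_def)
  have "quad n M (\<lambda>k. ?a k + ?b k) - quad n M (\<lambda>k. ?a k - ?b k)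
    = 4 * Re (\<Sum>i<n. cnj (v i) * lin n (M i) u)"
    by (subst quad_add_minus_quad_diff[OF M]) (use t in simp)
  then have "4 * \<bar>Re (\<Sum>i<n. cnj (v i) * lin n (M i) u)\<bar>
    \<le> S * (sqnorm n (\<lambda>k. ?a k + ?b k) + sqnorm n (\<lambda>k. ?a k - ?b k))"
    using q[of "\<lambda>k. ?a k + ?b k"] q[of "\<lambda>k. ?a k - ?b k"] unfolding distrib_left by linarith
  also have "\<dots> = 2 * S * (t\<^sup>2 * sqnorm n u + sqnorm n v / t\<^sup>2)"
    unfolding sqnorm_parallelogram sqnorm_scale by (simp add: power_divide algebra_simps)
  finally show ?thesis .
qed

text \<open>If \<open>S\<close> is the least bound of the form on the unit sphere, approximation by the net gives \<open>S \<le> max + S / 2\<close>.\<close>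

lemma norming_netI:
  assumes U: "finite U" "U \<noteq> {}" "\<And>u. u \<in> U \<Longrightarrow> sqnorm n u \<le> 1"
    and approx: "\<And>x. sqnorm n x = 1 \<Longrightarrow> \<exists>u\<in>U. sqnorm n (\<lambda>k. x k - u k) \<le> 1 / 16"
  shows "norming_net n U"
  unfolding norming_net_def
proof (intro conjI ballI allI impI U)
  fix M assume M: "herm n M"
  define mx where "mx = Max ((\<lambda>u. \<bar>quad n M u\<bar>) ` U)"
  have mx: "\<bar>quad n M u\<bar> \<le> mx" if "u \<in> U" for u
    unfolding mx_def using U that by simp
  have mx0: "0 \<le> mx"
    using U(2) mx abs_ge_zero order.trans by blast
  have bdd: "bdd_above ((\<lambda>x. \<bar>quad n M x\<bar>) ` {x. sqnorm n x = 1})"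
  proof -
    obtain K where "form_bound n M K" using form_bound_exists by blast
    then have "\<bar>quad n M x\<bar> \<le> K" if "sqnorm n x = 1" for x
      using that unfolding form_bound_def by (metis mult.right_neutral)
    then show ?thesis by (intro bdd_aboveI2) simp
  qed
  define S where "S = (SUP x\<in>{x. sqnorm n x = 1}. \<bar>quad n M x\<bar>)"
  have le: "\<bar>quad n M x\<bar> \<le> 2 * mx" if x: "sqnorm n x = 1" for x
  proof -
    have S_ge: "\<bar>quad n M y\<bar> \<le> S" if "sqnorm n y = 1" for y
      unfolding S_def using bdd that by (intro cSUP_upper) auto
    have S0: "0 \<le> S" using S_ge[OF x] by linarith
    have fb: "form_bound n M S" by (rule form_bound_of_sphere[OF S0 S_ge])
    have "\<bar>quad n M y\<bar> \<le> mx + S / 2" if y: "sqnorm n y = 1" for y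
    proof -
      obtain u where u: "u \<in> U" "sqnorm n (\<lambda>k. y k - u k) \<le> 1 / 16"
        using approx[OF y] by blast
      \<comment> \<open>Then \<open>y = p + d\<close> and \<open>u = p - d\<close>, so the
        difference of the forms is a single mixed term, linear in the small vector
        \<open>d\<close>.\<close>
      define p d where "p k = of_real (1 / 2) * (y k + u k)" and "d k = of_real (1 / 2) * (y k - u k)" for k
      have d: "sqnorm n d \<le> 1 / 64"
        unfolding d_def sqnorm_scale using u(2) by (simp add: power_divide)
      have p: "sqnorm n p \<le> 1"
        unfolding p_def sqnorm_scale
      proof -
        have "sqnorm n (\<lambda>k. y k + u k) \<le> 4"
          using sqnorm_parallelogram[of n y u] y U(3)[OF u(1)] sqnorm_nonneg[of n "\<lambda>k. y k - u k"]
          by linarith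
        then show "(1 / 2)\<^sup>2 * sqnorm n (\<lambda>k. y k + u k) \<le> 1" by (simp add: power_divide)
      qed
      have "quad n M y - quad n M u = quad n M (\<lambda>k. 1 * p k + 1 * d k) - quad n M (\<lambda>k. 1 * p k - 1 * d k)"
        by (simp add: p_def d_def field_simps)
      also have "\<dots> = 4 * Re (\<Sum>i<n. cnj (d i) * lin n (M i) p)"
        by (subst quad_add_minus_quad_diff[OF M]) simp
      finally have "\<bar>quad n M y - quad n M u\<bar> = 4 * \<bar>Re (\<Sum>i<n. cnj (d i) * lin n (M i) p)\<bar>"
        by (simp only: abs_mult abs_numeral)
      \<comment> \<open>For \<open>t\<^sup>2 = 1 / 8\<close> both summands are at most 1/8, since
        \<open>sqnorm n d \<le> 1 / 64\<close>; the total is \<open>S / 2\<close>. This is why the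
        net has radius 1/4.\<close>
      also have "\<dots> \<le> 2 * S * ((sqrt (1 / 8))\<^sup>2 * sqnorm n p + sqnorm n d / (sqrt (1 / 8))\<^sup>2)"
        by (rule form_bound_polarized[OF M fb]) simp
      also have "\<dots> \<le> 2 * S * (1 / 4)"
        using S0 p d by (intro mult_left_mono) simp_all
      finally show ?thesis using mx[OF u(1)] by linarith
    qed
    then have "S \<le> mx + S / 2"
      unfolding S_def using x by (intro cSUP_least) auto
    then show ?thesis using S_ge[OF x] by linarith
  qed
  show "form_bound n M (2 * Max ((\<lambda>u. \<bar>quad n M u\<bar>) ` U))"
    unfolding mx_def[symmetric] using mx0 by (intro form_bound_of_sphere le) simp_all
qed

section \<open>Counting lattice points in a ball\<close>

lemma sum_half_power_abs: "(\<Sum>z\<in>{- int L..int L}. (1 / 2 :: real) ^ nat \<bar>z\<bar>) = 3 - 2 * (1 / 2) ^ L"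
proof (induction L)
  case (Suc L)
  have "{- int (Suc L)..int (Suc L)} = insert (- int (Suc L)) (insert (int (Suc L)) {- int L..int L})"
    by auto
  moreover have "nat \<bar>- int (Suc L)\<bar> = Suc L" "nat \<bar>int (Suc L)\<bar> = Suc L" by linarith+
  ultimately have "(\<Sum>z\<in>{- int (Suc L)..int (Suc L)}. (1 / 2 :: real) ^ nat \<bar>z\<bar>)
    = 2 * (1 / 2) ^ Suc L + (\<Sum>z\<in>{- int L..int L}. (1 / 2) ^ nat \<bar>z\<bar>)"
    by (simp del: of_nat_Suc)
  then show ?case using Suc.IH by simp
qed simp

text \<open>The integer points of a ball in real dimension \<open>2 * n\<close>; extensionality of
  the functions makes the set finite.\<close>

definition lattice_ball :: "nat \<Rightarrow> nat \<Rightarrow> (nat \<Rightarrow> int \<times> int) set" where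
  "lattice_ball n R = {z \<in> ({..<n} \<rightarrow>\<^sub>E UNIV). (\<Sum>k<n. (fst (z k))\<^sup>2 + (snd (z k))\<^sup>2) \<le> int R}"

lemma int_abs_le_square: "\<bar>z :: int\<bar> \<le> z\<^sup>2"
proof (cases "z = 0")
  case False
  then have "\<bar>z\<bar> * 1 \<le> \<bar>z\<bar> * \<bar>z\<bar>" by (intro mult_left_mono) auto
  then show ?thesis by (simp add: power2_eq_square)
qed simp

text \<open>The weight \<open>2 ^ - (\<bar>p\<^sub>1\<bar> + \<bar>q\<^sub>1\<bar> + \<dots>)\<close> is at least \<open>2 ^ - R\<close> on the ball and has total mass at most \<open>9\<^sup>n\<close>.\<close>

lemma lattice_ball_card: "finite (lattice_ball n R)" "real (card (lattice_ball n R)) \<le> 2 ^ R * 9 ^ n"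
proof -
  let ?B = "{- int R..int R}"
  let ?A = "{..<n} \<rightarrow>\<^sub>E (?B \<times> ?B)"
  let ?w = "\<lambda>p :: int \<times> int. (1 / 2 :: real) ^ (nat \<bar>fst p\<bar> + nat \<bar>snd p\<bar>)"
  have sub: "lattice_ball n R \<subseteq> ?A"
  proof (intro subsetI PiE_I)
    fix z k assume z: "z \<in> lattice_ball n R" and k: "k \<in> {..<n}"
    have "(fst (z k))\<^sup>2 + (snd (z k))\<^sup>2 \<le> (\<Sum>k<n. (fst (z k))\<^sup>2 + (snd (z k))\<^sup>2)"
      using k by (intro member_le_sum[where f = "\<lambda>k. (fst (z k))\<^sup>2 + (snd (z k))\<^sup>2"]) auto
    then have le: "(fst (z k))\<^sup>2 + (snd (z k))\<^sup>2 \<le> int R"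
      using z by (simp add: lattice_ball_def)
    have "\<bar>fst (z k)\<bar> \<le> int R" "\<bar>snd (z k)\<bar> \<le> int R"
      using le int_abs_le_square[of "fst (z k)"] int_abs_le_square[of "snd (z k)"]
        zero_le_power2[of "fst (z k)"] zero_le_power2[of "snd (z k)"] by linarith+
    then show "z k \<in> ?B \<times> ?B" by (auto simp: mem_Times_iff)
  qed (auto simp: lattice_ball_def)
  have fin: "finite ?A" by (intro finite_PiE) auto
  show "finite (lattice_ball n R)" by (rule finite_subset[OF sub fin])
  have "real (card (lattice_ball n R)) = (\<Sum>z\<in>lattice_ball n R. 1)" by simp
  also have "\<dots> \<le> (\<Sum>z\<in>lattice_ball n R. 2 ^ R * (\<Prod>k<n. ?w (z k)))"
  proof (rule sum_mono)
    fix z assume z: "z \<in> lattice_ball n R"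
    have "int (\<Sum>k<n. nat \<bar>fst (z k)\<bar> + nat \<bar>snd (z k)\<bar>) = (\<Sum>k<n. \<bar>fst (z k)\<bar> + \<bar>snd (z k)\<bar>)"
      by simp
    also have "\<dots> \<le> (\<Sum>k<n. (fst (z k))\<^sup>2 + (snd (z k))\<^sup>2)"
      by (intro sum_mono add_mono int_abs_le_square)
    also have "\<dots> \<le> int R" using z by (simp add: lattice_ball_def)
    finally have "(\<Sum>k<n. nat \<bar>fst (z k)\<bar> + nat \<bar>snd (z k)\<bar>) \<le> R"
      by (simp only: of_nat_le_iff)
    then have "(1 / 2 :: real) ^ R \<le> (1 / 2) ^ (\<Sum>k<n. nat \<bar>fst (z k)\<bar> + nat \<bar>snd (z k)\<bar>)"
      by (intro power_decreasing) auto
    also have "\<dots> = (\<Prod>k<n. ?w (z k))" by (rule power_sum)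
    finally have "2 ^ R * (1 / 2 :: real) ^ R \<le> 2 ^ R * (\<Prod>k<n. ?w (z k))"
      by (intro mult_left_mono) auto
    then show "1 \<le> 2 ^ R * (\<Prod>k<n. ?w (z k))" by (simp flip: power_mult_distrib)
  qed
  also have "\<dots> \<le> (\<Sum>z\<in>?A. 2 ^ R * (\<Prod>k<n. ?w (z k)))"
    by (rule sum_mono2[OF fin sub]) (simp add: prod_nonneg)
  \<comment> \<open>Over the full product set the sum of product weights factors; each index
    contributes the square of a geometric sum below 3.\<close>
  also have "\<dots> = 2 ^ R * (\<Prod>k<n. \<Sum>p\<in>?B \<times> ?B. ?w p)"
    unfolding sum_distrib_left[symmetric]
    by (subst prod_sum_PiE) (simp_all only: finite_lessThan finite_atLeastAtMost_int finite_cartesian_product)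
  also have "(\<Sum>p\<in>?B \<times> ?B. ?w p) = (\<Sum>z\<in>?B. (1 / 2 :: real) ^ nat \<bar>z\<bar>)\<^sup>2"
    by (simp add: power2_eq_square sum_product sum.cartesian_product power_add split_beta')
  also have "2 ^ R * (\<Prod>k<n. (\<Sum>z\<in>?B. (1 / 2 :: real) ^ nat \<bar>z\<bar>)\<^sup>2) \<le> 2 ^ R * (\<Prod>k<n. 3\<^sup>2)"
    unfolding sum_half_power_abs using power_le_one[of "1 / 2 :: real" R]
    by (intro mult_left_mono prod_mono conjI power_mono) simp_all
  finally show "real (card (lattice_ball n R)) \<le> 2 ^ R * 9 ^ n" by simp
qed

text \<open>Rounding towards zero never increases the absolute value, so rounding a unit vector does
  not leave the ball; rounding to the nearest integer could.\<close>

definition round_to_zero :: "real \<Rightarrow> int" where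
  "round_to_zero x = (if 0 \<le> x then \<lfloor>x\<rfloor> else \<lceil>x\<rceil>)"

lemma round_to_zero: "\<bar>real_of_int (round_to_zero x)\<bar> \<le> \<bar>x\<bar>" "\<bar>x - round_to_zero x\<bar> \<le> 1"
  unfolding round_to_zero_def by (auto split: if_splits; linarith)+

lemma norming_net_exists:
  assumes "0 < n"
  obtains U where "norming_net n U" "real (card U) \<le> (2 ^ 32 * 9) ^ n"
proof -
  \<comment> \<open>Each of the \<open>2 * n\<close> real coordinates is rounded with error at most
    \<open>d\<close>, and \<open>2 * n * d\<^sup>2 = 1 / 16\<close>. In units of \<open>d\<close>
    the unit ball has squared radius \<open>32 * n\<close>, which explains the base
    \<open>2 ^ 32 * 9\<close>.\<close>
  define d where "d = 1 / sqrt (32 * real n)"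
  have d: "0 < d" "d\<^sup>2 = 1 / (32 * real n)"
    using assms by (simp_all add: d_def power_divide)
  define g where "g z k = Complex (d * real_of_int (fst (z k))) (d * real_of_int (snd (z k)))"
    for z :: "nat \<Rightarrow> int \<times> int" and k
  let ?Z = "lattice_ball n (32 * n)"
  have sq: "sqnorm n (g z) = d\<^sup>2 * real_of_int (\<Sum>k<n. (fst (z k))\<^sup>2 + (snd (z k))\<^sup>2)" for z
    by (simp add: sqnorm_def g_def cmod_power2 power_mult_distrib sum_distrib_left distrib_left)
  have "norming_net n (g ` ?Z)"
  proof (rule norming_netI)
    show "finite (g ` ?Z)" by (intro finite_imageI lattice_ball_card)
    have "(\<lambda>k\<in>{..<n}. (0, 0)) \<in> ?Z" by (auto simp: lattice_ball_def)
    then show "g ` ?Z \<noteq> {}" by blast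
    show "sqnorm n u \<le> 1" if "u \<in> g ` ?Z" for u
    proof -
      obtain z where z: "z \<in> ?Z" "u = g z" using \<open>u \<in> g ` ?Z\<close> by blast
      have "real_of_int (\<Sum>k<n. (fst (z k))\<^sup>2 + (snd (z k))\<^sup>2) \<le> real_of_int (int (32 * n))"
        using z(1) unfolding lattice_ball_def by (intro of_int_le_iff[THEN iffD2]) blast
      then have "d\<^sup>2 * real_of_int (\<Sum>k<n. (fst (z k))\<^sup>2 + (snd (z k))\<^sup>2) \<le> d\<^sup>2 * (32 * real n)"
        by (intro mult_left_mono) simp_all
      then show ?thesis unfolding z(2) sq using d(2) assms by simp
    qed
    fix x assume x: "sqnorm n x = 1"
    define z where "z = (\<lambda>k\<in>{..<n}. (round_to_zero (Re (x k) / d), round_to_zero (Im (x k) / d)))"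
    have le: "(real_of_int (round_to_zero y))\<^sup>2 \<le> y\<^sup>2" for y
      by (rule abs_le_square_iff[THEN iffD1]) (rule round_to_zero)
    have "real_of_int (\<Sum>k<n. (fst (z k))\<^sup>2 + (snd (z k))\<^sup>2) \<le> (\<Sum>k<n. (Re (x k) / d)\<^sup>2 + (Im (x k) / d)\<^sup>2)"
      unfolding of_int_sum by (intro sum_mono) (simp add: z_def add_mono le)
    also have "\<dots> = sqnorm n x / d\<^sup>2"
      by (simp add: sqnorm_def cmod_power2 power_divide sum_divide_distrib add_divide_distrib)
    also have "\<dots> = real_of_int (int (32 * n))" using x d(2) by simp
    finally have "z \<in> ?Z"
      unfolding of_int_le_iff by (simp add: lattice_ball_def z_def)
    moreover have "sqnorm n (\<lambda>k. x k - g z k) \<le> 1 / 16"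
    proof -
      have e: "(y - d * real_of_int (round_to_zero (y / d)))\<^sup>2 \<le> d\<^sup>2" for y
      proof -
        have "y - d * real_of_int (round_to_zero (y / d)) = d * (y / d - real_of_int (round_to_zero (y / d)))"
          using d(1) by (simp add: right_diff_distrib)
        moreover have "(y / d - real_of_int (round_to_zero (y / d)))\<^sup>2 \<le> 1"
          unfolding abs_square_le_1 by (rule round_to_zero)
        ultimately show ?thesis by (simp add: power_mult_distrib mult_left_le)
      qed
      have "sqnorm n (\<lambda>k. x k - g z k) \<le> (\<Sum>k<n. d\<^sup>2 + d\<^sup>2)"
        unfolding sqnorm_def cmod_power2 by (intro sum_mono add_mono) (simp_all add: g_def z_def e)
      also have "\<dots> = 1 / 16" using assms by (simp add: d(2))
      finally show ?thesis .
    qed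
    ultimately show "\<exists>u\<in>g ` ?Z. sqnorm n (\<lambda>k. x k - u k) \<le> 1 / 16" by blast
  qed
  moreover have "real (card (g ` ?Z)) \<le> real (card ?Z)"
    by (simp add: card_image_le lattice_ball_card)
  then have "real (card (g ` ?Z)) \<le> (2 ^ 32 * 9) ^ n"
    using lattice_ball_card(2)[of n "32 * n"] unfolding power_mult power_mult_distrib by linarith
  ultimately show thesis by (rule that)
qed

subsection \<open>The spectral theorem\<close>

definition dot :: "nat \<Rightarrow> (nat \<Rightarrow> complex) \<Rightarrow> (nat \<Rightarrow> complex) \<Rightarrow> complex" where
  "dot n x y = (\<Sum>a<n. cnj (x a) * y a)"

lemma cnj_dot [simp]: "cnj (dot n x y) = dot n y x"
  by (simp add: dot_def mult.commute)

lemma dot_self: "dot n x x = of_real (sqnorm n x)"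
  by (simp add: dot_def sqnorm_def complex_norm_square mult.commute del: of_real_power)

lemma dot_cong: "(\<And>a. a < n \<Longrightarrow> x a = x' a) \<Longrightarrow> (\<And>a. a < n \<Longrightarrow> y a = y' a) \<Longrightarrow> dot n x y = dot n x' y'"
  by (simp add: dot_def)

lemma dot_scale_right: "dot n x (\<lambda>a. c * y a) = c * dot n x y"
  by (simp add: dot_def sum_distrib_left mult_ac)

lemma dot_scale_left: "dot n (\<lambda>a. c * x a) y = cnj c * dot n x y"
  by (simp add: dot_def sum_distrib_left mult_ac)

lemma dot_add_right: "dot n x (\<lambda>a. y a + z a) = dot n x y + dot n x z"
  by (simp add: dot_def distrib_left sum.distrib)

lemma dot_sum_right: "dot n x (\<lambda>a. \<Sum>i\<in>I. y i a) = (\<Sum>i\<in>I. dot n x (y i))"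
  unfolding dot_def sum_distrib_left by (rule sum.swap)

lemma quad_eq_dot: "quad n H x = Re (dot n x (\<lambda>a. lin n (H a) x))"
  by (simp add: quad_def dot_def lin_def sum_distrib_left mult_ac)

lemma dot_herm:
  assumes "herm n H"
  shows "dot n x (\<lambda>a. lin n (H a) y) = dot n (\<lambda>a. lin n (H a) x) y"
proof -
  have "dot n (\<lambda>a. lin n (H a) x) y = (\<Sum>a<n. \<Sum>b<n. cnj (H a b) * cnj (x b) * y a)"
    by (simp add: dot_def lin_def sum_distrib_right)
  also have "\<dots> = (\<Sum>a<n. \<Sum>b<n. H b a * cnj (x b) * y a)"
    using assms by (intro sum.cong) (auto simp: hermD)
  also have "\<dots> = (\<Sum>b<n. \<Sum>a<n. H b a * cnj (x b) * y a)"
    by (rule sum.swap)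
  also have "\<dots> = dot n x (\<lambda>a. lin n (H a) y)"
    by (simp add: dot_def lin_def sum_distrib_left mult_ac)
  finally show ?thesis ..
qed

definition orthonormal :: "nat \<Rightarrow> 'i set \<Rightarrow> ('i \<Rightarrow> nat \<Rightarrow> complex) \<Rightarrow> bool" where
  "orthonormal n I e \<longleftrightarrow> finite I \<and> (\<forall>i\<in>I. \<forall>j\<in>I. dot n (e i) (e j) = (if i = j then 1 else 0))"

lemma orthonormalD:
  "orthonormal n I e \<Longrightarrow> i \<in> I \<Longrightarrow> j \<in> I \<Longrightarrow> dot n (e i) (e j) = (if i = j then 1 else 0)"
  by (simp add: orthonormal_def)

lemma orthonormal_finite: "orthonormal n I e \<Longrightarrow> finite I"
  by (simp add: orthonormal_def)

lemma sqnorm_minus_projection: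
  assumes e: "orthonormal n I e"
  shows "sqnorm n (\<lambda>a. x a - (\<Sum>i\<in>I. dot n (e i) x * e i a)) = sqnorm n x - (\<Sum>i\<in>I. (cmod (dot n (e i) x))\<^sup>2)"
proof -
  define y where "y a = (\<Sum>i\<in>I. dot n (e i) x * e i a)" for a
  have ey: "dot n (e j) y = dot n (e j) x" if "j \<in> I" for j
  proof -
    have "dot n (e j) y = (\<Sum>i\<in>I. dot n (e i) x * dot n (e j) (e i))"
      unfolding y_def dot_sum_right dot_scale_right ..
    also have "\<dots> = (\<Sum>i\<in>I. if i = j then dot n (e i) x else 0)"
      using that by (intro sum.cong) (auto simp: orthonormalD[OF e])
    finally show ?thesis using that orthonormal_finite[OF e] by simp
  qed
  have yz: "dot n z y = (\<Sum>i\<in>I. dot n (e i) x * dot n z (e i))" for z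
    unfolding y_def dot_sum_right dot_scale_right ..
  have "dot n x y = (\<Sum>i\<in>I. of_real ((cmod (dot n (e i) x))\<^sup>2))"
    unfolding yz by (intro sum.cong refl) (metis cnj_dot complex_norm_square)
  moreover have "dot n y y = dot n x y"
  proof -
    have "dot n y (e i) = dot n x (e i)" if "i \<in> I" for i
      using ey[OF that] by (metis cnj_dot)
    then show ?thesis unfolding yz[of y] yz[of x] by simp
  qed
  moreover have "dot n y x = dot n x y"
    using \<open>dot n y y = dot n x y\<close> by (metis cnj_dot)
  moreover have "dot n (\<lambda>a. x a - y a) (\<lambda>a. x a - y a) = dot n x x - dot n x y - dot n y x + dot n y y"
    by (simp add: dot_def left_diff_distrib right_diff_distrib sum_subtractf)
  ultimately have "complex_of_real (sqnorm n (\<lambda>a. x a - y a)) = of_real (sqnorm n x - (\<Sum>i\<in>I. (cmod (dot n (e i) x))\<^sup>2))"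
    by (simp add: dot_self)
  then show ?thesis unfolding of_real_eq_iff y_def .
qed

lemma bessel:
  assumes "orthonormal n I e"
  shows "(\<Sum>i\<in>I. (cmod (dot n (e i) x))\<^sup>2) \<le> sqnorm n x"
  using sqnorm_minus_projection[OF assms, of x] sqnorm_nonneg[of n "\<lambda>a. x a - (\<Sum>i\<in>I. dot n (e i) x * e i a)"]
  by linarith

section \<open>Orthonormal eigenbases of Hermitian matrices\<close>

lemma mat_trace_comm:
  assumes "A \<in> carrier_mat n n" "B \<in> carrier_mat n n"
  shows "mat_trace (A * B) = mat_trace (B * A)"
proof -
  have "mat_trace (A * B) = (\<Sum>i<n. \<Sum>j<n. A $$ (i, j) * B $$ (j, i))"
    using assms by (auto simp: mat_trace_def scalar_prod_def atLeast0LessThan intro!: sum.cong)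
  also have "\<dots> = (\<Sum>j<n. \<Sum>i<n. A $$ (i, j) * B $$ (j, i))" by (rule sum.swap)
  also have "\<dots> = mat_trace (B * A)"
    using assms by (auto simp: mat_trace_def scalar_prod_def atLeast0LessThan mult.commute intro!: sum.cong)
  finally show ?thesis .
qed

lemma mult_mat_vec_lin: "i < n \<Longrightarrow> v \<in> carrier_vec n \<Longrightarrow> (mat n n (\<lambda>(i, j). H i j) *\<^sub>v v) $ i = lin n (H i) (\<lambda>j. v $ j)"
  by (auto simp: scalar_prod_def lin_def atLeast0LessThan intro!: sum.cong)

text \<open>If \<open>c\<close> were the only eigenvalue, the trace, being the sum of the eigenvalues, would be \<open>n c\<close>.\<close>

lemma eigenvalue_not_mean:
  assumes "(\<Sum>a<n. H a a) \<noteq> of_nat n * c"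
  obtains z w where "z \<noteq> c" "sqnorm n w \<noteq> 0" "\<And>a. a < n \<Longrightarrow> lin n (H a) w = z * w a"
proof -
  define A where "A = mat n n (\<lambda>(i, j). H i j)"
  have A: "A \<in> carrier_mat n n" by (simp add: A_def)
  obtain es where es: "char_poly A = (\<Prod>a\<leftarrow>es. [:- a, 1:])"
    using char_poly_factorized[OF A] by blast
  \<comment> \<open>The Schur form has the eigenvalues on its diagonal, and similarity preserves the
    trace, so some diagonal entry differs from \<open>c\<close>.\<close>
  obtain B where B: "B \<in> carrier_mat n n" "upper_triangular B" "similar_mat A B"
    using schur_decomposition_exists[OF A es] by blast
  obtain P Q where "similar_mat_wit A B P Q"
    using B(3) unfolding similar_mat_def by blast
  from similar_mat_witD2[OF A this]
  have PQ: "P \<in> carrier_mat n n" "Q \<in> carrier_mat n n" "Q * P = 1\<^sub>m n" "A = P * B * Q"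
    by simp_all
  have "mat_trace A = mat_trace (P * (B * Q))"
    unfolding PQ(4) assoc_mult_mat[OF PQ(1) B(1) PQ(2)] ..
  also have "\<dots> = mat_trace ((B * Q) * P)"
    by (rule mat_trace_comm[OF PQ(1) mult_carrier_mat[OF B(1) PQ(2)]])
  also have "(B * Q) * P = B"
    unfolding assoc_mult_mat[OF B(1) PQ(2,1)] PQ(3) by (rule right_mult_one_mat[OF B(1)])
  finally have "(\<Sum>a<n. H a a) = (\<Sum>a<n. B $$ (a, a))"
    using B(1) by (simp add: mat_trace_def A_def)
  then have "(\<Sum>a<n. B $$ (a, a)) \<noteq> (\<Sum>a<n. c)" using assms by simp
  then obtain a where a: "a < n" "B $$ (a, a) \<noteq> c"
    by (meson lessThan_iff sum.cong)
  have "char_poly A = (\<Prod>b\<leftarrow>diag_mat B. [:- b, 1:])"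
    using char_poly_similar[OF B(3)] char_poly_upper_triangular[OF B(1,2)] by simp
  moreover have "B $$ (a, a) \<in> set (diag_mat B)"
    using a(1) B(1) by (auto simp: diag_mat_def)
  ultimately have "poly (char_poly A) (B $$ (a, a)) = 0"
    by (simp add: poly_prod_list image_image)
  then have "eigenvalue A (B $$ (a, a))"
    using eigenvalue_root_char_poly[OF A] by blast
  then obtain v where v: "v \<in> carrier_vec n" "v \<noteq> 0\<^sub>v n" "A *\<^sub>v v = B $$ (a, a) \<cdot>\<^sub>v v"
    using A unfolding eigenvalue_def eigenvector_def by auto
  show thesis
  proof (rule that[of "B $$ (a, a)" "\<lambda>j. v $ j"])
    show "sqnorm n (\<lambda>j. v $ j) \<noteq> 0"
    proof
      assume "sqnorm n (\<lambda>j. v $ j) = 0"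
      then have "v = 0\<^sub>v n"
        using v(1) by (intro eq_vecI) (auto simp: sqnorm_def sum_nonneg_eq_0_iff)
      then show False using v(2) by simp
    qed
    fix i assume i: "i < n"
    have "lin n (H i) (\<lambda>j. v $ j) = (A *\<^sub>v v) $ i"
      unfolding A_def by (rule mult_mat_vec_lin[OF i v(1), symmetric])
    also have "\<dots> = B $$ (a, a) * v $ i"
      unfolding v(3) using v(1) i by simp
    finally show "lin n (H i) (\<lambda>j. v $ j) = B $$ (a, a) * v $ i" .
  qed (rule a(2))
qed

text \<open>Deflation: shifting the known eigenvalues to \<open>t\<close>, with \<open>t\<close> different from the mean of all eigenvalues,
  leaves an eigenvalue other than \<open>t\<close>, whose eigenvectors are orthogonal to the known ones.\<close>

lemma orthonormal_eigenvectors: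
  assumes H: "herm n H" and "k \<le> n"
  shows "\<exists>u l. orthonormal n {..<k} u \<and> (\<forall>i<k. \<forall>a<n. lin n (H a) (u i) = complex_of_real (l i) * u i a)"
  using assms(2)
proof (induction k)
  case 0
  show ?case by (simp add: orthonormal_def)
next
  case (Suc k)
  then obtain u l where u: "orthonormal n {..<k} u"
    and l: "\<And>i a. i < k \<Longrightarrow> a < n \<Longrightarrow> lin n (H a) (u i) = complex_of_real (l i) * u i a"
    by force
  define d where "d = (\<Sum>a<n. H a a) - (\<Sum>i<k. of_real (l i))"
  \<comment> \<open>The condition is \<open>d + k * t \<noteq> n * t\<close>. If
    \<open>d \<noteq> 0\<close> then 0 satisfies it; if \<open>d = 0\<close> then 1 does, because
    \<open>k < n\<close>.\<close>
  define t :: real where "t = (if d = 0 then 1 else 0)"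
  define G where "G a b = H a b - (\<Sum>i<k. of_real (l i - t) * u i a * cnj (u i b))" for a b
  have uu: "(\<Sum>a<n. u i a * cnj (u i a)) = 1" if "i < k" for i
    using orthonormalD[OF u, of i i] that by (simp add: dot_def mult.commute)
  have "(\<Sum>a<n. G a a) = (\<Sum>a<n. H a a) - (\<Sum>i<k. of_real (l i - t) * (\<Sum>a<n. u i a * cnj (u i a)))"
    unfolding G_def sum_subtractf sum_distrib_left by (subst (2) sum.swap) (simp add: mult_ac)
  also have "\<dots> = d + of_nat k * of_real t"
    by (simp add: uu d_def sum_subtractf)
  finally have tr: "(\<Sum>a<n. G a a) = d + of_nat k * of_real t" .
  have "(\<Sum>a<n. G a a) \<noteq> of_nat n * of_real t"
    unfolding tr using Suc.prems by (auto simp: t_def)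
  then obtain z w where z: "z \<noteq> of_real t" "sqnorm n w \<noteq> 0" "\<And>a. a < n \<Longrightarrow> lin n (G a) w = z * w a"
    by (rule eigenvalue_not_mean[where H = G]) blast
  have linG: "lin n (G a) x = lin n (H a) x - (\<Sum>i<k. of_real (l i - t) * u i a * dot n (u i) x)" for a x
  proof -
    have "lin n (G a) x = lin n (H a) x - (\<Sum>b<n. \<Sum>i<k. of_real (l i - t) * u i a * cnj (u i b) * x b)"
      by (simp add: lin_def G_def left_diff_distrib sum_subtractf sum_distrib_right)
    also have "(\<Sum>b<n. \<Sum>i<k. of_real (l i - t) * u i a * cnj (u i b) * x b)
      = (\<Sum>i<k. of_real (l i - t) * u i a * dot n (u i) x)"
      unfolding dot_def sum_distrib_left by (subst sum.swap) (simp add: mult_ac)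
    finally show ?thesis .
  qed
  have "herm n G"
    using H by (auto simp: herm_def G_def mult_ac)
  have Gu: "lin n (G a) (u j) = of_real t * u j a" if "j < k" "a < n" for j a
  proof -
    have "(\<Sum>i<k. of_real (l i - t) * u i a * dot n (u i) (u j)) = (\<Sum>i<k. if i = j then of_real (l i - t) * u i a else 0)"
      using that by (intro sum.cong) (auto simp: orthonormalD[OF u])
    then show ?thesis
      unfolding linG using that by (simp add: l left_diff_distrib)
  qed
  have orth: "dot n (u j) w = 0" if "j < k" for j
  proof -
    have "z * dot n (u j) w = dot n (u j) (\<lambda>a. lin n (G a) w)"
      unfolding dot_scale_right[symmetric] by (rule dot_cong) (simp_all add: z(3))
    also have "\<dots> = dot n (\<lambda>a. lin n (G a) (u j)) w"
      by (rule dot_herm) fact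
    also have "\<dots> = dot n (\<lambda>a. of_real t * u j a) w"
      using that by (intro dot_cong) (simp_all add: Gu)
    also have "\<dots> = of_real t * dot n (u j) w" by (simp add: dot_scale_left)
    finally show ?thesis using z(1) by simp
  qed
  \<comment> \<open>The correction in \<open>G\<close> sees only components along the known
    eigenvectors, so \<open>w\<close> is an eigenvector of \<open>H\<close> as well; its eigenvalue
    \<open>z\<close> is then real because \<open>H\<close> is Hermitian.\<close>
  have Hw: "lin n (H a) w = z * w a" if "a < n" for a
    using z(3)[OF that] unfolding linG by (simp add: orth)
  have "z * of_real (sqnorm n w) = dot n w (\<lambda>a. lin n (H a) w)"
    unfolding dot_self[symmetric] dot_scale_right[symmetric] by (rule dot_cong) (simp_all add: Hw)
  also have "\<dots> = dot n (\<lambda>a. lin n (H a) w) w" by (rule dot_herm[OF H])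
  also have "\<dots> = dot n (\<lambda>a. z * w a) w" by (rule dot_cong) (simp_all add: Hw)
  also have "\<dots> = cnj z * of_real (sqnorm n w)" by (simp add: dot_scale_left dot_self)
  finally have "z = cnj z" using z(2) by simp
  then have zr: "z = of_real (Re z)" by (simp add: complex_eq_iff)
  define c where "c = complex_of_real (1 / sqrt (sqnorm n w))"
  have "0 < sqnorm n w" using z(2) sqnorm_nonneg[of n w] by linarith
  then have "cnj c * c * of_real (sqnorm n w) = 1"
    unfolding c_def complex_cnj_complex_of_real of_real_mult[symmetric] by simp
  then have ww: "dot n (\<lambda>a. c * w a) (\<lambda>a. c * w a) = 1"
    by (simp add: dot_scale_left dot_scale_right dot_self mult_ac)
  have ow: "dot n (u j) (\<lambda>a. c * w a) = 0" "dot n (\<lambda>a. c * w a) (u j) = 0" if "j < k" for j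
  proof -
    show 1: "dot n (u j) (\<lambda>a. c * w a) = 0" using orth[OF that] by (simp add: dot_scale_right)
    show "dot n (\<lambda>a. c * w a) (u j) = 0"
      using cnj_dot[of n "u j" "\<lambda>a. c * w a"] unfolding 1 by simp
  qed
  let ?u = "u(k := \<lambda>a. c * w a)" and ?l = "l(k := Re z)"
  have "orthonormal n {..<Suc k} ?u"
    using u ww ow by (auto simp: orthonormal_def less_Suc_eq)
  moreover have "lin n (H a) (\<lambda>a. c * w a) = of_real (Re z) * (c * w a)" if "a < n" for a
  proof -
    have "lin n (H a) (\<lambda>a. c * w a) = c * lin n (H a) w"
      by (simp add: lin_def sum_distrib_left mult_ac)
    then show ?thesis using Hw[OF that] zr by (simp add: mult_ac)
  qed
  then have "\<forall>i<Suc k. \<forall>a<n. lin n (H a) (?u i) = complex_of_real (?l i) * ?u i a"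
    using l by (auto simp: less_Suc_eq)
  ultimately show ?case by blast
qed

definition eigenbasis :: "nat \<Rightarrow> (nat \<Rightarrow> nat \<Rightarrow> complex) \<Rightarrow> (nat \<Rightarrow> nat \<Rightarrow> complex) \<Rightarrow> (nat \<Rightarrow> real) \<Rightarrow> bool" where
  "eigenbasis n H u l \<longleftrightarrow> orthonormal n {..<n} u \<and>
     (\<forall>a<n. \<forall>b<n. (\<Sum>i<n. u i a * cnj (u i b)) = (if a = b then 1 else 0)) \<and>
     (\<forall>i<n. \<forall>a<n. lin n (H a) (u i) = complex_of_real (l i) * u i a)"

text \<open>Orthonormality says that \<open>W\<close> is a left inverse of the square matrix
  \<open>V\<close>. It is then a right inverse too, which is the completeness relation.\<close>

lemma eigenbasis_exists:
  assumes "herm n H"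
  obtains u l where "eigenbasis n H u l"
proof -
  obtain u l where u: "orthonormal n {..<n} u"
    and l: "\<forall>i<n. \<forall>a<n. lin n (H a) (u i) = complex_of_real (l i) * u i a"
    using orthonormal_eigenvectors[OF assms order.refl] by blast
  define V where "V = mat n n (\<lambda>(a, i). u i a)"
  define W where "W = mat n n (\<lambda>(i, a). cnj (u i a))"
  have "W * V = 1\<^sub>m n"
    using orthonormalD[OF u]
    by (intro eq_matI) (auto simp: W_def V_def scalar_prod_def dot_def atLeast0LessThan)
  then have VW: "V * W = 1\<^sub>m n"
    by (intro mat_mult_left_right_inverse[of W n V]) (auto simp: V_def W_def)
  have "(\<Sum>i<n. u i a * cnj (u i b)) = (if a = b then 1 else 0)" if "a < n" "b < n" for a b
  proof -
    have "(\<Sum>i<n. u i a * cnj (u i b)) = (V * W) $$ (a, b)"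
      using that by (auto simp: W_def V_def scalar_prod_def atLeast0LessThan)
    then show ?thesis unfolding VW using that by simp
  qed
  then show thesis using that[of u l] u l unfolding eigenbasis_def by blast
qed

subsection \<open>The descent cone of the nuclear norm\<close>

lemma lin_sum_right: "lin n c (\<lambda>b. \<Sum>i\<in>I. y i b) = (\<Sum>i\<in>I. lin n c (y i))"
  unfolding lin_def sum_distrib_left by (rule sum.swap)

lemma lin_scale_right: "lin n c (\<lambda>b. z * y b) = z * lin n c y"
  by (simp add: lin_def sum_distrib_left mult_ac)

lemma eigenbasis_expand:
  assumes e: "eigenbasis n H u l" and "a < n" "b < n"
  shows "H a b = (\<Sum>i<n. of_real (l i) * u i a * cnj (u i b))"
proof -
  have "(\<Sum>i<n. of_real (l i) * u i a * cnj (u i b)) = (\<Sum>i<n. cnj (u i b) * lin n (H a) (u i))"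
    using e \<open>a < n\<close> by (intro sum.cong) (auto simp: eigenbasis_def)
  also have "\<dots> = lin n (H a) (\<lambda>c. \<Sum>i<n. cnj (u i b) * u i c)"
    unfolding lin_sum_right lin_scale_right ..
  also have "\<dots> = (\<Sum>c<n. if c = b then H a c else 0)"
    unfolding lin_def using e \<open>b < n\<close>
    by (intro sum.cong) (auto simp: eigenbasis_def mult.commute)
  also have "\<dots> = H a b" using \<open>b < n\<close> by simp
  finally show ?thesis ..
qed

lemma tr_cong: "(\<And>a b. a < n \<Longrightarrow> b < n \<Longrightarrow> H a b = H' a b) \<Longrightarrow> tr n M H = tr n M H'"
  by (simp add: tr_def)

lemma tr_commute: "tr n M H = tr n H M"
proof -
  have "(\<Sum>i<n. \<Sum>j<n. M i j * H j i) = (\<Sum>j<n. \<Sum>i<n. M i j * H j i)" by (rule sum.swap)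
  then show ?thesis by (simp add: tr_def mult.commute)
qed

lemma tr_add: "tr n M (\<lambda>a b. G a b + H a b) = tr n M G + tr n M H"
  by (simp add: tr_def distrib_left sum.distrib)

lemma tr_sum_outer:
  "tr n M (\<lambda>a b. \<Sum>i\<in>I. x i a * cnj (y i b)) = (\<Sum>i\<in>I. Re (dot n (y i) (\<lambda>a. lin n (M a) (x i))))"
proof -
  have "(\<Sum>a<n. \<Sum>b<n. M a b * (\<Sum>i\<in>I. x i b * cnj (y i a)))
    = (\<Sum>a<n. \<Sum>i\<in>I. \<Sum>b<n. M a b * (x i b * cnj (y i a)))"
    unfolding sum_distrib_left by (intro sum.cong refl sum.swap)
  also have "\<dots> = (\<Sum>i\<in>I. \<Sum>a<n. \<Sum>b<n. M a b * (x i b * cnj (y i a)))"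
    by (rule sum.swap)
  also have "\<dots> = (\<Sum>i\<in>I. dot n (y i) (\<lambda>a. lin n (M a) (x i)))"
    by (simp add: dot_def lin_def sum_distrib_left mult_ac)
  finally show ?thesis by (simp add: tr_def)
qed

lemma tr_sum_self_outer:
  "tr n M (\<lambda>a b. \<Sum>i\<in>I. of_real (c i) * u i a * cnj (u i b)) = (\<Sum>i\<in>I. c i * quad n M (u i))"
proof -
  have "dot n (u i) (\<lambda>a. lin n (M a) (\<lambda>b. of_real (c i) * u i b))
    = of_real (c i) * dot n (u i) (\<lambda>a. lin n (M a) (u i))" for i
    unfolding lin_scale_right dot_scale_right ..
  then show ?thesis by (simp add: tr_sum_outer quad_eq_dot)
qed

lemma tr_eigenbasis:
  assumes "eigenbasis n H u l"
  shows "tr n M H = (\<Sum>i<n. l i * quad n M (u i))"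
proof -
  have "tr n M H = tr n M (\<lambda>a b. \<Sum>i<n. of_real (l i) * u i a * cnj (u i b))"
    by (rule tr_cong) (rule eigenbasis_expand[OF assms])
  then show ?thesis unfolding tr_sum_self_outer .
qed

section \<open>The nuclear norm of a Hermitian matrix\<close>

lemma proots_linear_factors: "proots (\<Prod>a\<leftarrow>as. [:- a, 1:]) = mset (as :: 'a :: idom list)"
proof (induction as)
  case (Cons a as)
  have "(\<Prod>a\<leftarrow>as. [:- a, 1:]) \<noteq> 0" by (auto simp: prod_list_zero_iff)
  then have "proots ([:- a, 1:] * (\<Prod>a\<leftarrow>as. [:- a, 1:])) = proots [:- a, 1:] + mset as"
    unfolding Cons.IH[symmetric] by (intro proots_mult) simp_all
  then show ?case by (simp del: mult_pCons_left)
qed simp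

text \<open>For Hermitian \<open>Z\<close> the singular values come from the characteristic
  polynomial of \<open>Z * Z\<close>, which is similar to the diagonal matrix of the
  \<open>(l i)\<^sup>2\<close>; their square roots are the absolute values.\<close>

lemma nuclear_norm_eigenbasis:
  assumes Z: "Z \<in> hermitian_mats n" and e: "eigenbasis n (\<lambda>i j. Z $$ (i, j)) u l"
  shows "nuclear_norm Z = (\<Sum>i<n. \<bar>l i\<bar>)"
proof -
  have Zc: "Z \<in> carrier_mat n n" and adj: "mat_adjoint Z = Z"
    using Z by (auto simp: hermitian_mats_def)
  define V where "V = mat n n (\<lambda>(a, i). u i a)"
  define W where "W = mat n n (\<lambda>(i, a). cnj (u i a))"
  define D where "D = mat n n (\<lambda>(i, j). if i = j then complex_of_real ((l i)\<^sup>2) else 0)"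
  have car: "V \<in> carrier_mat n n" "W \<in> carrier_mat n n" "D \<in> carrier_mat n n"
    by (auto simp: V_def W_def D_def)
  have "V * W = 1\<^sub>m n"
    using e by (intro eq_matI) (auto simp: W_def V_def scalar_prod_def atLeast0LessThan eigenbasis_def)
  moreover have "W * V = 1\<^sub>m n"
    using e by (intro eq_matI) (auto simp: W_def V_def scalar_prod_def atLeast0LessThan eigenbasis_def orthonormal_def dot_def)
  moreover have "Z * Z = V * D * W"
  proof (rule eq_matI)
    fix a b assume "a < dim_row (V * D * W)" "b < dim_col (V * D * W)"
    then have ab: "a < n" "b < n" using car by auto
    have VD: "(V * D) $$ (a, i) = u i a * of_real ((l i)\<^sup>2)" if "i < n" for i
    proof -
      have "(V * D) $$ (a, i) = (\<Sum>j<n. u j a * (if j = i then of_real ((l j)\<^sup>2) else 0))"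
        using that ab by (simp add: V_def D_def scalar_prod_def atLeast0LessThan)
      also have "\<dots> = (\<Sum>j<n. if j = i then u i a * of_real ((l i)\<^sup>2) else 0)"
        by (intro sum.cong) auto
      finally have "(V * D) $$ (a, i) = (\<Sum>j<n. if j = i then u i a * of_real ((l i)\<^sup>2) else 0)" .
      then show ?thesis using that by simp
    qed
    have "(Z * Z) $$ (a, b) = lin n (\<lambda>c. Z $$ (a, c)) (\<lambda>c. Z $$ (c, b))"
      using ab Zc by (auto simp: lin_def scalar_prod_def atLeast0LessThan)
    also have "\<dots> = lin n (\<lambda>c. Z $$ (a, c)) (\<lambda>c. \<Sum>i<n. (of_real (l i) * cnj (u i b)) * u i c)"
      unfolding lin_def by (intro sum.cong refl) (simp add: eigenbasis_expand[OF e _ ab(2)] mult_ac)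
    also have "\<dots> = (\<Sum>i<n. (of_real (l i) * cnj (u i b)) * lin n (\<lambda>c. Z $$ (a, c)) (u i))"
      unfolding lin_sum_right lin_scale_right ..
    also have "\<dots> = (\<Sum>i<n. u i a * of_real ((l i)\<^sup>2) * cnj (u i b))"
      using e ab(1) by (intro sum.cong) (auto simp: eigenbasis_def power2_eq_square)
    also have "\<dots> = (V * D * W) $$ (a, b)"
      using car ab VD by (auto simp: W_def scalar_prod_def atLeast0LessThan intro!: sum.cong)
    finally show "(Z * Z) $$ (a, b) = (V * D * W) $$ (a, b)" .
  qed (use car Zc in auto)
  ultimately have "similar_mat_wit (Z * Z) D V W"
    using car Zc by (auto simp: similar_mat_wit_def Let_def)
  then have "char_poly (Z * Z) = char_poly D"
    by (intro char_poly_similar) (auto simp: similar_mat_def)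
  also have "\<dots> = (\<Prod>a\<leftarrow>diag_mat D. [:- a, 1:])"
    by (rule char_poly_upper_triangular[OF car(3)]) (auto simp: D_def upper_triangular_def)
  finally have "singular_values Z = image_mset (\<lambda>z. sqrt (Re z)) (mset (diag_mat D))"
    unfolding singular_values_def adj by (simp add: proots_linear_factors)
  also have "\<dots> = image_mset (\<lambda>i. \<bar>l i\<bar>) (mset [0..<n])"
  proof -
    have "map (\<lambda>z. sqrt (Re z)) (diag_mat D) = map (\<lambda>i. \<bar>l i\<bar>) [0..<n]"
      unfolding diag_mat_def map_map by (intro map_cong) (auto simp: D_def)
    then show ?thesis by (simp only: mset_map[symmetric])
  qed
  finally show ?thesis
    by (simp add: nuclear_norm_def sum_unfold_sum_mset atLeast0LessThan flip: mset_set_upto_eq_mset_upto)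
qed

lemma lin_zero: "sqnorm n x = 0 \<Longrightarrow> lin n c x = 0"
  by (auto simp: sqnorm_def lin_def sum_nonneg_eq_0_iff)

text \<open>Take \<open>t\<^sup>2\<close> in \<open>form_bound_polarized\<close> to be the ratio of
  the norms of \<open>v\<close> and \<open>u\<close>; vectors of norm 0 are treated apart.\<close>

lemma form_bound_dot:
  assumes M: "herm n M" and S: "form_bound n M S"
  shows "\<bar>Re (dot n v (\<lambda>a. lin n (M a) u))\<bar> \<le> S * (sqrt (sqnorm n u) * sqrt (sqnorm n v))"
proof (cases "sqnorm n u = 0 \<or> sqnorm n v = 0")
  case True
  then have "dot n v (\<lambda>a. lin n (M a) u) = 0"
  proof
    assume "sqnorm n u = 0"
    then show ?thesis by (simp add: dot_def lin_zero)
  next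
    assume "sqnorm n v = 0"
    then have "dot n (\<lambda>a. lin n (M a) u) v = 0"
      using lin_zero[of n v "\<lambda>a. cnj (lin n (M a) u)"] by (simp add: dot_def lin_def)
    then show ?thesis by (metis cnj_dot complex_cnj_zero)
  qed
  then show ?thesis using S by (simp add: form_bound_def)
next
  case False
  define x y where "x = sqrt (sqnorm n u)" and "y = sqrt (sqnorm n v)"
  have xy: "0 < x" "0 < y" "sqnorm n u = x\<^sup>2" "sqnorm n v = y\<^sup>2"
    using False by (auto simp: x_def y_def order.not_eq_order_implies_strict)
  have t2: "(sqrt (y / x))\<^sup>2 = y / x" using xy by simp
  have "4 * \<bar>Re (\<Sum>i<n. cnj (v i) * lin n (M i) u)\<bar> \<le> 2 * S * (y / x * x\<^sup>2 + y\<^sup>2 / (y / x))"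
    using form_bound_polarized[OF M S, of "sqrt (y / x)" v u] xy unfolding t2 by simp
  also have "y / x * x\<^sup>2 + y\<^sup>2 / (y / x) = 2 * (x * y)"
    using xy by (simp add: power2_eq_square field_simps)
  finally show ?thesis unfolding dot_def x_def[symmetric] y_def[symmetric] by simp
qed

text \<open>Cauchy-Schwarz. Applied to a basis of the range of \<open>X\<close>, it is where the
  rank enters as \<open>sqrt r\<close>.\<close>

lemma sum_sqrt_le:
  assumes "\<And>i. i \<in> I \<Longrightarrow> 0 \<le> f i" "(\<Sum>i\<in>I. f i) \<le> F" "card I \<le> r"
  shows "(\<Sum>i\<in>I. sqrt (f i)) \<le> sqrt r * sqrt F"
proof -
  have "(\<Sum>i\<in>I. sqrt (f i))\<^sup>2 \<le> (\<Sum>i\<in>I. (sqrt (f i))\<^sup>2) * card I"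
    by (rule sum_squared_le_sum_of_squares)
  also have "(\<Sum>i\<in>I. (sqrt (f i))\<^sup>2) = (\<Sum>i\<in>I. f i)"
    using assms(1) by (intro sum.cong) auto
  also have "(\<Sum>i\<in>I. f i) * card I \<le> F * r"
    using assms sum_nonneg[of I f] by (intro mult_mono) auto
  finally show ?thesis by (simp add: real_le_rsqrt mult.commute flip: real_sqrt_mult)
qed

text \<open>Bessel's inequality for each conjugated row of \<open>H\<close>.\<close>

lemma sum_sqnorm_image_le:
  assumes q: "orthonormal n I q"
  shows "(\<Sum>i\<in>I. sqnorm n (\<lambda>a. lin n (H a) (q i))) \<le> (\<Sum>a<n. sqnorm n (H a))"
proof -
  have "cmod (lin n (H a) (q i)) = cmod (dot n (q i) (\<lambda>b. cnj (H a b)))" for a i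
  proof -
    have "lin n (H a) (q i) = cnj (dot n (q i) (\<lambda>b. cnj (H a b)))"
      unfolding cnj_dot by (simp add: dot_def lin_def)
    then show ?thesis by (simp only: complex_mod_cnj)
  qed
  then have "(\<Sum>i\<in>I. sqnorm n (\<lambda>a. lin n (H a) (q i))) = (\<Sum>i\<in>I. \<Sum>a<n. (cmod (dot n (q i) (\<lambda>b. cnj (H a b))))\<^sup>2)"
    by (simp only: sqnorm_def)
  also have "\<dots> = (\<Sum>a<n. \<Sum>i\<in>I. (cmod (dot n (q i) (\<lambda>b. cnj (H a b))))\<^sup>2)"
    by (rule sum.swap)
  also have "\<dots> \<le> (\<Sum>a<n. sqnorm n (\<lambda>b. cnj (H a b)))"
    by (intro sum_mono bessel[OF q])
  finally show ?thesis by simp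
qed

text \<open>With \<open>Q\<close> the projection on the range of \<open>A\<close>, \<open>K = (1 - Q) H (1 - Q)\<close> and \<open>W = Q + sgn K\<close>, the norm of \<open>W\<close> is at most 1,
  so the trace of \<open>W (A + H)\<close> bounds the nuclear norm of \<open>A + H\<close> from below; this controls the nuclear norm of \<open>K\<close>.\<close>

lemma descent_cone_effective_rank:
  assumes A: "eigenbasis n A q l" "\<And>i. i < n \<Longrightarrow> 0 \<le> l i" "card {i. i < n \<and> l i \<noteq> 0} \<le> r"
    and H: "herm n H"
    and Y: "eigenbasis n (\<lambda>a b. A a b + H a b) y \<nu>" "(\<Sum>i<n. \<bar>\<nu> i\<bar>) \<le> (\<Sum>i<n. l i)"
    and M: "herm n M" "form_bound n M S"
  shows "tr n M H \<le> 3 * sqrt r * S * sqrt (\<Sum>a<n. sqnorm n (H a))"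
proof -
  define I where "I = {i. i < n \<and> l i \<noteq> 0}"
  have I: "finite I" "card I \<le> r" "\<And>i. i \<in> I \<Longrightarrow> i < n" using A(3) by (auto simp: I_def)
  have q: "orthonormal n I q"
    using A(1) I by (auto simp: eigenbasis_def orthonormal_def)
  define F where "F = (\<Sum>a<n. sqnorm n (H a))"
  have S: "0 \<le> S" using M(2) by (simp add: form_bound_def)
  \<comment> \<open>Here \<open>g i\<close> is \<open>H\<close> applied to \<open>q i\<close>, and
    \<open>p i\<close> is its part orthogonal to the range of \<open>A\<close>. The two sums in
    \<open>K\<close> are therefore \<open>Q H\<close> and \<open>(1 - Q) H Q\<close>. Each of the
    three pieces of \<open>H\<close> contributes the same bound, whence the factor 3.\<close>
  define g where "g i a = lin n (H a) (q i)" for i a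
  define p where "p i a = g i a - (\<Sum>j\<in>I. dot n (q j) (g i) * q j a)" for i a
  define K where "K a b = H a b - (\<Sum>i\<in>I. q i a * cnj (g i b)) - (\<Sum>i\<in>I. p i a * cnj (q i b))" for a b
  have gq: "dot n (g i) (q j) = dot n (q i) (g j)" for i j
    unfolding g_def by (rule dot_herm[OF H, symmetric])
  have pg: "sqnorm n (p i) \<le> sqnorm n (g i)" for i
    unfolding p_def sqnorm_minus_projection[OF q] using sum_nonneg[of I "\<lambda>j. (cmod (dot n (q j) (g i)))\<^sup>2"] by simp
  have gF: "(\<Sum>i\<in>I. sqnorm n (g i)) \<le> F"
    unfolding g_def F_def by (rule sum_sqnorm_image_le[OF q])
  have pF: "(\<Sum>i\<in>I. sqnorm n (p i)) \<le> F"
    by (rule order.trans[OF sum_mono gF]) (rule pg)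
  have qq: "sqnorm n (q i) = 1" if "i \<in> I" for i
    using orthonormalD[OF q that that] unfolding dot_self by simp
  have K_eq: "K a b = H a b - (\<Sum>i\<in>I. q i a * cnj (g i b)) - (\<Sum>i\<in>I. g i a * cnj (q i b))
      + (\<Sum>i\<in>I. \<Sum>j\<in>I. dot n (q j) (g i) * q j a * cnj (q i b))" for a b
    by (simp add: K_def p_def left_diff_distrib sum_subtractf sum_distrib_right)
  have "herm n K"
    unfolding herm_def
  proof (intro allI impI)
    fix a b assume ab: "a < n" "b < n"
    have "(\<Sum>i\<in>I. \<Sum>j\<in>I. cnj (dot n (q j) (g i) * q j a * cnj (q i b)))
      = (\<Sum>i\<in>I. \<Sum>j\<in>I. dot n (q i) (g j) * q i b * cnj (q j a))"
      by (intro sum.cong refl) (simp add: gq mult_ac)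
    also have "\<dots> = (\<Sum>i\<in>I. \<Sum>j\<in>I. dot n (q j) (g i) * q j b * cnj (q i a))"
      by (rule sum.swap)
    finally show "cnj (K a b) = K b a"
      unfolding K_eq using hermD[OF H ab] by (simp add: mult.commute)
  qed
  then obtain v \<mu> where v: "eigenbasis n K v \<mu>" by (rule eigenbasis_exists)
  have linK: "lin n (K a) x = lin n (H a) x - (\<Sum>i\<in>I. q i a * dot n (g i) x) - (\<Sum>i\<in>I. p i a * dot n (q i) x)" for a x
  proof -
    have s: "(\<Sum>b<n. (\<Sum>i\<in>I. z i a * cnj (w i b)) * x b) = (\<Sum>i\<in>I. z i a * dot n (w i) x)" for z w :: "nat \<Rightarrow> nat \<Rightarrow> complex"
      unfolding dot_def sum_distrib_left sum_distrib_right by (subst sum.swap) (simp add: mult_ac)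
    show ?thesis
      unfolding lin_def K_def left_diff_distrib sum_subtractf s ..
  qed
  have Kq: "lin n (K a) (q k) = 0" if "k \<in> I" for a k
  proof -
    have "(\<Sum>i\<in>I. p i a * dot n (q i) (q k)) = (\<Sum>i\<in>I. if i = k then p i a else 0)"
      using that by (intro sum.cong) (auto simp: orthonormalD[OF q])
    then have "lin n (K a) (q k) = g k a - (\<Sum>i\<in>I. q i a * dot n (q i) (g k)) - p k a"
      unfolding linK gq using that I(1) by (simp add: g_def)
    then show ?thesis by (simp add: p_def mult.commute)
  qed
  \<comment> \<open>\<open>K\<close> annihilates the range of \<open>A\<close>, so its eigenvectors
    for nonzero eigenvalues are orthogonal to that range. Those for the eigenvalue 0 need not be,
    which is why \<open>W\<close> is summed over \<open>J\<close> only.\<close>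
  define J where "J = {k. k < n \<and> \<mu> k \<noteq> 0}"
  have J: "finite J" "\<And>k. k \<in> J \<Longrightarrow> k < n" by (auto simp: J_def)
  have vv: "dot n (v j) (v k) = (if j = k then 1 else 0)" if "j \<in> J" "k \<in> J" for j k
    using v J(2) that by (auto simp: eigenbasis_def orthonormal_def)
  have qv: "dot n (q i) (v k) = 0" if "i \<in> I" "k \<in> J" for i k
  proof -
    have "of_real (\<mu> k) * dot n (q i) (v k) = dot n (q i) (\<lambda>a. lin n (K a) (v k))"
      unfolding dot_scale_right[symmetric] using v J(2)[OF that(2)]
      by (intro dot_cong) (auto simp: eigenbasis_def)
    also have "\<dots> = dot n (\<lambda>a. lin n (K a) (q i)) (v k)"
      by (rule dot_herm) fact
    also have "\<dots> = 0" using Kq[OF that(1)] by (simp add: dot_def)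
    finally show ?thesis using that(2) by (simp add: J_def)
  qed
  have vq: "dot n (v k) (q i) = 0" if "i \<in> I" "k \<in> J" for i k
    using qv[OF that] by (metis cnj_dot complex_cnj_zero)
  have quadK: "quad n H (v k) = \<mu> k" if k: "k \<in> J" for k
  proof -
    have "lin n (H a) (v k) = lin n (K a) (v k) + (\<Sum>i\<in>I. dot n (g i) (v k) * q i a)" for a
      unfolding linK using qv[OF _ k] by (simp add: mult.commute)
    then have "dot n (v k) (\<lambda>a. lin n (H a) (v k)) = dot n (v k) (\<lambda>a. lin n (K a) (v k))
        + (\<Sum>i\<in>I. dot n (g i) (v k) * dot n (v k) (q i))"
      by (simp only: dot_add_right dot_sum_right dot_scale_right)
    also have "(\<Sum>i\<in>I. dot n (g i) (v k) * dot n (v k) (q i)) = 0"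
      using vq[OF _ k] by simp
    also have "dot n (v k) (\<lambda>a. lin n (K a) (v k)) = dot n (v k) (\<lambda>a. of_real (\<mu> k) * v k a)"
      using v J(2)[OF k] by (intro dot_cong) (auto simp: eigenbasis_def)
    also have "\<dots> = of_real (\<mu> k)" unfolding dot_scale_right vv[OF k k] by simp
    finally show ?thesis by (simp add: quad_eq_dot)
  qed
  define W where "W a b = (\<Sum>i\<in>I. of_real 1 * q i a * cnj (q i b)) + (\<Sum>k\<in>J. of_real (sgn (\<mu> k)) * v k a * cnj (v k b))" for a b
  have trW: "tr n G W = (\<Sum>i\<in>I. quad n G (q i)) + (\<Sum>k\<in>J. sgn (\<mu> k) * quad n G (v k))" for G
    unfolding W_def tr_add tr_sum_self_outer by simp
  have quadW: "\<bar>quad n W x\<bar> \<le> sqnorm n x" for x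
  proof -
    \<comment> \<open>Bessel's inequality for the joint family bounds \<open>W\<close>; the sum type
      keeps the two index sets apart.\<close>
    have "orthonormal n (I <+> J) (case_sum q v)"
      using I(1) J(1) vv qv vq by (auto simp: orthonormal_def orthonormalD[OF q] split: sum.splits)
    from bessel[OF this, of x]
    have b: "(\<Sum>i\<in>I. (cmod (dot n (q i) x))\<^sup>2) + (\<Sum>k\<in>J. (cmod (dot n (v k) x))\<^sup>2) \<le> sqnorm n x"
      using I(1) J(1) by (simp add: sum.Plus)
    have lo: "lin n (\<lambda>b. \<Sum>i\<in>B. of_real (c i) * z i a * cnj (z i b)) x = (\<Sum>i\<in>B. of_real (c i) * dot n (z i) x * z i a)"
      for B :: "nat set" and c z a
      unfolding lin_def dot_def sum_distrib_left sum_distrib_right by (subst sum.swap) (simp add: mult_ac)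
    have "dot n x (\<lambda>a. lin n (W a) x)
      = (\<Sum>i\<in>I. of_real 1 * dot n (q i) x * dot n x (q i)) + (\<Sum>k\<in>J. of_real (sgn (\<mu> k)) * dot n (v k) x * dot n x (v k))"
    proof -
      have "lin n (W a) x = (\<Sum>i\<in>I. of_real 1 * dot n (q i) x * q i a) + (\<Sum>k\<in>J. of_real (sgn (\<mu> k)) * dot n (v k) x * v k a)" for a
      proof -
        have "lin n (W a) x = lin n (\<lambda>b. \<Sum>i\<in>I. of_real 1 * q i a * cnj (q i b)) x
            + lin n (\<lambda>b. \<Sum>k\<in>J. of_real (sgn (\<mu> k)) * v k a * cnj (v k b)) x"
          by (simp only: lin_def W_def distrib_right sum.distrib)
        then show ?thesis
          unfolding lo[where B = I and c = "\<lambda>_. 1" and z = q] lo[where B = J and c = "\<lambda>k. sgn (\<mu> k)" and z = v] .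
      qed
      then show ?thesis by (simp only: dot_add_right dot_sum_right dot_scale_right)
    qed
    moreover have "dot n z x * dot n x z = of_real ((cmod (dot n z x))\<^sup>2)" for z
      by (metis cnj_dot complex_norm_square)
    ultimately have "quad n W x = (\<Sum>i\<in>I. (cmod (dot n (q i) x))\<^sup>2) + (\<Sum>k\<in>J. sgn (\<mu> k) * (cmod (dot n (v k) x))\<^sup>2)"
      by (simp add: quad_eq_dot mult.assoc del: of_real_power)
    moreover have "\<bar>\<Sum>k\<in>J. sgn (\<mu> k) * (cmod (dot n (v k) x))\<^sup>2\<bar> \<le> (\<Sum>k\<in>J. (cmod (dot n (v k) x))\<^sup>2)"
      by (rule order.trans[OF sum_abs sum_mono]) (auto simp: abs_mult sgn_if)
    moreover have "0 \<le> (\<Sum>i\<in>I. (cmod (dot n (q i) x))\<^sup>2)" by (simp add: sum_nonneg)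
    ultimately show ?thesis using b by linarith
  qed
  have "tr n W (\<lambda>a b. A a b + H a b) \<le> (\<Sum>i<n. \<bar>\<nu> i\<bar>)"
    unfolding tr_eigenbasis[OF Y(1)]
  proof (rule sum_mono)
    fix i assume "i \<in> {..<n}"
    then have "dot n (y i) (y i) = 1" using Y(1) by (auto simp: eigenbasis_def orthonormal_def)
    then have "sqnorm n (y i) = 1" unfolding dot_self by simp
    then have "\<bar>\<nu> i * quad n W (y i)\<bar> \<le> \<bar>\<nu> i\<bar> * 1"
      unfolding abs_mult using quadW[of "y i"] by (intro mult_left_mono) auto
    then show "\<nu> i * quad n W (y i) \<le> \<bar>\<nu> i\<bar>" by linarith
  qed
  moreover have "tr n W A = (\<Sum>i<n. l i)"
  proof -
    have Av: "lin n (A a) (v k) = 0" if a: "a < n" and k: "k \<in> J" for a k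
    proof -
      have "lin n (A a) (v k) = (\<Sum>b<n. (\<Sum>i<n. of_real (l i) * q i a * cnj (q i b)) * v k b)"
        unfolding lin_def using a by (intro sum.cong refl) (simp add: eigenbasis_expand[OF A(1)])
      also have "\<dots> = (\<Sum>i<n. of_real (l i) * q i a * dot n (q i) (v k))"
        unfolding dot_def sum_distrib_left sum_distrib_right by (subst sum.swap) (simp add: mult_ac)
      also have "\<dots> = 0"
        using qv[OF _ k] by (intro sum.neutral) (auto simp: I_def)
      finally show ?thesis .
    qed
    have "quad n A (v k) = 0" if "k \<in> J" for k
      unfolding quad_eq_dot dot_def using Av[OF _ that] by simp
    moreover have "quad n A (q i) = l i" if "i \<in> I" for i
    proof -
      have "dot n (q i) (\<lambda>a. lin n (A a) (q i)) = dot n (q i) (\<lambda>a. of_real (l i) * q i a)"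
        using A(1) I(3)[OF that] by (intro dot_cong) (auto simp: eigenbasis_def)
      then show ?thesis
        using orthonormalD[OF q that that] by (simp add: quad_eq_dot dot_scale_right)
    qed
    ultimately have "tr n W A = (\<Sum>i\<in>I. l i)"
      unfolding tr_commute[of n W] trW by simp
    also have "\<dots> = (\<Sum>i<n. l i)"
      by (rule sum.mono_neutral_left) (auto simp: I_def)
    finally show ?thesis .
  qed
  moreover have "tr n W H = (\<Sum>i\<in>I. quad n H (q i)) + (\<Sum>k\<in>J. \<bar>\<mu> k\<bar>)"
    unfolding tr_commute[of n W] trW by (simp add: quadK sgn_mult_self_eq abs_sgn mult.commute)
  \<comment> \<open>\<open>tr n W A\<close> already equals the nuclear norm of \<open>A\<close>, so
    the assumption on \<open>Y\<close> forces \<open>tr n W H \<le> 0\<close>: the nuclear norm of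
    \<open>K\<close> is at most minus the trace of \<open>H\<close> over the range of
    \<open>A\<close>.\<close>
  ultimately have "(\<Sum>k\<in>J. \<bar>\<mu> k\<bar>) \<le> (\<Sum>i\<in>I. - quad n H (q i))"
    using Y(2) unfolding tr_add sum_negf by linarith
  also have "\<dots> \<le> (\<Sum>i\<in>I. sqrt (sqnorm n (g i)))"
  proof (rule sum_mono)
    fix i assume i: "i \<in> I"
    have "(cmod (dot n (q i) (g i)))\<^sup>2 \<le> (\<Sum>j\<in>I. (cmod (dot n (q j) (g i)))\<^sup>2)"
      using i I(1) by (intro member_le_sum) auto
    also have "\<dots> \<le> sqnorm n (g i)" by (rule bessel[OF q])
    finally have "cmod (dot n (q i) (g i)) \<le> sqrt (sqnorm n (g i))"
      by (rule real_le_rsqrt)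
    then show "- quad n H (q i) \<le> sqrt (sqnorm n (g i))"
      unfolding quad_eq_dot g_def[symmetric] using abs_Re_le_cmod[of "dot n (q i) (g i)"] by linarith
  qed
  also have "\<dots> \<le> sqrt r * sqrt F"
    by (rule sum_sqrt_le[OF _ gF I(2)]) simp
  finally have mu: "(\<Sum>k\<in>J. \<bar>\<mu> k\<bar>) \<le> sqrt r * sqrt F" .
  have "tr n M K = (\<Sum>k<n. \<mu> k * quad n M (v k))" by (rule tr_eigenbasis[OF v])
  also have "\<dots> = (\<Sum>k\<in>J. \<mu> k * quad n M (v k))"
    by (rule sum.mono_neutral_right) (auto simp: J_def)
  also have "\<dots> \<le> (\<Sum>k\<in>J. \<bar>\<mu> k\<bar> * S)"
  proof (rule sum_mono)
    fix k assume k: "k \<in> J"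
    have "sqnorm n (v k) = 1" using vv[OF k k] unfolding dot_self by simp
    then have "\<bar>quad n M (v k)\<bar> \<le> S" using M(2) unfolding form_bound_def by (metis mult.right_neutral)
    then have "\<bar>\<mu> k * quad n M (v k)\<bar> \<le> \<bar>\<mu> k\<bar> * S"
      unfolding abs_mult by (rule mult_left_mono) simp
    then show "\<mu> k * quad n M (v k) \<le> \<bar>\<mu> k\<bar> * S" by linarith
  qed
  also have "\<dots> \<le> sqrt r * sqrt F * S"
    unfolding sum_distrib_right[symmetric] by (rule mult_right_mono[OF mu S])
  finally have 1: "tr n M K \<le> sqrt r * sqrt F * S" .
  \<comment> \<open>Covers both remaining pieces: every rank-one term has a unit vector
    \<open>q i\<close> as one factor, so the products \<open>f i\<close> are the squared norms of
    the \<open>g i\<close> or the \<open>p i\<close>.\<close>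
  have outer: "(\<Sum>i\<in>I. Re (dot n (z i) (\<lambda>a. lin n (M a) (x i)))) \<le> sqrt r * sqrt F * S"
    if "\<And>i. i \<in> I \<Longrightarrow> sqnorm n (x i) * sqnorm n (z i) = f i" "(\<Sum>i\<in>I. f i) \<le> F" for x z f
  proof -
    have f: "0 \<le> f i" if "i \<in> I" for i
      using that \<open>\<And>i. i \<in> I \<Longrightarrow> sqnorm n (x i) * sqnorm n (z i) = f i\<close>[OF that] sqnorm_nonneg[of n "x i"] sqnorm_nonneg[of n "z i"]
      by (metis mult_nonneg_nonneg)
    have "(\<Sum>i\<in>I. Re (dot n (z i) (\<lambda>a. lin n (M a) (x i)))) \<le> (\<Sum>i\<in>I. sqrt (f i) * S)"
    proof (rule sum_mono)
      fix i assume i: "i \<in> I"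
      show "Re (dot n (z i) (\<lambda>a. lin n (M a) (x i))) \<le> sqrt (f i) * S"
        using form_bound_dot[OF M, of "z i" "x i"] unfolding that(1)[OF i, symmetric] real_sqrt_mult
        by (simp add: mult.commute)
    qed
    also have "\<dots> \<le> sqrt r * sqrt F * S"
      unfolding sum_distrib_right[symmetric]
      by (rule mult_right_mono[OF sum_sqrt_le[OF f that(2) I(2)] S])
    finally show ?thesis .
  qed
  have "tr n M H = tr n M (\<lambda>a b. K a b + ((\<Sum>i\<in>I. q i a * cnj (g i b)) + (\<Sum>i\<in>I. p i a * cnj (q i b))))"
    by (rule tr_cong) (simp add: K_def)
  also have "\<dots> = tr n M K + ((\<Sum>i\<in>I. Re (dot n (g i) (\<lambda>a. lin n (M a) (q i)))) + (\<Sum>i\<in>I. Re (dot n (q i) (\<lambda>a. lin n (M a) (p i)))))"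
    unfolding tr_add tr_sum_outer ..
  also have "\<dots> \<le> sqrt r * sqrt F * S + (sqrt r * sqrt F * S + sqrt r * sqrt F * S)"
    by (intro add_mono 1 outer[OF _ gF] outer[OF _ pF]) (simp_all add: qq)
  finally show ?thesis unfolding F_def by (simp add: mult_ac)
qed

subsection \<open>Stable recovery\<close>

text \<open>An eigenvector for a nonzero eigenvalue is the image of a multiple of itself, hence in
  the column space. Orthonormal vectors are independent, so Steinitz replacement against a maximal
  independent set of columns bounds their number.\<close>

lemma card_eigenvectors_le_rank:
  fixes X :: "complex mat"
  assumes X: "X \<in> carrier_mat n n" and q: "orthonormal n I q"
    and l: "\<And>i a. i \<in> I \<Longrightarrow> a < n \<Longrightarrow> lin n (\<lambda>j. X $$ (a, j)) (q i) = l i * q i a"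
    and nz: "\<And>i. i \<in> I \<Longrightarrow> l i \<noteq> 0"
  shows "card I \<le> vec_space.rank n X"
proof -
  interpret V: vec_space "TYPE(complex)" n .
  define w where "w i = vec n (q i)" for i
  have I: "finite I" by (rule orthonormal_finite[OF q])
  have inj: "inj_on w I"
  proof (rule inj_onI, rule ccontr)
    fix i j assume ij: "i \<in> I" "j \<in> I" "w i = w j" "i \<noteq> j"
    have "q i a = q j a" if "a < n" for a
      using arg_cong[OF ij(3), of "\<lambda>v. v $ a"] that by (simp add: w_def)
    then have "dot n (q i) (q i) = dot n (q i) (q j)" by (intro dot_cong) simp_all
    then show False using ij by (simp add: orthonormalD[OF q])
  qed
  have wc: "w ` I \<subseteq> carrier_vec n" by (auto simp: w_def)
  have indpt: "V.lin_indpt (w ` I)"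
  proof (rule V.finite_lin_indpt2)
    fix c assume c: "V.lincomb c (w ` I) = 0\<^sub>v n"
    show "\<forall>v\<in>w ` I. c v = 0"
    proof
      fix v assume "v \<in> w ` I"
      then obtain k where k: "k \<in> I" "v = w k" by blast
      have "(\<Sum>i\<in>I. c (w i) * q i a) = 0" if "a < n" for a
      proof -
        have "(\<Sum>v\<in>w ` I. c v * v $ a) = 0"
          using V.lincomb_index[OF that wc, of c] that unfolding c by simp
        moreover have "w i $ a = q i a" for i using that by (simp add: w_def)
        ultimately show ?thesis
          using sum.reindex[OF inj, of "\<lambda>v. c v * v $ a"] by (simp add: o_def)
      qed
      then have "dot n (q k) (\<lambda>a. \<Sum>i\<in>I. c (w i) * q i a) = dot n (q k) (\<lambda>a. 0)"
        by (intro dot_cong) simp_all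
      moreover have "dot n (q k) (\<lambda>a. \<Sum>i\<in>I. c (w i) * q i a) = (\<Sum>i\<in>I. if i = k then c (w i) else 0)"
        unfolding dot_sum_right dot_scale_right using k(1)
        by (intro sum.cong) (auto simp: orthonormalD[OF q])
      ultimately show "c v = 0" using k I by (simp add: dot_def)
    qed
  qed (use I wc in auto)
  have colsc: "set (cols X) \<subseteq> carrier_vec n" using cols_dim X by blast
  obtain S where S: "maximal S (\<lambda>T. T \<subseteq> set (cols X) \<and> V.lin_indpt T)" "finite S"
    using maximal_exists_superset[of "set (cols X)" "\<lambda>T. T \<subseteq> set (cols X) \<and> V.lin_indpt T" "{}"]
    by (auto simp: V.lin_dep_def)
  have Ssub: "S \<subseteq> set (cols X)" "V.lin_indpt S"
    and Smax: "\<And>B. S \<subseteq> B \<Longrightarrow> B \<subseteq> set (cols X) \<Longrightarrow> V.lin_indpt B \<Longrightarrow> B = S"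
    using S(1) unfolding maximal_def by blast+
  have Sc: "S \<subseteq> carrier_vec n" using Ssub colsc by blast
  have "set (cols X) \<subseteq> V.span S"
  proof
    fix c assume c: "c \<in> set (cols X)"
    show "c \<in> V.span S"
    proof (cases "c \<in> S")
      case True
      then show ?thesis using V.span_mem[OF Sc] by blast
    next
      case False
      then have "S \<union> {c} \<noteq> S" by blast
      then have "V.lin_dep (S \<union> {c})" using Smax[of "S \<union> {c}"] c Ssub by blast
      then show ?thesis using V.lin_dep_iff_in_span[of S c] Sc Ssub(2) c colsc False by auto
    qed
  qed
  then have span: "V.span (set (cols X)) \<subseteq> V.span S" by (rule V.span_subsetI[OF Sc])
  have "w ` I \<subseteq> V.span S"
  proof
    fix v assume "v \<in> w ` I"
    then obtain i where i: "i \<in> I" "v = w i" by blast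
    have "X *\<^sub>v ((1 / l i) \<cdot>\<^sub>v w i) = w i"
    proof (rule eq_vecI)
      fix a assume "a < dim_vec (w i)"
      then have a: "a < n" by (simp add: w_def)
      have "(X *\<^sub>v ((1 / l i) \<cdot>\<^sub>v w i)) $ a = (\<Sum>j<n. X $$ (a, j) * (1 / l i * q i j))"
        using a X by (simp add: scalar_prod_def w_def atLeast0LessThan)
      also have "\<dots> = 1 / l i * lin n (\<lambda>j. X $$ (a, j)) (q i)"
        by (simp add: lin_def sum_distrib_left mult_ac)
      also have "\<dots> = q i a" using l[OF i(1) a] nz[OF i(1)] by simp
      finally show "(X *\<^sub>v ((1 / l i) \<cdot>\<^sub>v w i)) $ a = w i $ a" using a by (simp add: w_def)
    qed (use X in \<open>simp add: w_def\<close>)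
    then have "\<exists>x\<in>carrier_vec (dim_col X). X *\<^sub>v x = w i"
      using X by (intro bexI[of _ "(1 / l i) \<cdot>\<^sub>v w i"]) (auto simp: w_def)
    then have "w i \<in> V.col_space X"
      unfolding V.col_space_eq[OF X] using X by (auto simp: w_def)
    then show "v \<in> V.span S" using span i(2) unfolding V.col_space_def by blast
  qed
  from V.replacement[OF finite_imageI[OF I] S(2) Sc indpt this]
  have "card (w ` I) \<le> card S" by force
  then show ?thesis
    unfolding V.rank_card_indpt[OF X S(1)] card_image[OF inj] .
qed

section \<open>From matrices to coefficient functions\<close>

lemma hermitian_mats_herm:
  assumes "Z \<in> hermitian_mats n"
  shows "herm n (\<lambda>i j. Z $$ (i, j))"
  unfolding herm_def
proof (intro allI impI)
  fix i j assume ij: "i < n" "j < n"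
  have Z: "Z \<in> carrier_mat n n" "mat_adjoint Z = Z" using assms by (auto simp: hermitian_mats_def)
  have "mat_adjoint Z $$ (j, i) = cnj (Z $$ (i, j))"
    using Z(1) ij by (simp add: mat_adjoint_def mat_of_rows_def)
  then show "cnj (Z $$ (i, j)) = Z $$ (j, i)" unfolding Z(2) by simp
qed

lemma measurement_index:
  assumes "Z \<in> carrier_mat n n" "j < m"
  shows "measurement m (\<lambda>j. vec n (\<omega> j)) Z $ j = quad n (\<lambda>i k. Z $$ (i, k)) (\<omega> j)"
  using assms
  by (auto simp: measurement_def mat_trace_def quad_def outer_self_def scalar_prod_def atLeast0LessThan mult_ac
      intro!: sum.cong)

lemma psd_mat_eigenvalue_nonneg:
  assumes X: "psd_mat n X" and e: "eigenbasis n (\<lambda>i j. X $$ (i, j)) q l" and i: "i < n"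
  shows "0 \<le> l i"
proof -
  let ?v = "vec n (q i)"
  have c: "X \<in> carrier_mat n n" using X by (auto simp: psd_mat_def hermitian_mats_def)
  have "(X *\<^sub>v ?v) \<bullet>c ?v = (\<Sum>a<n. (\<Sum>b<n. X $$ (a, b) * q i b) * cnj (q i a))"
    using c by (auto simp: scalar_prod_def atLeast0LessThan intro!: sum.cong)
  also have "\<dots> = dot n (q i) (\<lambda>a. lin n (\<lambda>b. X $$ (a, b)) (q i))"
    by (simp add: dot_def lin_def mult.commute)
  also have "\<dots> = dot n (q i) (\<lambda>a. of_real (l i) * q i a)"
    using e i by (intro dot_cong) (auto simp: eigenbasis_def)
  also have "\<dots> = of_real (l i)"
    using e i by (simp add: dot_scale_right eigenbasis_def orthonormal_def)
  finally have "(X *\<^sub>v ?v) \<bullet>c ?v = of_real (l i)" .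
  moreover have "0 \<le> (X *\<^sub>v ?v) \<bullet>c ?v"
    using X vec_carrier[of n "q i"] unfolding psd_mat_def by blast
  ultimately have "(0 :: complex) \<le> of_real (l i)" by simp
  then show ?thesis by (simp add: less_eq_complex_def)
qed

lemma tr_scale: "tr n M (\<lambda>a b. of_real c * H a b) = c * tr n M H"
proof -
  have "(\<Sum>i<n. \<Sum>j<n. M i j * (of_real c * H j i)) = of_real c * (\<Sum>i<n. \<Sum>j<n. M i j * H j i)"
    by (simp add: sum_distrib_left mult_ac)
  then show ?thesis by (simp add: tr_def)
qed

lemma quad_scale_mat: "quad n (\<lambda>a b. of_real c * H a b) x = c * quad n H x"
proof -
  have "(\<Sum>i<n. \<Sum>j<n. of_real c * H i j * cnj (x i) * x j) = of_real c * (\<Sum>i<n. \<Sum>j<n. H i j * cnj (x i) * x j)"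
    by (simp add: sum_distrib_left mult_ac)
  then show ?thesis by (simp add: quad_def)
qed

lemma quad_diff_mat: "quad n (\<lambda>a b. G a b - H a b) x = quad n G x - quad n H x"
  by (simp add: quad_def left_diff_distrib sum_subtractf)

lemma sum_abs_le_L2_set: "(\<Sum>j<m. \<bar>f j\<bar>) \<le> sqrt (real m) * L2_set f {..<m}"
  unfolding L2_set_def
  using sum_sqrt_le[of "{..<m}" "\<lambda>j. (f j)\<^sup>2" "\<Sum>j<m. (f j)\<^sup>2" m] by simp

text \<open>The deterministic part: the measurements enter through the hypothesis
  \<open>lower\<close> alone.\<close>

lemma recovery:
  assumes r: "1 \<le> r" and m: "0 < m"
    and lower: "\<And>H. H \<in> eff_low_rank n r \<Longrightarrow> real m / 16 \<le> (\<Sum>j<m. trunc (quad n H (\<omega> j)))"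
    and X: "psd_mat n X" "vec_space.rank n X \<le> r"
    and eta: "\<epsilon> \<in> carrier_vec m" "l2_norm \<epsilon> \<le> \<eta>"
    and Y: "is_solution n m (\<lambda>j. vec n (\<omega> j)) (measurement m (\<lambda>j. vec n (\<omega> j)) X + \<epsilon>) \<eta> Y"
  shows "frobenius_norm (X - Y) \<le> 32 * \<eta> / sqrt (real m)"
proof -
  let ?a = "\<lambda>j. vec n (\<omega> j)"
  have Xh: "X \<in> hermitian_mats n" using X by (simp add: psd_mat_def)
  have Yf: "Y \<in> hermitian_mats n" "l2_norm (measurement m ?a Y - (measurement m ?a X + \<epsilon>)) \<le> \<eta>"
    using Y by (auto simp: is_solution_def feasible_set_def)
  have c: "X \<in> carrier_mat n n" "Y \<in> carrier_mat n n" using Xh Yf(1) by (auto simp: hermitian_mats_def)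
  have dm: "dim_vec \<epsilon> = m" "dim_vec (measurement m ?a Z) = m" for Z
    using eta(1) by (auto simp: measurement_def)
  have l2: "l2_norm \<epsilon> = L2_set (\<lambda>j. \<epsilon> $ j) {..<m}" by (simp add: l2_norm_def dm)
  have "l2_norm (measurement m ?a X - (measurement m ?a X + \<epsilon>)) = l2_norm \<epsilon>"
    unfolding l2 by (simp add: l2_norm_def dm L2_set_def)
  then have "X \<in> feasible_set n m ?a (measurement m ?a X + \<epsilon>) \<eta>"
    using Xh eta(2) by (simp add: feasible_set_def)
  then have nuc: "nuclear_norm Y \<le> nuclear_norm X" using Y by (auto simp: is_solution_def)
  define A where "A i j = X $$ (i, j)" for i j
  define H where "H i j = Y $$ (i, j) - X $$ (i, j)" for i j
  have herm: "herm n A" "herm n H" "herm n (\<lambda>i j. Y $$ (i, j))"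
    using hermitian_mats_herm[OF Xh] hermitian_mats_herm[OF Yf(1)] by (auto simp: herm_def A_def H_def)
  have AH: "(\<lambda>i j. A i j + H i j) = (\<lambda>i j. Y $$ (i, j))" by (simp add: A_def H_def)
  obtain q l where ql: "eigenbasis n A q l" using eigenbasis_exists[OF herm(1)] .
  obtain y \<nu> where y: "eigenbasis n (\<lambda>i j. Y $$ (i, j)) y \<nu>" using eigenbasis_exists[OF herm(3)] .
  have l0: "0 \<le> l i" if "i < n" for i
    using psd_mat_eigenvalue_nonneg[OF X(1) ql[unfolded A_def] that] .
  have "(\<Sum>i<n. \<bar>\<nu> i\<bar>) \<le> (\<Sum>i<n. \<bar>l i\<bar>)"
    using nuc unfolding nuclear_norm_eigenbasis[OF Xh ql[unfolded A_def]] nuclear_norm_eigenbasis[OF Yf(1) y] .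
  also have "\<dots> = (\<Sum>i<n. l i)" using l0 by (intro sum.cong) auto
  finally have nl: "(\<Sum>i<n. \<bar>\<nu> i\<bar>) \<le> (\<Sum>i<n. l i)" .
  have "card {i. i < n \<and> l i \<noteq> 0} \<le> vec_space.rank n X"
  proof (rule card_eigenvectors_le_rank[OF c(1)])
    show "orthonormal n {i. i < n \<and> l i \<noteq> 0} q"
      using ql by (auto simp: eigenbasis_def orthonormal_def)
    show "lin n (\<lambda>j. X $$ (a, j)) (q i) = complex_of_real (l i) * q i a" if "i \<in> {i. i < n \<and> l i \<noteq> 0}" "a < n" for i a
      using ql that unfolding A_def by (auto simp: eigenbasis_def)
  qed auto
  then have card: "card {i. i < n \<and> l i \<noteq> 0} \<le> r" using X(2) by simp
  define F where "F = sqrt (\<Sum>a<n. sqnorm n (H a))"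
  have frob: "frobenius_norm (X - Y) = F"
    using c by (simp add: frobenius_norm_def F_def sqnorm_def H_def norm_minus_commute)
  have res: "L2_set (\<lambda>j. quad n H (\<omega> j)) {..<m} \<le> 2 * \<eta>"
  proof -
    let ?d = "\<lambda>j. (measurement m ?a Y - (measurement m ?a X + \<epsilon>)) $ j"
    have "quad n H (\<omega> j) = ?d j + \<epsilon> $ j" if "j < m" for j
    proof -
      have "quad n H (\<omega> j) = measurement m ?a Y $ j - measurement m ?a X $ j"
        unfolding measurement_index[OF c(1) that] measurement_index[OF c(2) that] H_def quad_diff_mat ..
      then show ?thesis using that by (simp add: dm)
    qed
    then have "L2_set (\<lambda>j. quad n H (\<omega> j)) {..<m} = L2_set (\<lambda>j. ?d j + \<epsilon> $ j) {..<m}"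
      by (intro L2_set_cong) auto
    also have "\<dots> \<le> L2_set ?d {..<m} + L2_set (\<lambda>j. \<epsilon> $ j) {..<m}" by (rule L2_set_triangle_ineq)
    also have "\<dots> \<le> \<eta> + \<eta>"
      using Yf(2) eta(2) unfolding l2 by (intro add_mono) (auto simp: l2_norm_def dm)
    finally show ?thesis by simp
  qed
  have F0: "0 \<le> F" by (simp add: F_def sum_nonneg)
  have eta0: "0 \<le> \<eta>" using eta(2) l2 by (metis L2_set_nonneg order.trans)
  show ?thesis
  proof (cases "F = 0")
    case True
    then show ?thesis using eta0 unfolding frob by simp
  next
    case False
    then have F: "0 < F" using F0 by simp
    define G where "G a b = of_real (1 / F) * H a b" for a b
    have "G \<in> eff_low_rank n r"
      unfolding eff_low_rank_def
    proof (intro CollectI conjI allI impI)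
      show "herm n G" using herm(2) by (simp add: herm_def G_def)
      have "(\<Sum>i<n. sqnorm n (G i)) = (1 / F)\<^sup>2 * (\<Sum>i<n. sqnorm n (H i))"
        unfolding G_def sqnorm_scale sum_distrib_left ..
      also have "(\<Sum>i<n. sqnorm n (H i)) = F\<^sup>2" by (simp add: F_def sum_nonneg)
      finally show "(\<Sum>i<n. sqnorm n (G i)) = 1" using F by (simp add: power_divide)
      fix M S assume M: "herm n M" "form_bound n M S"
      have "tr n M H \<le> 3 * sqrt r * S * F"
        unfolding F_def by (rule descent_cone_effective_rank[OF ql l0 card herm(2) y[folded AH] nl M])
      then show "tr n M G \<le> 3 * sqrt r * S"
        unfolding G_def tr_scale using F by (simp add: field_simps)
    qed
    \<comment> \<open>The chain compares the truncated sum with the sum of moduli, then with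
      \<open>sqrt m\<close> times the Euclidean norm, and arrives at
      \<open>m / 16 \<le> 2 * \<eta> * sqrt m / F\<close>; hence the constant 32.\<close>
    then have "real m / 16 \<le> (\<Sum>j<m. trunc (quad n G (\<omega> j)))" by (rule lower)
    also have "\<dots> \<le> (\<Sum>j<m. \<bar>quad n G (\<omega> j)\<bar>)" by (intro sum_mono trunc_bounds)
    also have "\<dots> = 1 / F * (\<Sum>j<m. \<bar>quad n H (\<omega> j)\<bar>)"
      unfolding G_def quad_scale_mat abs_mult sum_distrib_left using F by simp
    also have "\<dots> \<le> 1 / F * (sqrt (real m) * (2 * \<eta>))"
      using F by (intro mult_left_mono order.trans[OF sum_abs_le_L2_set] res) simp_all
    finally have "F * (sqrt (real m) * sqrt (real m)) \<le> 32 * \<eta> * sqrt (real m)"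
      using F by (simp add: field_simps)
    then have "(F * sqrt (real m)) * sqrt (real m) \<le> (32 * \<eta>) * sqrt (real m)"
      by (simp only: mult.assoc)
    then have "F * sqrt (real m) \<le> 32 * \<eta>"
      by (rule mult_right_le_imp_le) (use m in simp)
    then show ?thesis unfolding frob using m by (simp add: field_simps)
  qed
qed

text \<open>Matrices carry the product topology of their entries, of which only finitely many occur
  in the form.\<close>

lemma trunc_quad_continuous: "continuous_on UNIV (\<lambda>H :: nat \<Rightarrow> nat \<Rightarrow> complex. \<Sum>j<m. trunc (quad n H (\<omega> j)))"
proof -
  have [continuous_intros]: "continuous_on UNIV (\<lambda>H :: nat \<Rightarrow> nat \<Rightarrow> complex. H i j)" for i j
    by (rule continuous_on_product_then_coordinatewise, rule continuous_on_product_coordinates)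
  show ?thesis
    unfolding trunc_def quad_def by (intro continuous_intros)
qed

text \<open>The deviation bound does not depend on the number of matrices. It therefore holds along
  an increasing sequence of finite parts of a dense set and, by continuity from below, for the union
  of the bad events.\<close>

lemma uniform_lower_bound_event:
  assumes U: "norming_net n U" and r: "1 \<le> r"
    and m: "0 < m" "384 * 3072 * real r * ln (2 * real (card U)) \<le> real m"
  obtains E where "E \<in> sets (gaussian_vectors n m)"
    "1 - exp (- real m / 512) \<le> measure (gaussian_vectors n m) E"
    "\<And>\<omega> H. \<omega> \<in> E \<Longrightarrow> H \<in> eff_low_rank n r \<Longrightarrow> real m / 16 \<le> (\<Sum>j<m. trunc (quad n H (\<omega> j)))"
proof -
  let ?M = "gaussian_vectors n m"
  interpret M: prob_space ?M
    unfolding gaussian_vectors_def by (intro prob_space_PiM prob_space_complex_gaussian)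
  obtain D where D: "countable D" "D \<subseteq> eff_low_rank n r" "eff_low_rank n r \<subseteq> closure D"
    by (rule separable)
  let ?f = "\<lambda>\<omega> H. \<Sum>j<m. trunc (quad n H (\<omega> j))"
  \<comment> \<open>The intersection with \<open>D\<close> also covers an empty \<open>D\<close>,
    for which \<open>from_nat_into\<close> returns an arbitrary value.\<close>
  define B where "B k = {\<omega> \<in> space ?M. \<exists>H\<in>D \<inter> from_nat_into D ` {..k}. ?f \<omega> H < real m / 16}" for k :: nat
  have Bs [measurable]: "B k \<in> sets ?M" for k
  proof -
    have "finite (D \<inter> from_nat_into D ` {..k})" by simp
    then show ?thesis unfolding B_def gaussian_vectors_def by measurable
  qed
  have Bm: "measure ?M (B k) \<le> exp (- real m / 512)" for k
  proof (cases "D \<inter> from_nat_into D ` {..k} = {}")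
    case True
    then show ?thesis by (simp add: B_def)
  next
    case False
    then show ?thesis unfolding B_def using D(2) by (intro gaussian_deviation[OF U _ _ _ r m]) auto
  qed
  have "(\<lambda>k. measure ?M (B k)) \<longlonglongrightarrow> measure ?M (\<Union>k. B k)"
  proof (rule M.finite_Lim_measure_incseq)
    show "range B \<subseteq> sets ?M" using Bs by blast
    show "incseq B" unfolding incseq_def B_def by fastforce
  qed
  then have le: "measure ?M (\<Union>k. B k) \<le> exp (- real m / 512)"
    by (rule LIMSEQ_le_const2) (use Bm in blast)
  show thesis
  proof (rule that)
    show "space ?M - (\<Union>k. B k) \<in> sets ?M" by measurable
    show "1 - exp (- real m / 512) \<le> measure ?M (space ?M - (\<Union>k. B k))"
      using le by (subst M.prob_compl) auto
    fix \<omega> H assume w: "\<omega> \<in> space ?M - (\<Union>k. B k)" and H: "H \<in> eff_low_rank n r"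
    have "D \<subseteq> {H. real m / 16 \<le> ?f \<omega> H}"
    proof
      fix H assume "H \<in> D"
      then obtain k where "H = from_nat_into D k" using from_nat_into_surj[OF D(1)] by metis
      then have "H \<in> D \<inter> from_nat_into D ` {..k}" using \<open>H \<in> D\<close> by auto
      moreover have "\<omega> \<notin> B k" "\<omega> \<in> space ?M" using w by auto
      ultimately have "\<not> ?f \<omega> H < real m / 16" unfolding B_def by blast
      then show "H \<in> {H. real m / 16 \<le> ?f \<omega> H}" by simp
    qed
    \<comment> \<open>The bound on good samples is not strict, so it passes from \<open>D\<close> to
      its closure.\<close>
    moreover have "closed {H. real m / 16 \<le> ?f \<omega> H}"
      by (intro closed_Collect_le trunc_quad_continuous continuous_on_const)
    ultimately have "closure D \<subseteq> {H. real m / 16 \<le> ?f \<omega> H}" by (rule closure_minimal)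
    then show "real m / 16 \<le> ?f \<omega> H" using H D(3) by blast
  qed
qed

theorem theorem2:
  shows "\<exists>C1 C2 C3 :: real. 0 < C1 \<and> 0 < C2 \<and> 0 < C3 \<and>
    (\<forall>n r m :: nat. 1 \<le> r \<and> r \<le> n \<and> C1 * real n * real r \<le> real m \<longrightarrow>
      (\<exists>E \<in> sets (gaussian_vectors n m).
        1 - exp (- C2 * real m) \<le> measure (gaussian_vectors n m) E \<and>
        (\<forall>\<omega> \<in> E. let a = (\<lambda>j. vec n (\<omega> j)) in
          \<forall>X \<eta> \<epsilon> Y.
            psd_mat n X \<and> vec_space.rank n X \<le> r \<and>
            0 \<le> \<eta> \<and> \<epsilon> \<in> carrier_vec m \<and> l2_norm \<epsilon> \<le> \<eta> \<and>
            is_solution n m a (measurement m a X + \<epsilon>) \<eta> Y \<longrightarrow>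
            frobenius_norm (X - Y) \<le> C3 * \<eta> / sqrt (real m))))"
proof (intro exI conjI allI impI)
  \<comment> \<open>The net has at most \<open>(2 ^ 32 * 9) ^ n\<close> points, so
    \<open>ln (2 * real (card U))\<close> is at most \<open>n * ?L\<close>. The factor
    \<open>384 * 3072\<close> and the rate \<open>1 / 512\<close> come from
    \<open>gaussian_deviation\<close>, and 32 from \<open>recovery\<close>.\<close>
  let ?L = "ln (2 * (2 ^ 32 * 9)) :: real"
  show "0 < 384 * 3072 * ?L" "(0::real) < 1 / 512" "(0::real) < 32" by simp_all
  fix n r m :: nat
  assume "1 \<le> r \<and> r \<le> n \<and> 384 * 3072 * ?L * real n * real r \<le> real m"
  then have r: "1 \<le> r" and n: "0 < n" and m: "384 * 3072 * ?L * real n * real r \<le> real m" by auto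
  have "0 < 384 * 3072 * ?L * real n * real r" using r n by simp
  then have m0: "0 < m" using m by linarith
  obtain U where U: "norming_net n U" "real (card U) \<le> (2 ^ 32 * 9) ^ n"
    using norming_net_exists[OF n] .
  have cU: "0 < card U" using U(1) by (auto simp: norming_net_def card_gt_0_iff)
  \<comment> \<open>The factor 2 is absorbed into the base, as \<open>2 \<le> 2 ^ n\<close> for
    positive \<open>n\<close>.\<close>
  have "2 * real (card U) \<le> 2 ^ n * (2 ^ 32 * 9) ^ n"
    using U(2) n by (intro mult_mono self_le_power) auto
  then have "2 * real (card U) \<le> (2 * (2 ^ 32 * 9)) ^ n"
    by (simp only: power_mult_distrib)
  then have "ln (2 * real (card U)) \<le> ln ((2 * (2 ^ 32 * 9)) ^ n)"
    using cU by (intro iffD2[OF ln_le_cancel_iff] zero_less_power) simp_all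
  also have "\<dots> = real n * ?L" by (rule ln_realpow)
  finally have "384 * 3072 * real r * ln (2 * real (card U)) \<le> 384 * 3072 * real r * (real n * ?L)"
    by (intro mult_left_mono) simp_all
  also have "\<dots> \<le> real m" using m by (simp add: mult_ac)
  finally have m': "384 * 3072 * real r * ln (2 * real (card U)) \<le> real m" .
  obtain E where E: "E \<in> sets (gaussian_vectors n m)"
    "1 - exp (- real m / 512) \<le> measure (gaussian_vectors n m) E"
    "\<And>\<omega> H. \<omega> \<in> E \<Longrightarrow> H \<in> eff_low_rank n r \<Longrightarrow> real m / 16 \<le> (\<Sum>j<m. trunc (quad n H (\<omega> j)))"
    using uniform_lower_bound_event[OF U(1) r m0 m'] by blast
  show "\<exists>E \<in> sets (gaussian_vectors n m).
        1 - exp (- (1 / 512) * real m) \<le> measure (gaussian_vectors n m) E \<and>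
        (\<forall>\<omega> \<in> E. let a = (\<lambda>j. vec n (\<omega> j)) in
          \<forall>X \<eta> \<epsilon> Y.
            psd_mat n X \<and> vec_space.rank n X \<le> r \<and>
            0 \<le> \<eta> \<and> \<epsilon> \<in> carrier_vec m \<and> l2_norm \<epsilon> \<le> \<eta> \<and>
            is_solution n m a (measurement m a X + \<epsilon>) \<eta> Y \<longrightarrow>
            frobenius_norm (X - Y) \<le> 32 * \<eta> / sqrt (real m))"
    unfolding Let_def
  proof (intro bexI[OF _ E(1)] conjI ballI allI impI)
    show "1 - exp (- (1 / 512) * real m) \<le> measure (gaussian_vectors n m) E"
      using E(2) by simp
  qed (elim conjE, rule recovery[OF r m0 E(3)])
qed

end
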